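(* The homeomorphism equivalence relation on $\mathsf{LC}_1(\mathbb{R}^2)$, i.e. of $1$-dimensional locally connected continua in $\mathbb{R}^2$, is not classifiable by countable structures.
   Context: $\mathcal{K}(\mathbb{R}^2)$ is the space of compact subsets of $\mathbb{R}^2$ with the Vietoris topology; $\mathsf{LC}_1(\mathbb{R}^2)\subseteq\mathcal{K}(\mathbb{R}^2)$ is the (Borel) set of locally connected continua (connected nonempty compacta) of covering dimension $1$. The homeomorphism relation relates $K,L$ iff they are homeomorphic. An equivalence relation $E$ on a standard Borel space is classifiable by countable structures if there is a countable relational language $\mathcal{L}$ such that $E$ is Borel reducible to the isomorphism relation of $\mathcal{L}$-structures with universe $\mathbb{N}$. *)

theory Defs
  imports "HOL-Analysis.Analysis"
begin

definition vietoris :: "('a::topological_space) set topology" where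
  "vietoris = topology_generated_by
     ({{K. compact K \<and> K \<subseteq> U} | U. open U} \<union> {{K. compact K \<and> K \<inter> U \<noteq> {}} | U. open U})"

definition K_borel :: "('a::topological_space) set set set" where
  "K_borel = sigma_sets {K. compact K} {B. openin vietoris B}"

definition cov_dim_le :: "('a::topological_space) set \<Rightarrow> nat \<Rightarrow> bool" where
  "cov_dim_le S n \<longleftrightarrow>
     (\<forall>\<U>. finite \<U> \<and> (\<forall>U\<in>\<U>. openin (top_of_set S) U) \<and> \<Union>\<U> = S \<longrightarrow>
        (\<exists>\<V>. finite \<V> \<and> (\<forall>V\<in>\<V>. openin (top_of_set S) V) \<and> \<Union>\<V> = S \<and>
             (\<forall>V\<in>\<V>. \<exists>U\<in>\<U>. V \<subseteq> U) \<and>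
             (\<forall>x\<in>S. card {V\<in>\<V>. x \<in> V} \<le> n + 1)))"

definition covering_dimension :: "('a::topological_space) set \<Rightarrow> nat \<Rightarrow> bool" where
  "covering_dimension S n \<longleftrightarrow> S \<noteq> {} \<and> cov_dim_le S n \<and> (\<forall>m<n. \<not> cov_dim_le S m)"

definition LC1 :: "('a::topological_space) set set" where
  "LC1 = {K. compact K \<and> connected K \<and> K \<noteq> {} \<and> locally connected K \<and> covering_dimension K 1}"

text \<open>Countable relational language: symbols I \<subseteq> nat with arities ar.
Structures with universe nat: R i xs holds only for i \<in> I and length xs = ar i.\<close>
definition Mod :: "nat set \<Rightarrow> (nat \<Rightarrow> nat) \<Rightarrow> (nat \<Rightarrow> nat list \<Rightarrow> bool) set" where
  "Mod I ar = {R. \<forall>i xs. R i xs \<longrightarrow> i \<in> I \<and> length xs = ar i}"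

text \<open>Standard Borel structure of Mod(L): generated by the basic sets {R. R i xs}
(equivalently the Borel sets of the product topology of 2^(\<Union>_i nat^ar i)).\<close>
definition Mod_sets :: "nat set \<Rightarrow> (nat \<Rightarrow> nat) \<Rightarrow> (nat \<Rightarrow> nat list \<Rightarrow> bool) set set" where
  "Mod_sets I ar = sigma_sets (Mod I ar) {{R \<in> Mod I ar. R i xs} | i xs. i \<in> I \<and> length xs = ar i}"

definition iso_struct :: "nat set \<Rightarrow> (nat \<Rightarrow> nat) \<Rightarrow> (nat \<Rightarrow> nat list \<Rightarrow> bool) \<Rightarrow> (nat \<Rightarrow> nat list \<Rightarrow> bool) \<Rightarrow> bool" where
  "iso_struct I ar R S \<longleftrightarrow> (\<exists>\<pi>. bij \<pi> \<and>
     (\<forall>i\<in>I. \<forall>xs. length xs = ar i \<longrightarrow> (R i xs \<longleftrightarrow> S i (map \<pi> xs))))"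

definition classifiable_by_countable_structures ::
  "('a::topological_space) set set \<Rightarrow> ('a set \<Rightarrow> 'a set \<Rightarrow> bool) \<Rightarrow> bool" where
  "classifiable_by_countable_structures X E \<longleftrightarrow>
     (\<exists>(I::nat set) (ar::nat \<Rightarrow> nat) f.
        (\<forall>K\<in>X. f K \<in> Mod I ar) \<and>
        (\<forall>B\<in>Mod_sets I ar. {K\<in>X. f K \<in> B} \<in> K_borel) \<and>
        (\<forall>K\<in>X. \<forall>L\<in>X. E K L \<longleftrightarrow> iso_struct I ar (f K) (f L)))"

end

theory Submission
  imports Defs
begin

text \<open>
The proof produces a family of continua disc x, indexed by the sequences x of natural numbers,
and shows that no Borel invariant with countable structures as values can classify it.

Category part. Suppose that g maps sequences to countable structures in a Borel way and that g x and
g y are isomorphic whenever x and y differ by at most 1 in every coordinate. For a finite set F,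
only countably many classes of the relation ``isomorphic by a map fixing F pointwise'' lie over the
orbit of a point under the Cantor group that flips coordinates along a perfect matching of the
naturals. These classes are analytic, so one of them is comeager in some cylinder, and
generically all changes of late coordinates stay in one class. A sequence of finite changes of
a generic x, with isomorphisms fixing more and more points, converges to a point z far away from x
with g x isomorphic to g z.

Geometric part. Let stair be a continuous monotone function which is constant on a gap for every
rational value, and let base consist of the circles around 0 whose radii lie in no gap, together
with N q equally spaced spokes across the gap at level q, where N q tends to infinity. This is a Peano
continuum with empty interior. The map z \<mapsto> z cis (2 \<pi> \<beta> (stair |z|)) preserves base as soon as
\<beta> is continuous with N q \<beta> q integral. To obtain disc x, attach n + 2 whiskers at a point of the gap at level
1/2^n at the angle 2 \<pi> x n / 2^n. Changing every x n by at most 1 is realised by one such twist.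
The attaching points are recognised by the number of components of their complements, so a
homeomorphism from disc x to disc z matches them, and this fails by continuity when their limits
along two subsequences disagree.
\<close>

section \<open>Baire category in the space of sequences of naturals\<close>


text \<open>A bijection has only countably many possible restrictions to the preimages of a finite
  set, whereas changes of bounded size in infinitely many coordinates have uncountable orbits; this
  is the tension behind turbulence, used here without the general theory. Small changes must thus be
  realisable by homeomorphisms although large ones are not. A change of \<open>x n\<close> by 1
  turns the n-th marked point by \<open>2 * pi / 2 ^ n\<close>; these angles tend to 0, so one
  continuous twist performs all of them. A change from 0 to \<open>2 ^ n div 2\<close> is a half
  turn at every level n > 0 and is visible at the limit circle. A twist by a nonconstant continuous
  angle cannot preserve finitely many spokes at every level of an interval. Hence spokes exist only
  at rational levels, where the angle can be kept commensurable with them, and \<open>stair\<close>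
  stretches each such level to an interval of radii on which the twist is a rigid rotation. The
  unbounded number of spokes serves local connectedness, the dense gaps keep the interior empty and
  the dimension at 1.\<close>

definition cyl :: "nat list \<Rightarrow> (nat \<Rightarrow> nat) set" where
  "cyl s = {y. \<forall>i<length s. y i = s ! i}"

abbreviation pre :: "(nat \<Rightarrow> nat) \<Rightarrow> nat \<Rightarrow> nat list" where
  "pre x n \<equiv> map x [0..<n]"

lemma mem_cyl_pre: "y \<in> cyl (pre x n) \<longleftrightarrow> (\<forall>i<n. y i = x i)"
  by (auto simp: cyl_def)

lemma open_cyl: "open (cyl s)"
proof -
  have "cyl s = (\<Inter>i<length s. {y. y i \<in> {s ! i}})"
    by (auto simp: cyl_def)
  moreover have "open {y :: nat \<Rightarrow> nat. y i \<in> {s ! i}}" for i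
    using open_vimage[OF open_discrete continuous_on_product_coordinates[of i], of "{s!i}"]
    by (simp add: vimage_def)
  ultimately show ?thesis by auto
qed

lemma open_imp_cyl:
  assumes "open U" "x \<in> U"
  obtains n where "cyl (pre x n) \<subseteq> U"
proof -
  obtain X where X: "x \<in> Pi\<^sub>E UNIV X" "finite {i. X i \<noteq> UNIV}" "Pi\<^sub>E UNIV X \<subseteq> U"
    using product_topology_open_contains_basis[OF assms(1)[unfolded open_fun_def] assms(2)]
    unfolding topspace_euclidean by blast
  obtain n where n: "{i. X i \<noteq> UNIV} \<subseteq> {..<n}"
    using finite_nat_iff_bounded X(2) by blast
  have "cyl (pre x n) \<subseteq> Pi\<^sub>E UNIV X"
  proof
    fix y assume y: "y \<in> cyl (pre x n)"
    have "y i \<in> X i" for i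
    proof (cases "i < n")
      case True
      then have "y i = x i" using y by (simp only: mem_cyl_pre)
      moreover have "x i \<in> X i" using X(1) by (rule PiE_mem) simp
      ultimately show ?thesis by simp
    next
      case False then have "X i = UNIV" using n by auto
      then show ?thesis by simp
    qed
    then show "y \<in> Pi\<^sub>E UNIV X" by (simp only: PiE_UNIV_domain Pi_iff) blast
  qed
  then have "cyl (pre x n) \<subseteq> U" using X(3) by (rule subset_trans)
  then show ?thesis by (rule that)
qed

lemma cyl_pre_mono: "m \<le> n \<Longrightarrow> cyl (pre x n) \<subseteq> cyl (pre x m)"
  by (auto simp: mem_cyl_pre)

definition meager :: "(nat \<Rightarrow> nat) set \<Rightarrow> bool" where
  "meager A \<longleftrightarrow> (\<exists>F::nat \<Rightarrow> (nat \<Rightarrow> nat) set. (\<forall>k. closed (F k) \<and> interior (F k) = {}) \<and> A \<subseteq> (\<Union>k. F k))"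

lemma meager_subset: "meager B \<Longrightarrow> A \<subseteq> B \<Longrightarrow> meager A"
  unfolding meager_def by blast

lemma meager_nowhere_dense: "closed A \<Longrightarrow> interior A = {} \<Longrightarrow> meager A"
  unfolding meager_def by (rule exI[of _ "\<lambda>_. A"]) auto

lemma meager_empty [simp]: "meager {}"
  by (rule meager_nowhere_dense) auto

lemma meager_UN:
  fixes A :: "'i::countable \<Rightarrow> (nat \<Rightarrow> nat) set"
  assumes "\<And>i. meager (A i)"
  shows "meager (\<Union>i. A i)"
proof -
  obtain F where F: "\<And>i k. closed (F i k) \<and> interior (F i k) = {}" "\<And>i. A i \<subseteq> (\<Union>k::nat. F i k)"
    using assms unfolding meager_def by metis
  define G where "G = (\<lambda>n. (\<lambda>(i::'i, k). F i k) (from_nat n))"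
  have "closed (G k) \<and> interior (G k) = {}" for k
    using F(1) by (auto simp: G_def split: prod.splits)
  moreover have "(\<Union>i. A i) \<subseteq> (\<Union>n. G n)"
  proof
    fix x assume "x \<in> (\<Union>i. A i)"
    then obtain i k where "x \<in> F i k" using F(2) by blast
    then have "x \<in> G (to_nat (i, k))" by (simp add: G_def)
    then show "x \<in> (\<Union>n. G n)" by blast
  qed
  ultimately show ?thesis unfolding meager_def by blast
qed

lemma meager_Un: "meager A \<Longrightarrow> meager B \<Longrightarrow> meager (A \<union> B)"
  using meager_UN[of "\<lambda>b::bool. if b then A else B"] by (auto simp: UNIV_bool Un_commute)

lemma nat_discrete: "(euclidean :: nat topology) = discrete_topology UNIV"
  by (simp add: topology_eq open_discrete)

lemma completely_metrizable_baire: "completely_metrizable_space (euclidean :: (nat \<Rightarrow> nat) topology)"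
proof -
  have "completely_metrizable_space (product_topology (\<lambda>_::nat. euclidean :: nat topology) UNIV)"
    by (subst completely_metrizable_space_product_topology)
       (simp add: nat_discrete completely_metrizable_space_discrete_topology)
  then show ?thesis by (simp add: euclidean_product_topology)
qed

lemma baire:
  assumes "meager A" "open U" "U \<noteq> {}"
  shows "\<exists>x\<in>U. x \<notin> A"
proof -
  obtain F :: "nat \<Rightarrow> (nat \<Rightarrow> nat) set"
    where F: "\<And>k. closed (F k)" "\<And>k. interior (F k) = {}" "A \<subseteq> (\<Union>k. F k)"
    using assms(1) unfolding meager_def by blast
  have "euclidean interior_of \<Union>(range F) = {}"
    by (rule Baire_category_alt) (use F completely_metrizable_baire in auto)
  then have "interior (\<Union>(range F)) = {}" by simp
  then have "\<not> U \<subseteq> \<Union>(range F)"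
    using assms(2,3) interior_maximal by blast
  then show ?thesis using F(3) by auto
qed

text \<open>Local meagerness suffices because there are only countably many cylinders: those in
  which A is meager have a dense open union W, so A is covered by countably many meager pieces and
  the nowhere dense complement of W.\<close>

lemma meager_localize:
  assumes "\<And>U. open U \<Longrightarrow> U \<noteq> {} \<Longrightarrow> \<exists>V. open V \<and> V \<noteq> {} \<and> V \<subseteq> U \<and> meager (A \<inter> V)"
  shows "meager A"
proof -
  define B where "B = (\<lambda>s. if meager (A \<inter> cyl s) then cyl s else {})"
  define W where "W = (\<Union>s. B s)"
  have "meager (\<Union>s. A \<inter> B s)"
    by (rule meager_UN) (auto simp: B_def)
  moreover have "open W" unfolding W_def B_def by (auto simp: open_cyl)
  moreover have "interior (- W) = {}"
  proof (rule ccontr)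
    assume "interior (- W) \<noteq> {}"
    then obtain V where V: "open V" "V \<noteq> {}" "V \<subseteq> interior (- W)" "meager (A \<inter> V)"
      using assms[of "interior (- W)"] by auto
    then obtain x where "x \<in> V" by auto
    then obtain n where n: "cyl (pre x n) \<subseteq> V" using V(1) open_imp_cyl by blast
    then have "meager (A \<inter> cyl (pre x n))" using V(4) meager_subset by (metis Int_mono order_refl)
    then have "x \<in> W" unfolding W_def B_def by (auto intro!: exI[of _ "pre x n"] simp: mem_cyl_pre)
    then show False using \<open>x \<in> V\<close> V(3) interior_subset by blast
  qed
  moreover from calculation have "meager (- W)"
    by (intro meager_nowhere_dense) (simp_all add: closed_def)
  ultimately have "meager ((\<Union>s. A \<inter> B s) \<union> (- W))"
    by (intro meager_Un)
  then show ?thesis by (rule meager_subset) (auto simp: W_def)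
qed

section \<open>The Baire property and the Souslin operation\<close>

definition bp :: "(nat \<Rightarrow> nat) set \<Rightarrow> bool" where
  "bp A \<longleftrightarrow> (\<exists>U. open U \<and> meager (A - U) \<and> meager (U - A))"

lemma bp_open: "open U \<Longrightarrow> bp U"
  unfolding bp_def by (rule exI[of _ U]) simp

lemma bp_modify:
  assumes "bp A" "meager (A - B)" "meager (B - A)" shows "bp B"
proof -
  obtain U where U: "open U" "meager (A - U)" "meager (U - A)" using assms(1) bp_def by blast
  have "meager (B - U)" by (rule meager_subset[OF meager_Un[OF assms(3) U(2)]]) auto
  moreover have "meager (U - B)" by (rule meager_subset[OF meager_Un[OF assms(2) U(3)]]) auto
  ultimately show ?thesis using U(1) bp_def by blast
qed

lemma bp_closed: assumes "closed D" shows "bp D"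
proof -
  have "meager (D - interior D)"
  proof (rule meager_nowhere_dense)
    show "closed (D - interior D)" using assms by (simp add: closed_Diff)
    have "interior (D - interior D) \<subseteq> interior D" by (rule interior_mono) auto
    moreover have "interior (D - interior D) \<subseteq> D - interior D" by (rule interior_subset)
    ultimately show "interior (D - interior D) = {}" by blast
  qed
  moreover have "interior D - D = {}" using interior_subset by blast
  then have "meager (interior D - D)" by (simp only: meager_empty)
  ultimately show ?thesis unfolding bp_def by (intro exI[of _ "interior D"]) simp
qed

lemma bp_Compl: assumes "bp A" shows "bp (- A)"
proof -
  obtain U where U: "open U" "meager (A - U)" "meager (U - A)" using assms(1) bp_def by blast
  have eq: "- U - - A = A - U" "- A - - U = U - A" by auto
  show ?thesis
  proof (rule bp_modify)
    show "bp (- U)" using U(1) by (intro bp_closed) auto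
    show "meager (- U - - A)" "meager (- A - - U)" by (simp_all only: eq U)
  qed
qed

lemma bp_UN:
  fixes A :: "'i::countable \<Rightarrow> (nat \<Rightarrow> nat) set"
  assumes "\<And>i. bp (A i)" shows "bp (\<Union>i. A i)"
proof -
  obtain U where U: "\<And>i. open (U i)" "\<And>i. meager (A i - U i)" "\<And>i. meager (U i - A i)"
    using assms unfolding bp_def by metis
  have "meager ((\<Union>i. A i) - (\<Union>i. U i))"
    by (rule meager_subset[OF meager_UN[OF U(2)]]) auto
  moreover have "meager ((\<Union>i. U i) - (\<Union>i. A i))"
    by (rule meager_subset[OF meager_UN[OF U(3)]]) auto
  moreover have "open (\<Union>i. U i)" using U(1) by blast
  ultimately show ?thesis unfolding bp_def by blast
qed

lemma bp_Un: assumes "bp A" "bp B" shows "bp (A \<union> B)"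
proof -
  have "bp (\<Union>b::bool. if b then A else B)" by (rule bp_UN) (use assms in simp)
  moreover have "(\<Union>b::bool. if b then A else B) = A \<union> B" by (auto split: if_splits)
  ultimately show ?thesis by (simp only:)
qed

lemma bp_Diff: assumes "bp A" "bp B" shows "bp (A - B)"
proof -
  have "A - B = - (- A \<union> B)" by auto
  then show ?thesis using bp_Compl[OF bp_Un[OF bp_Compl[OF assms(1)] assms(2)]] by (simp only:)
qed

lemma bp_borel: assumes "A \<in> sets borel" shows "bp A"
proof -
  have "A \<in> sigma_sets UNIV {S. open S}" using assms by (simp add: sets_borel)
  then show ?thesis
  proof (induction rule: sigma_sets.induct)
    case (Basic a) then show ?case by (auto intro: bp_open)
  next
    case Empty then show ?case by (auto intro: bp_open)
  next
    case (Compl a) then show ?case using bp_Compl[of a] by (metis Compl_eq_Diff_UNIV)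
  next
    case (Union a) then show ?case by (auto intro: bp_UN)
  qed
qed

text \<open>Turns non-meagerness into comeagerness on a smaller open set: modulo meager sets A is
  open, and the part of that open set inside W cannot be empty.\<close>

lemma bp_nonmeager:
  assumes "bp A" "\<not> meager (A \<inter> W)" "open W"
  obtains V where "open V" "V \<noteq> {}" "V \<subseteq> W" "meager (V - A)"
proof -
  obtain U where U: "open U" "meager (A - U)" "meager (U - A)" using assms(1) bp_def by blast
  have "U \<inter> W \<noteq> {}"
  proof
    assume "U \<inter> W = {}"
    then have "A \<inter> W \<subseteq> A - U" by auto
    then show False using U(2) assms(2) meager_subset by blast
  qed
  moreover have "meager (U \<inter> W - A)" using U(3) by (rule meager_subset) auto
  ultimately show ?thesis using that[of "U \<inter> W"] U(1) assms(3) by auto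
qed

text \<open>The points none of whose open neighbourhoods meets S in a meager set. This closed set
  contains S up to a meager set and serves as a hull of S with the Baire property.\<close>

definition env :: "(nat \<Rightarrow> nat) set \<Rightarrow> (nat \<Rightarrow> nat) set" where
  "env S = - \<Union>{V. open V \<and> meager (V \<inter> S)}"

lemma closed_env: "closed (env S)"
  unfolding env_def by (auto simp: closed_def)

lemma env_disjoint: "open V \<Longrightarrow> meager (V \<inter> S) \<Longrightarrow> V \<inter> env S = {}"
  unfolding env_def by auto

lemma meager_Diff_env: "meager (S - env S)"
proof -
  have "meager (\<Union>s. if meager (cyl s \<inter> S) then cyl s \<inter> S else {})"
    by (rule meager_UN) auto
  moreover have "S - env S \<subseteq> (\<Union>s. if meager (cyl s \<inter> S) then cyl s \<inter> S else {})"
  proof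
    fix x assume x: "x \<in> S - env S"
    then obtain V where V: "open V" "meager (V \<inter> S)" "x \<in> V" unfolding env_def by auto
    obtain n where "cyl (pre x n) \<subseteq> V" using V open_imp_cyl by blast
    then have "meager (cyl (pre x n) \<inter> S)" using V(2) by (meson Int_mono meager_subset order_refl)
    then show "x \<in> (\<Union>s. if meager (cyl s \<inter> S) then cyl s \<inter> S else {})"
      using x by (auto intro!: exI[of _ "pre x n"] simp: mem_cyl_pre)
  qed
  ultimately show ?thesis by (rule meager_subset)
qed

text \<open>The classical proof that the Souslin operation preserves the Baire property: off a meager set
  every point of the envelope of the projection lies on a branch of envelopes.\<close>

lemma bp_analytic:
  fixes P :: "((nat \<Rightarrow> nat) \<times> (nat \<Rightarrow> nat)) set"
  assumes C: "meager (- C)"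
    and closed: "\<And>x a. x \<in> C \<Longrightarrow>
      (\<And>n U. open U \<Longrightarrow> x \<in> U \<Longrightarrow> \<exists>x'\<in>U \<inter> C. \<exists>a'. (\<forall>i<n. a' i = a i) \<and> (x', a') \<in> P) \<Longrightarrow> (x, a) \<in> P"
  shows "bp {x\<in>C. \<exists>a. (x, a) \<in> P}"
proof -
  define A where "A s = {x\<in>C. \<exists>a\<in>cyl s. (x, a) \<in> P}" for s
  \<comment> \<open>A point of \<open>T s\<close> is one where a branch of envelopes that has
    reached the node s cannot be prolonged; outside all \<open>T s\<close> a branch can be continued
    for ever.\<close>
  define T where "T s = env (A s) - (\<Union>k. env (A (s @ [k])))" for s
  have T: "meager (T s)" for s
  proof (rule ccontr)
    assume nm: "\<not> meager (T s)"
    have bpT: "bp (T s)" unfolding T_def by (rule bp_Diff[OF bp_closed[OF closed_env] bp_UN[OF bp_closed[OF closed_env]]])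
    have nm': "\<not> meager (T s \<inter> UNIV)" using nm by simp
    obtain V where V: "open V" "V \<noteq> {}" "meager (V - T s)"
      by (rule bp_nonmeager[OF bpT nm' open_UNIV])
    have split: "A s \<subseteq> (\<Union>k. A (s @ [k]))"
    proof
      fix x assume "x \<in> A s"
      then obtain a where a: "x \<in> C" "a \<in> cyl s" "(x, a) \<in> P" by (auto simp: A_def)
      then have "a \<in> cyl (s @ [a (length s)])" by (auto simp: cyl_def nth_append less_Suc_eq)
      then show "x \<in> (\<Union>k. A (s @ [k]))" using a by (auto simp: A_def)
    qed
    have "V \<inter> A s \<subseteq> (V - T s) \<union> (\<Union>k. A (s @ [k]) - env (A (s @ [k])))"
      using split by (auto simp: T_def)
    moreover have "meager ((V - T s) \<union> (\<Union>k. A (s @ [k]) - env (A (s @ [k]))))"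
      by (rule meager_Un[OF V(3) meager_UN[OF meager_Diff_env]])
    ultimately have "meager (V \<inter> A s)" using meager_subset by blast
    then have "V \<inter> T s = {}" using env_disjoint V(1) by (auto simp: T_def)
    then have "meager V" using V(3) by (simp add: Diff_triv)
    then show False using baire[of V V] V(1,2) by blast
  qed
  have "env (A []) - {x\<in>C. \<exists>a. (x, a) \<in> P} \<subseteq> - C \<union> (\<Union>s. T s)"
  proof (rule subsetI, rule ccontr)
    fix x assume x: "x \<in> env (A []) - {x\<in>C. \<exists>a. (x, a) \<in> P}" and nx: "x \<notin> - C \<union> (\<Union>s. T s)"
    have step: "\<exists>k. x \<in> env (A (s @ [k]))" if "x \<in> env (A s)" for s
      using that nx by (auto simp: T_def)
    define sel where "sel s = (SOME k. x \<in> env (A (s @ [k])))" for s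
    have sel: "x \<in> env (A (s @ [sel s]))" if "x \<in> env (A s)" for s
      unfolding sel_def using step[OF that] by (rule someI_ex)
    define L where "L = rec_nat [] (\<lambda>_ s. s @ [sel s])"
    have L0: "L 0 = []" and LS: "L (Suc n) = L n @ [sel (L n)]" for n by (auto simp: L_def)
    define a where "a n = sel (L n)" for n
    have La: "L n = pre a n" for n by (induction n) (auto simp: L0 LS a_def)
    have Lx: "x \<in> env (A (L n))" for n by (induction n) (use x sel in \<open>auto simp: L0 LS\<close>)
    have "(x, a) \<in> P"
    proof (rule closed)
      show "x \<in> C" using nx by auto
      fix n U assume U: "open U" "x \<in> U"
      \<comment> \<open>The envelope avoids every open set in which the set itself is meager, in
        particular empty, but x lies in U and in the envelope.\<close>
      have "U \<inter> A (pre a n) \<noteq> {}"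
      proof
        assume "U \<inter> A (pre a n) = {}"
        then have "U \<inter> env (A (pre a n)) = {}" using env_disjoint[OF U(1)] by simp
        then show False using Lx[of n] U(2) La by auto
      qed
      then obtain x' a' where "x' \<in> U \<inter> C" "a' \<in> cyl (pre a n)" "(x', a') \<in> P"
        unfolding A_def by auto
      then show "\<exists>x'\<in>U \<inter> C. \<exists>a'. (\<forall>i<n. a' i = a i) \<and> (x', a') \<in> P"
        unfolding mem_cyl_pre by blast
    qed
    then show False using x nx by auto
  qed
  moreover have "meager (- C \<union> (\<Union>s. T s))" by (rule meager_Un[OF C meager_UN[OF T]])
  ultimately have 1: "meager (env (A []) - {x\<in>C. \<exists>a. (x, a) \<in> P})" by (rule meager_subset[rotated])
  have 2: "A [] = {x\<in>C. \<exists>a. (x, a) \<in> P}" by (auto simp: A_def cyl_def)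
  show ?thesis
    by (rule bp_modify[OF bp_closed[OF closed_env[of "A []"]]]) (use 1 meager_Diff_env[of "A []"] 2 in auto)
qed

section \<open>Isomorphisms with prescribed values\<close>


text \<open>T is a set of prescribed argument-value pairs and not just a set of fixed points:
  \<open>B_local\<close> prescribes preimages by pairs \<open>(t ! i, i)\<close>, and the identity
  on a set A is the case \<open>Id_on A\<close>.\<close>

definition isoT :: "nat set \<Rightarrow> (nat \<Rightarrow> nat) \<Rightarrow> (nat \<times> nat) set \<Rightarrow>
    (nat \<Rightarrow> nat list \<Rightarrow> bool) \<Rightarrow> (nat \<Rightarrow> nat list \<Rightarrow> bool) \<Rightarrow> bool" where
  "isoT I ar T R S \<longleftrightarrow> (\<exists>\<pi>. bij \<pi> \<and> (\<forall>(i, j)\<in>T. \<pi> i = j) \<and>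
     (\<forall>i\<in>I. \<forall>xs. length xs = ar i \<longrightarrow> (R i xs \<longleftrightarrow> S i (map \<pi> xs))))"

lemma isoT_empty: "isoT I ar {} = iso_struct I ar"
  by (intro ext) (simp add: isoT_def iso_struct_def)

lemma isoT_refl: "isoT I ar (Id_on A) R R"
  unfolding isoT_def by (rule exI[of _ id]) (auto simp: Id_on_def)

text \<open>Two isomorphisms p and q out of the same R with the same prescribed preimages of A give
  \<open>q \<circ> inv p\<close>, which fixes A pointwise. This is how countably many prescriptions
  control the relation of being isomorphic over A; symmetry and transitivity are special
  cases.\<close>

lemma isoT_compose:
  assumes "isoT I ar T R S" "isoT I ar T R S'" "\<And>i. i \<in> A \<Longrightarrow> \<exists>k. (k, i) \<in> T"
  shows "isoT I ar (Id_on A) S S'"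
proof -
  obtain p where p: "bij p" "\<forall>(i, j)\<in>T. p i = j"
      "\<And>i xs. i \<in> I \<Longrightarrow> length xs = ar i \<Longrightarrow> R i xs \<longleftrightarrow> S i (map p xs)"
    using assms(1) unfolding isoT_def by blast
  obtain q where q: "bij q" "\<forall>(i, j)\<in>T. q i = j"
      "\<And>i xs. i \<in> I \<Longrightarrow> length xs = ar i \<Longrightarrow> R i xs \<longleftrightarrow> S' i (map q xs)"
    using assms(2) unfolding isoT_def by blast
  have pinv: "p (inv p x) = x" for x using p(1) by (meson bij_inv_eq_iff)
  have "S i xs \<longleftrightarrow> S' i (map (q \<circ> inv p) xs)" if "i \<in> I" "length xs = ar i" for i xs
    using p(3)[of i "map (inv p) xs"] q(3)[of i "map (inv p) xs"] that
    by (simp add: comp_def pinv)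
  moreover have "bij (q \<circ> inv p)" using p(1) q(1) by (simp add: bij_comp bij_imp_bij_inv)
  moreover have "(q \<circ> inv p) i = i" if i: "i \<in> A" for i
  proof -
    obtain k where "(k, i) \<in> T" using assms(3) i by blast
    then have "p k = i" "q k = i" using p(2) q(2) by auto
    then show ?thesis using p(1) by (metis bij_inv_eq_iff comp_apply)
  qed
  ultimately show ?thesis unfolding isoT_def by (intro exI[of _ "q \<circ> inv p"]) (auto simp: Id_on_def)
qed

lemma isoT_sym: "isoT I ar (Id_on A) R S \<Longrightarrow> isoT I ar (Id_on A) S R"
  by (rule isoT_compose[OF _ isoT_refl]) auto

lemma isoT_trans:
  "isoT I ar (Id_on A) R S \<Longrightarrow> isoT I ar (Id_on A) S T \<Longrightarrow> isoT I ar (Id_on A) R T"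
  by (rule isoT_compose[OF isoT_sym]) auto

section \<open>Finite modifications, invariant meager sets and coordinate flips\<close>

definition fm :: "(nat \<Rightarrow> nat) \<Rightarrow> (nat \<Rightarrow> nat) \<Rightarrow> bool" where
  "fm x y \<longleftrightarrow> finite {n. x n \<noteq> y n}"

lemma fm_sym: "fm x y \<Longrightarrow> fm y x"
  by (simp add: fm_def eq_commute)

lemma fm_trans: assumes "fm x y" "fm y z" shows "fm x z"
proof -
  have "{n. x n \<noteq> z n} \<subseteq> {n. x n \<noteq> y n} \<union> {n. y n \<noteq> z n}" by auto
  then show ?thesis using assms unfolding fm_def by (meson finite_Un finite_subset)
qed

lemma fmI: "(\<And>n. n \<ge> m \<Longrightarrow> x n = y n) \<Longrightarrow> fm x y"
  unfolding fm_def by (rule finite_subset[of _ "{..<m}"]) (auto intro: leI)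

lemma fmD: assumes "fm x y" shows "\<exists>m. \<forall>n\<ge>m. x n = y n"
proof -
  obtain m where "{n. x n \<noteq> y n} \<subseteq> {..<m}" using assms unfolding fm_def finite_nat_iff_bounded by blast
  then have "x n = y n" if "n \<ge> m" for n using that by fastforce
  then show ?thesis by blast
qed

text \<open>Non-expansive for the usual ultrametric on sequences. This strong form of continuity
  holds for overwriting a prefix, for \<open>act\<close> in its group argument and for
  \<open>flip\<close>, and it is easy to check coordinatewise.\<close>

definition nonexp :: "((nat \<Rightarrow> nat) \<Rightarrow> (nat \<Rightarrow> nat)) \<Rightarrow> bool" where
  "nonexp f \<longleftrightarrow> (\<forall>n x x'. (\<forall>i<n. x i = x' i) \<longrightarrow> (\<forall>i<n. f x i = f x' i))"

lemma nonexp_open: assumes "nonexp f" "open U" shows "open {x. f x \<in> U}"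
proof (subst open_subopen, rule ballI)
  fix x assume "x \<in> {x. f x \<in> U}"
  then obtain n where n: "cyl (pre (f x) n) \<subseteq> U" using open_imp_cyl[OF assms(2)] by blast
  have "cyl (pre x n) \<subseteq> {x. f x \<in> U}"
  proof
    fix x' assume "x' \<in> cyl (pre x n)"
    then have "\<forall>i<n. f x' i = f x i" using assms(1) unfolding nonexp_def mem_cyl_pre by blast
    then have "f x' \<in> cyl (pre (f x) n)" by (simp only: mem_cyl_pre)
    then show "x' \<in> {x. f x \<in> U}" using n by blast
  qed
  then show "\<exists>T. open T \<and> x \<in> T \<and> T \<subseteq> {x. f x \<in> U}"
    by (intro exI[of _ "cyl (pre x n)"]) (simp add: open_cyl mem_cyl_pre)
qed

lemma nonexp_closed: assumes "nonexp f" "closed U" shows "closed {x. f x \<in> U}"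
proof -
  have "open {x. f x \<in> - U}" using assms by (intro nonexp_open) auto
  then show ?thesis by (simp add: closed_def Collect_neg_eq[symmetric])
qed

text \<open>A meager F-sigma set kept as the sequence of its closed pieces, since
  \<open>generic_step\<close> escapes from one piece at a time. Invariance under finite modification
  makes every finite modification of a generic point generic.\<close>

definition fam :: "(nat \<Rightarrow> (nat \<Rightarrow> nat) set) \<Rightarrow> bool" where
  "fam F \<longleftrightarrow> (\<forall>k. closed (F k) \<and> interior (F k) = {}) \<and>
     (\<forall>x y. fm x y \<longrightarrow> x \<in> (\<Union>k. F k) \<longrightarrow> y \<in> (\<Union>k. F k))"

lemma meager_fam: "fam F \<Longrightarrow> meager (\<Union>k. F k)"
  unfolding fam_def meager_def by blast

lemma interior_empty_cyl:
  assumes "\<And>x n. \<exists>y\<in>cyl (pre x n). y \<notin> A" shows "interior A = {}"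
proof (rule ccontr)
  assume "interior A \<noteq> {}"
  then obtain x where "x \<in> interior A" by auto
  then obtain n where "cyl (pre x n) \<subseteq> interior A" using open_imp_cyl open_interior by metis
  then show False using assms[of x n] interior_subset by blast
qed

text \<open>There are only countably many finite prefixes s, and overwriting by s
  (\<open>ov s\<close>) pulls a closed nowhere dense set back to a closed nowhere dense one: a
  nearby point outside the set is found beyond the prefix, and the original prefix is put
  back.\<close>

lemma meager_saturate:
  assumes "meager M"
  obtains F where "fam F" "M \<subseteq> (\<Union>k. F k)"
proof -
  obtain G :: "nat \<Rightarrow> (nat \<Rightarrow> nat) set"
    where G: "\<And>k. closed (G k)" "\<And>k. interior (G k) = {}" "M \<subseteq> (\<Union>k. G k)"
    using assms unfolding meager_def by blast
  define ov where "ov s x = (\<lambda>i. if i < length s then s ! i else x i :: nat)" for s x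
  define H where "H p = {x. ov (snd p) x \<in> G (fst p)}" for p :: "nat \<times> nat list"
  define F where "F k = H (from_nat k)" for k
  have FH: "(\<Union>k. F k) = (\<Union>p. H p)"
  proof (rule antisym; rule subsetI)
    fix x assume "x \<in> (\<Union>p. H p)"
    then obtain p where "x \<in> H p" by blast
    then have "x \<in> F (to_nat p)" by (simp add: F_def)
    then show "x \<in> (\<Union>k. F k)" by blast
  next
    fix x assume "x \<in> (\<Union>k. F k)"
    then obtain k where "x \<in> H (from_nat k)" by (auto simp: F_def)
    then show "x \<in> (\<Union>p. H p)" by blast
  qed
  have "closed (H p)" for p
    unfolding H_def by (rule nonexp_closed) (auto simp: nonexp_def ov_def G)
  moreover have "interior (H p) = {}" for p
  proof (rule interior_empty_cyl)
    fix x n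
    define m where "m = max n (length (snd p))"
    have "\<not> cyl (pre (ov (snd p) x) m) \<subseteq> G (fst p)"
    proof
      assume "cyl (pre (ov (snd p) x) m) \<subseteq> G (fst p)"
      then have "cyl (pre (ov (snd p) x) m) \<subseteq> {}"
        using interior_maximal[OF _ open_cyl] G(2) by metis
      moreover have "ov (snd p) x \<in> cyl (pre (ov (snd p) x) m)" by (simp add: mem_cyl_pre)
      ultimately show False by blast
    qed
    then obtain y where y: "\<forall>i<m. y i = ov (snd p) x i" "y \<notin> G (fst p)"
      unfolding mem_cyl_pre subset_iff by blast
    define y' where "y' i = (if i < length (snd p) then x i else y i)" for i
    have "ov (snd p) y' = y"
      using y(1) by (auto simp: ov_def y'_def m_def fun_eq_iff)
    moreover have "y' \<in> cyl (pre x n)"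
      unfolding mem_cyl_pre using y(1) by (auto simp: ov_def y'_def m_def)
    ultimately show "\<exists>y\<in>cyl (pre x n). y \<notin> H p" using y(2) by (auto simp: H_def)
  qed
  moreover have "y \<in> (\<Union>p. H p)" if xy: "fm x y" and x: "x \<in> (\<Union>p. H p)" for x y
  proof -
    obtain k s where ks: "ov s x \<in> G k" using x by (auto simp: H_def)
    obtain m where m: "\<forall>n\<ge>m. x n = y n" using fmD[OF xy] by blast
    define m' where "m' = max m (length s)"
    have "ov (pre (ov s x) m') y = ov s x"
      using m by (auto simp: ov_def m'_def fun_eq_iff)
    then have "y \<in> H (k, pre (ov s x) m')" using ks by (simp add: H_def)
    then show ?thesis by blast
  qed
  ultimately have "fam F" unfolding fam_def FH by (simp add: F_def)
  moreover have "M \<subseteq> (\<Union>p. H p)"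
  proof
    fix x assume "x \<in> M"
    then obtain k where "x \<in> G k" using G(3) by blast
    then have "x \<in> H (k, [])" by (simp add: H_def ov_def)
    then show "x \<in> (\<Union>p. H p)" by blast
  qed
  ultimately show ?thesis using FH by (intro that[of F]) simp_all
qed

text \<open>For c true it swaps 2i and 2i + 1; for c false it swaps 2i + 1 and 2i + 2 and fixes 0,
  because truncated subtraction gives 0 - 1 = 0. Each single matching yields commuting involutions,
  while the two together connect all naturals by steps of size 1.\<close>

definition tw :: "bool \<Rightarrow> nat \<Rightarrow> nat" where
  "tw c k = (if even k = c then Suc k else k - 1)"

lemma tw_tw [simp]: "tw c (tw c k) = k"
  by (cases k) (auto simp: tw_def)

lemma tw_near: "tw c k \<le> Suc k" "k \<le> Suc (tw c k)"
  by (auto simp: tw_def)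

text \<open>The Cantor group acts through the parities of the entries of e, so that no second sequence space is needed.\<close>

definition act :: "bool \<Rightarrow> (nat \<Rightarrow> nat) \<Rightarrow> (nat \<Rightarrow> nat) \<Rightarrow> (nat \<Rightarrow> nat)" where
  "act c e y = (\<lambda>n. if odd (e n) then tw c (y n) else y n)"

definition flip :: "bool \<Rightarrow> nat \<Rightarrow> (nat \<Rightarrow> nat) \<Rightarrow> (nat \<Rightarrow> nat)" where
  "flip c n y = y(n := tw c (y n))"

lemma flip_act: "flip c n (act c e y) = act c (e(n := Suc (e n))) y"
  by (auto simp: flip_def act_def fun_eq_iff)

lemma nonexp_act: "nonexp (\<lambda>e. act c e y)"
  by (auto simp: nonexp_def act_def)

lemma nonexp_flip: "nonexp (flip c n)"
  by (auto simp: nonexp_def flip_def)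

lemma fm_flip: "fm x (flip c n x)"
  by (rule fmI[of "Suc n"]) (auto simp: flip_def)

text \<open>Every cylinder of group elements contains one whose later entries are all even. It
  changes y in finitely many coordinates only, so by invariance it does not move y into the
  exceptional set.\<close>

lemma meager_act:
  assumes "fam F" "y \<notin> (\<Union>k. F k)"
  shows "meager {e. act c e y \<in> (\<Union>k. F k)}"
proof -
  have "meager {e. act c e y \<in> F k}" for k
  proof (rule meager_nowhere_dense)
    show "closed {e. act c e y \<in> F k}"
      using assms(1) by (intro nonexp_closed nonexp_act) (simp add: fam_def)
    show "interior {e. act c e y \<in> F k} = {}"
    proof (rule interior_empty_cyl)
      fix e :: "nat \<Rightarrow> nat" and n
      define e' where "e' i = (if i < n then e i else 0)" for i
      have "fm y (act c e' y)" by (rule fmI[of n]) (auto simp: act_def e'_def)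
      then have "act c e' y \<notin> (\<Union>k. F k)" using assms fm_sym unfolding fam_def by blast
      moreover have "e' \<in> cyl (pre e n)" by (simp add: mem_cyl_pre e'_def)
      ultimately show "\<exists>e'\<in>cyl (pre e n). e' \<notin> {e. act c e y \<in> F k}" by auto
    qed
  qed
  then have "meager (\<Union>k. {e. act c e y \<in> F k})" by (rule meager_UN)
  then show ?thesis by (rule meager_subset) auto
qed

section \<open>Generic rigidity of Borel homomorphisms\<close>


text \<open>Raising one entry by 1 is a homeomorphism onto the clopen set where that entry is
  positive, so it pulls nowhere dense closed sets back to such sets. Raising an entry changes its
  parity and hence flips the corresponding coordinate under \<open>act\<close>.\<close>

lemma meager_bump:
  assumes "meager M"
  shows "meager {e. e(k := Suc (e k)) \<in> M}"
proof -
  obtain G :: "nat \<Rightarrow> (nat \<Rightarrow> nat) set"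
    where G: "\<And>j. closed (G j)" "\<And>j. interior (G j) = {}" "M \<subseteq> (\<Union>j. G j)"
    using assms unfolding meager_def by blast
  have "meager {e. e(k := Suc (e k)) \<in> G j}" for j
  proof (rule meager_nowhere_dense)
    show "closed {e. e(k := Suc (e k)) \<in> G j}"
      by (rule nonexp_closed) (auto simp: nonexp_def G)
    show "interior {e. e(k := Suc (e k)) \<in> G j} = {}"
    proof (rule interior_empty_cyl)
      fix e :: "nat \<Rightarrow> nat" and n
      define e1 where "e1 = e(k := Suc (e k))"
      define m where "m = max n (Suc k)"
      have "\<not> cyl (pre e1 m) \<subseteq> G j"
      proof
        assume "cyl (pre e1 m) \<subseteq> G j"
        then have "cyl (pre e1 m) \<subseteq> {}"
          using interior_maximal[OF _ open_cyl] G(2) by metis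
        moreover have "e1 \<in> cyl (pre e1 m)" by (simp add: mem_cyl_pre)
        ultimately show False by blast
      qed
      then obtain y where y: "\<forall>i<m. y i = e1 i" "y \<notin> G j"
        unfolding mem_cyl_pre subset_iff by blast
      have yk: "y k = Suc (e k)" using y(1) by (auto simp: m_def e1_def)
      have "y(k := e k) \<in> cyl (pre e n)"
        unfolding mem_cyl_pre using y(1) by (auto simp: m_def e1_def)
      moreover have "(y(k := e k))(k := Suc ((y(k := e k)) k)) = y" using yk by auto
      ultimately show "\<exists>e'\<in>cyl (pre e n). e' \<notin> {e. e(k := Suc (e k)) \<in> G j}"
        using y(2) by (intro bexI[of _ "y(k := e k)"]) auto
    qed
  qed
  then have "meager (\<Union>j. {e. e(k := Suc (e k)) \<in> G j})" by (rule meager_UN)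
  then show ?thesis by (rule meager_subset) (use G(3) in auto)
qed

text \<open>\<open>cont\<close> says that g, restricted to the complement of one meager set, is
  continuous: each atomic statement is decided by a prefix. \<open>hom\<close> is assumed for all
  points, not only for generic ones.\<close>

locale generic_iso =
  fixes I :: "nat set" and ar :: "nat \<Rightarrow> nat" and g :: "(nat \<Rightarrow> nat) \<Rightarrow> nat \<Rightarrow> nat list \<Rightarrow> bool"
    and F :: "nat \<Rightarrow> (nat \<Rightarrow> nat) set"
  assumes fam: "fam F"
    and cont: "\<And>x i xs. x \<notin> (\<Union>k. F k) \<Longrightarrow> i \<in> I \<Longrightarrow> length xs = ar i \<Longrightarrow>
      \<exists>n. \<forall>x'. x' \<notin> (\<Union>k. F k) \<longrightarrow> (\<forall>j<n. x' j = x j) \<longrightarrow> g x' i xs = g x i xs"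
    and hom: "\<And>x y. (\<forall>n. x n \<le> Suc (y n) \<and> y n \<le> Suc (x n)) \<Longrightarrow> isoT I ar {} (g x) (g y)"
begin

definition C :: "(nat \<Rightarrow> nat) set" where "C = - (\<Union>k. F k)"

abbreviation iso :: "(nat \<times> nat) set \<Rightarrow> (nat \<Rightarrow> nat) \<Rightarrow> (nat \<Rightarrow> nat) \<Rightarrow> bool" where
  "iso T x y \<equiv> isoT I ar T (g x) (g y)"

abbreviation isoN :: "nat \<Rightarrow> (nat \<Rightarrow> nat) \<Rightarrow> (nat \<Rightarrow> nat) \<Rightarrow> bool" where
  "isoN m \<equiv> iso (Id_on {..<m})"

lemma contC:
  assumes "x \<in> C" "i \<in> I" "length xs = ar i"
  obtains n where "\<And>x'. x' \<in> C \<Longrightarrow> (\<forall>j<n. x' j = x j) \<Longrightarrow> g x' i xs = g x i xs"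
proof -
  have "x \<notin> (\<Union>k. F k)" using assms(1) unfolding C_def by (rule ComplD)
  then obtain n where n: "\<forall>x'. x' \<notin> (\<Union>k. F k) \<longrightarrow> (\<forall>j<n. x' j = x j) \<longrightarrow> g x' i xs = g x i xs"
    using cont[OF _ assms(2,3)] by metis
  show ?thesis
    by (rule that[of n]) (use n in \<open>simp add: C_def\<close>)
qed

lemma fm_C: "fm x y \<Longrightarrow> x \<in> C \<Longrightarrow> y \<in> C"
  using fam fm_sym unfolding fam_def C_def by blast

lemma meager_C: "meager (- C)"
  unfolding C_def using meager_fam[OF fam] by simp

lemma bp_C: "bp C"
  unfolding C_def using fam by (intro bp_Compl bp_UN bp_closed) (simp add: fam_def)

text \<open>An isomorphism is coded by a sequence \<alpha> whose even entries list it and whose odd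
  entries list its inverse. With the inverse included, bijectivity is a closed condition, and by
  continuity on C the whole relation is relatively closed; the set is then its projection and
  \<open>bp_analytic\<close> applies.\<close>

lemma bp_iso:
  assumes a: "nonexp a" and b: "nonexp b" and C0: "meager (- C0)"
    and ab: "\<And>x. x \<in> C0 \<Longrightarrow> a x \<in> C" "\<And>x. x \<in> C0 \<Longrightarrow> b x \<in> C"
  shows "bp {x\<in>C0. iso T (a x) (b x)}"
proof -
  define P where "P = {(x, \<alpha>). (\<forall>i. \<alpha> (Suc (2 * \<alpha> (2 * i))) = i \<and> \<alpha> (2 * \<alpha> (Suc (2 * i))) = i) \<and>
    (\<forall>(i, j)\<in>T. \<alpha> (2 * i) = j) \<and>
    (\<forall>i\<in>I. \<forall>xs. length xs = ar i \<longrightarrow> (g (a x) i xs \<longleftrightarrow> g (b x) i (map (\<lambda>i. \<alpha> (2 * i)) xs)))}"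
  have "{x\<in>C0. iso T (a x) (b x)} = {x\<in>C0. \<exists>\<alpha>. (x, \<alpha>) \<in> P}"
  proof (intro Collect_cong conj_cong refl iffI)
    fix x assume "iso T (a x) (b x)"
    then obtain p where p: "bij p" "\<forall>(i, j)\<in>T. p i = j"
        "\<forall>i\<in>I. \<forall>xs. length xs = ar i \<longrightarrow> (g (a x) i xs \<longleftrightarrow> g (b x) i (map p xs))"
      unfolding isoT_def by blast
    define \<alpha> where "\<alpha> k = (if even k then p (k div 2) else inv p (k div 2))" for k
    have "p (inv p x) = x" "inv p (p x) = x" for x
      using p(1) by (simp_all add: bij_is_inj bij_is_surj surj_f_inv_f)
    then have "(x, \<alpha>) \<in> P" using p by (auto simp: P_def \<alpha>_def)
    then show "\<exists>\<alpha>. (x, \<alpha>) \<in> P" by (intro exI[of _ \<alpha>])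
  next
    fix x assume "\<exists>\<alpha>. (x, \<alpha>) \<in> P"
    then obtain \<alpha> where \<alpha>: "(x, \<alpha>) \<in> P" ..
    have "bij (\<lambda>i. \<alpha> (2 * i))"
      by (rule o_bij[of "\<lambda>i. \<alpha> (Suc (2 * i))"]) (use \<alpha> in \<open>auto simp: P_def fun_eq_iff\<close>)
    then show "iso T (a x) (b x)"
      unfolding isoT_def by (intro exI[of _ "\<lambda>i. \<alpha> (2 * i)"]) (use \<alpha> in \<open>simp add: P_def\<close>)
  qed
  moreover have "bp {x\<in>C0. \<exists>\<alpha>. (x, \<alpha>) \<in> P}"
  proof (rule bp_analytic[OF C0])
    fix x \<alpha> assume x: "x \<in> C0"
      and ap: "\<And>n U. open U \<Longrightarrow> x \<in> U \<Longrightarrow> \<exists>x'\<in>U \<inter> C0. \<exists>\<alpha>'. (\<forall>i<n. \<alpha>' i = \<alpha> i) \<and> (x', \<alpha>') \<in> P"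
    have ap': "\<exists>x'\<in>C0. \<exists>\<alpha>'. (\<forall>i<n. \<alpha>' i = \<alpha> i) \<and> (x', \<alpha>') \<in> P" for n
      using ap[of UNIV n] by auto
    have 1: "\<alpha> (Suc (2 * \<alpha> (2 * i))) = i \<and> \<alpha> (2 * \<alpha> (Suc (2 * i))) = i" for i
    proof -
      \<comment> \<open>Exceeds every position at which \<alpha> is read in the two inverse
        equations for i.\<close>
      define n where "n = Suc (Suc (2 * i) + Suc (2 * \<alpha> (2 * i)) + 2 * \<alpha> (Suc (2 * i)))"
      obtain x' \<alpha>' where *: "\<forall>i<n. \<alpha>' i = \<alpha> i" "(x', \<alpha>') \<in> P" using ap'[of n] by blast
      have e: "\<alpha>' (2 * i) = \<alpha> (2 * i)" "\<alpha>' (Suc (2 * i)) = \<alpha> (Suc (2 * i))"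
        "\<alpha>' (Suc (2 * \<alpha> (2 * i))) = \<alpha> (Suc (2 * \<alpha> (2 * i)))"
        "\<alpha>' (2 * \<alpha> (Suc (2 * i))) = \<alpha> (2 * \<alpha> (Suc (2 * i)))"
        using *(1) by (auto simp: n_def)
      have "\<alpha>' (Suc (2 * \<alpha>' (2 * i))) = i \<and> \<alpha>' (2 * \<alpha>' (Suc (2 * i))) = i"
        using *(2) by (auto simp: P_def)
      then show ?thesis by (simp only: e)
    qed
    have 2: "\<alpha> (2 * i) = j" if "(i, j) \<in> T" for i j
    proof -
      obtain x' \<alpha>' where *: "\<forall>k<Suc (2 * i). \<alpha>' k = \<alpha> k" "(x', \<alpha>') \<in> P"
        using ap'[of "Suc (2 * i)"] by blast
      then show ?thesis using that by (auto simp: P_def)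
    qed
    have 3: "g (a x) i xs \<longleftrightarrow> g (b x) i (map (\<lambda>i. \<alpha> (2 * i)) xs)" if i: "i \<in> I" "length xs = ar i" for i xs
    proof -
      \<comment> \<open>The sum of xs bounds each of its entries, so agreement below n determines
        the image of xs.\<close>
      define n where "n = Suc (2 * sum_list xs)"
      define ys where "ys = map (\<lambda>i. \<alpha> (2 * i)) xs"
      have ys: "length ys = ar i" using i by (simp add: ys_def)
      obtain na where na: "\<And>x'. x' \<in> C \<Longrightarrow> (\<forall>j<na. x' j = a x j) \<Longrightarrow> g x' i xs = g (a x) i xs"
        by (rule contC[OF ab(1)[OF x] i]) blast
      obtain nb where nb: "\<And>x'. x' \<in> C \<Longrightarrow> (\<forall>j<nb. x' j = b x j) \<Longrightarrow> g x' i ys = g (b x) i ys"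
        by (rule contC[OF ab(2)[OF x] i(1) ys]) blast
      define U where "U = {x'. a x' \<in> cyl (pre (a x) na)} \<inter> {x'. b x' \<in> cyl (pre (b x) nb)}"
      have "open U" unfolding U_def by (intro open_Int nonexp_open a b open_cyl)
      moreover have "x \<in> U" by (simp add: U_def mem_cyl_pre)
      ultimately obtain x' \<alpha>' where *: "x' \<in> U" "x' \<in> C0" "\<forall>i<n. \<alpha>' i = \<alpha> i" "(x', \<alpha>') \<in> P"
        using ap[of U n] by blast
      have "2 * j < n" if "j \<in> set xs" for j
        using member_le_sum_list[OF that] by (simp add: n_def)
      then have "map (\<lambda>i. \<alpha>' (2 * i)) xs = ys" using *(3) by (simp add: ys_def)
      moreover have "g (a x') i xs \<longleftrightarrow> g (b x') i (map (\<lambda>i. \<alpha>' (2 * i)) xs)"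
        using *(4) i by (simp add: P_def)
      moreover have "g (a x') i xs = g (a x) i xs"
        using na[OF ab(1)[OF *(2)]] *(1) unfolding U_def mem_cyl_pre by blast
      moreover have "g (b x') i ys = g (b x) i ys"
        using nb[OF ab(2)[OF *(2)]] *(1) unfolding U_def mem_cyl_pre by blast
      ultimately show ?thesis unfolding ys_def[symmetric] by metis
    qed
    show "(x, \<alpha>) \<in> P" unfolding P_def using 1 2 3 by auto
  qed
  ultimately show ?thesis by simp
qed

definition B :: "nat \<Rightarrow> bool \<Rightarrow> nat \<Rightarrow> (nat \<Rightarrow> nat) set" where
  "B m c N = {y\<in>C. \<exists>n\<ge>N. \<not> isoN m y (flip c n y)}"

lemma bp_B: "bp (B m c N)"
proof -
  have "bp {y\<in>C. isoN m y (flip c n y)}" for n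
    by (rule bp_iso) (auto simp: nonexp_def[of "\<lambda>x. x"] nonexp_flip meager_C intro: fm_C[OF fm_flip])
  then have "bp (\<Union>n. C - {y\<in>C. isoN m y (flip c (N + n) y)})"
    by (intro bp_UN bp_Diff bp_C) simp
  moreover have "(\<Union>n. C - {y\<in>C. isoN m y (flip c (N + n) y)}) = B m c N"
    by (auto simp: B_def le_iff_add)
  ultimately show ?thesis by (simp only:)
qed

text \<open>If B m c N were comeager everywhere in U for all N, a generic orbit of the Cantor group would contain
  a cylinder with almost all of its points in one class, although flipping some late coordinate leaves the class.\<close>

lemma B_local:
  assumes U: "open U" "U \<noteq> {}"
  shows "\<exists>V N. open V \<and> V \<noteq> {} \<and> V \<subseteq> U \<and> meager (B m c N \<inter> V)"
proof (rule ccontr)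
  assume "\<not> ?thesis"
  then have nm: "\<not> meager (B m c N \<inter> V)" if "open V" "V \<noteq> {}" "V \<subseteq> U" for V N
    using that by blast
  have mU: "meager (U - B m c N)" for N
  proof (rule ccontr)
    assume "\<not> meager (U - B m c N)"
    then have n: "\<not> meager (- B m c N \<inter> U)" by (simp add: Diff_eq Int_commute)
    obtain V where V: "open V" "V \<noteq> {}" "V \<subseteq> U" "meager (V - - B m c N)"
      by (rule bp_nonmeager[OF bp_Compl[OF bp_B] n U(1)])
    moreover have "V - - B m c N = B m c N \<inter> V" by auto
    ultimately show False using nm[of V N] by simp
  qed
  obtain G where G: "fam G" "(\<Union>N. U - B m c N) \<subseteq> (\<Union>k. G k)"
    by (rule meager_saturate[OF meager_UN[OF mU]])
  obtain y where y: "y \<in> U" "y \<in> C" "y \<notin> (\<Union>k. G k)"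
    using baire[OF meager_Un[OF meager_C meager_fam[OF G(1)]] U] by auto
  define E where "E = {e. act c e y \<in> (\<Union>k. F k)} \<union> {e. act c e y \<in> (\<Union>k. G k)}"
  have mE: "meager E"
    unfolding E_def using y by (intro meager_Un meager_act fam G) (auto simp: C_def)
  define W where "W = {e. act c e y \<in> U}"
  have oW: "open W" unfolding W_def by (rule nonexp_open[OF nonexp_act U(1)])
  have "act c (\<lambda>_. 0) y = y" by (simp add: act_def)
  then have W0: "W \<noteq> {}" using y(1) unfolding W_def by (metis (mono_tags) empty_Collect_eq)
  define C0 where "C0 = {e. act c e y \<in> C}"
  have mC0: "meager (- C0)"
    using mE by (rule meager_subset) (auto simp: C0_def C_def E_def)
  \<comment> \<open>The list t prescribes the preimages of the numbers below m. There are countably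
    many such lists, and two isomorphisms with the same t combine to one that fixes all numbers
    below m.\<close>
  define T where "T t = {(t ! i, i) |i. i < m}" for t :: "nat list"
  define A where "A t = {e\<in>C0. iso (T t) y (act c e y)}" for t
  have bpA: "bp (A t)" for t
    unfolding A_def by (rule bp_iso) (simp_all add: nonexp_act nonexp_def[of "\<lambda>_. y"] mC0 y(2), simp add: C0_def)
  have cover: "W \<subseteq> E \<union> (\<Union>t. A t \<inter> W)"
  proof
    fix e assume e: "e \<in> W"
    show "e \<in> E \<union> (\<Union>t. A t \<inter> W)"
    proof (cases "e \<in> E")
      case False
      then have eC: "e \<in> C0" by (auto simp: E_def C0_def C_def)
      \<comment> \<open>The action of any group element moves every coordinate by at most 1, so the
        full orbit lies in one isomorphism class; only the prescribed preimages vary.\<close>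
      have "iso {} y (act c e y)"
        by (rule hom) (auto simp: act_def tw_near)
      then obtain p where p: "bij p"
          "\<forall>i\<in>I. \<forall>xs. length xs = ar i \<longrightarrow> (g y i xs \<longleftrightarrow> g (act c e y) i (map p xs))"
        unfolding isoT_def by blast
      have "p (inv p i) = i" for i using p(1) by (meson bij_inv_eq_iff)
      then have "\<forall>(i, j)\<in>T (pre (inv p) m). p i = j" by (auto simp: T_def)
      then have "iso (T (pre (inv p) m)) y (act c e y)" unfolding isoT_def using p by blast
      then show ?thesis using eC e by (auto simp: A_def)
    qed simp
  qed
  have "\<exists>t. \<not> meager (A t \<inter> W)"
  proof (rule ccontr)
    assume "\<nexists>t. \<not> meager (A t \<inter> W)"
    then have "meager (E \<union> (\<Union>t. A t \<inter> W))" by (intro meager_Un mE meager_UN) auto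
    then have "meager W" using cover by (rule meager_subset)
    then show False using baire[OF _ oW W0] by blast
  qed
  then obtain t where t: "\<not> meager (A t \<inter> W)" ..
  obtain V where V: "open V" "V \<noteq> {}" "V \<subseteq> W" "meager (V - A t)"
    by (rule bp_nonmeager[OF bpA t oW])
  obtain e0 where "e0 \<in> V" using V(2) by auto
  then obtain n where n: "cyl (pre e0 n) \<subseteq> V" using open_imp_cyl[OF V(1)] by blast
  \<comment> \<open>Besides the exceptional set of e itself, those of all its one-entry changes are
    avoided at once.\<close>
  define M where "M = E \<union> ((V - A t) \<union> (\<Union>k. {e. e(k := Suc (e k)) \<in> V - A t}))"
  have mM: "meager M"
    unfolding M_def by (rule meager_Un[OF mE meager_Un[OF V(4) meager_UN[OF meager_bump[OF V(4)]]]])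
  have "cyl (pre e0 n) \<noteq> {}" using mem_cyl_pre[of e0 e0 n] by auto
  then obtain e where eM: "e \<in> cyl (pre e0 n)" "e \<notin> M"
    using baire[OF mM open_cyl] by blast
  then have e: "e \<in> cyl (pre e0 n)" "e \<notin> E" "e \<notin> V - A t"
      "\<And>k. e(k := Suc (e k)) \<notin> V - A t"
    unfolding M_def by simp_all
  have "e \<in> V" using e n by auto
  then have eA: "e \<in> A t" using e by auto
  have "act c e y \<in> U" using \<open>e \<in> V\<close> V(3) by (auto simp: W_def)
  moreover have "act c e y \<notin> (\<Union>N. U - B m c N)" using e(2) G(2) by (auto simp: E_def)
  \<comment> \<open>\<open>B m c N\<close> is comeager in U for every N; taking N to be the length n
    of the cylinder gives a flip at some k \<ge> n, and that change of e stays inside the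
    cylinder.\<close>
  ultimately have "act c e y \<in> B m c n" by auto
  then obtain k where k: "k \<ge> n" "\<not> isoN m (act c e y) (flip c k (act c e y))"
    by (auto simp: B_def)
  have "e(k := Suc (e k)) \<in> cyl (pre e0 n)" using e(1) k(1) by (auto simp: mem_cyl_pre)
  then have "e(k := Suc (e k)) \<in> A t" using n e(4)[of k] by auto
  then have "isoN m (act c e y) (act c (e(k := Suc (e k))) y)"
    using eA unfolding A_def by (intro isoT_compose[where T = "T t"]) (auto simp: T_def)
  then show False using k(2) by (simp add: flip_act)
qed

text \<open>Here a neighbourhood of x, intersected with its class of finite modifications, stays in
  a single \<open>isoN m\<close> class. This is the failure of turbulence that countable structures
  force.\<close>

definition Good :: "nat \<Rightarrow> (nat \<Rightarrow> nat) set" where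
  "Good m = {x\<in>C. \<exists>N. \<forall>y. fm x y \<longrightarrow> (\<forall>i<N. y i = x i) \<longrightarrow> isoN m x y}"

text \<open>A finite change is made one coordinate at a time, and a single entry passes through 0 in
  steps of size 1. The step from j to j + 1 is a flip in the matching \<open>c = even j\<close>, so
  both matchings are used in alternation.\<close>

lemma isoN_chain:
  assumes step: "\<And>y c k. fm x y \<Longrightarrow> (\<forall>i<n. y i = x i) \<Longrightarrow> k \<ge> n \<Longrightarrow> isoN m y (flip c k y)"
    and y: "fm x y" "\<forall>i<n. y i = x i"
  shows "isoN m x y"
proof -
  have zero: "isoN m (y(k := 0)) (y(k := j))" if y: "fm x y" "\<forall>i<n. y i = x i" and k: "k \<ge> n" for y k j
  proof (induction j)
    case 0 show ?case by (rule isoT_refl)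
  next
    case (Suc j)
    have "fm y (y(k := j))" by (rule fmI[of "Suc k"]) auto
    then have "fm x (y(k := j))" using fm_trans y by blast
    then have "isoN m (y(k := j)) (flip (even j) k (y(k := j)))"
      using y k by (intro step) auto
    moreover have "flip (even j) k (y(k := j)) = y(k := Suc j)" by (simp add: flip_def tw_def)
    ultimately show ?case using Suc isoT_trans by metis
  qed
  have single: "isoN m (y(k := i)) (y(k := j))" if y: "fm x y" "\<forall>i<n. y i = x i" and k: "k \<ge> n" for y k i j
    using isoT_trans[OF isoT_sym[OF zero[OF that, of i]] zero[OF that, of j]] .
  define Y where "Y p = (\<lambda>i. if i < p then y i else x i)" for p
  have "isoN m x (Y p)" for p
  proof (induction p)
    case 0 then show ?case by (simp add: Y_def isoT_refl)
  next
    case (Suc p)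
    have Yp: "Y (Suc p) = (Y p)(p := y p)" "(Y p)(p := x p) = Y p" by (auto simp: Y_def fun_eq_iff)
    show ?case
    proof (cases "p < n")
      case True then show ?thesis using Suc Yp y(2) by simp
    next
      case False
      have "fm x (Y p)" by (rule fmI[of p]) (simp add: Y_def)
      moreover have "\<forall>i<n. Y p i = x i" using y(2) by (simp add: Y_def)
      ultimately have "isoN m ((Y p)(p := x p)) ((Y p)(p := y p))" using False by (intro single) auto
      then show ?thesis using Suc Yp isoT_trans by metis
    qed
  qed
  moreover obtain p where "\<forall>i\<ge>p. x i = y i" using fmD y(1) by blast
  then have "Y p = y" by (auto simp: Y_def fun_eq_iff)
  ultimately show ?thesis by metis
qed

text \<open>\<open>B_local\<close> is applied to one matching after the other, giving an open set
  where late flips of either kind rarely leave the class. Saturating the exceptional set keeps all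
  intermediate points of the chain from x outside it.\<close>

lemma meager_Good: "meager (- Good m)"
proof (rule meager_localize)
  fix U :: "(nat \<Rightarrow> nat) set" assume U: "open U" "U \<noteq> {}"
  obtain V1 N1 where V1: "open V1" "V1 \<noteq> {}" "V1 \<subseteq> U" "meager (B m False N1 \<inter> V1)"
    using B_local[OF U] by metis
  obtain V N2 where V: "open V" "V \<noteq> {}" "V \<subseteq> V1" "meager (B m True N2 \<inter> V)"
    using B_local[OF V1(1,2)] by metis
  have "meager (B m False N1 \<inter> V)" using V1(4) by (rule meager_subset) (use V in auto)
  then have M: "meager ((B m False N1 \<inter> V) \<union> (B m True N2 \<inter> V))" using V(4) by (rule meager_Un)
  obtain G where G: "fam G" "(B m False N1 \<inter> V) \<union> (B m True N2 \<inter> V) \<subseteq> (\<Union>k. G k)"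
    by (rule meager_saturate[OF M])
  obtain x0 where "x0 \<in> V" using V(2) by auto
  then obtain n0 where n0: "cyl (pre x0 n0) \<subseteq> V" using open_imp_cyl[OF V(1)] by blast
  define n where "n = max n0 (max N1 N2)"
  have n: "cyl (pre x0 n) \<subseteq> V" using n0 cyl_pre_mono[of n0 n x0] by (auto simp: n_def)
  have "- Good m \<inter> cyl (pre x0 n) \<subseteq> - C \<union> (\<Union>k. G k)"
  proof (rule subsetI, rule ccontr)
    fix x assume x: "x \<in> - Good m \<inter> cyl (pre x0 n)" and nx: "x \<notin> - C \<union> (\<Union>k. G k)"
    have step: "isoN m y (flip c k y)" if y: "fm x y" "\<forall>i<n. y i = x i" "k \<ge> n" for y c k
    proof -
      have "y \<in> C" using nx fm_C y by blast
      moreover have "y \<notin> (\<Union>k. G k)" using nx G(1) fm_sym[OF y(1)] unfolding fam_def by blast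
      moreover have "y \<in> cyl (pre x0 n)" using x y(2) by (auto simp: mem_cyl_pre)
      ultimately have "y \<in> V" "y \<notin> B m False N1" "y \<notin> B m True N2" using n G(2) by auto
      then show ?thesis using \<open>y \<in> C\<close> y(3) by (cases c) (auto simp: B_def n_def)
    qed
    have "isoN m x y" if "fm x y" "\<forall>i<n. y i = x i" for y
      by (rule isoN_chain[OF step that])
    moreover have "x \<in> C" using nx by blast
    ultimately have "x \<in> Good m" unfolding Good_def by blast
    then show False using x by blast
  qed
  then have "meager (- Good m \<inter> cyl (pre x0 n))"
    by (rule meager_subset[OF meager_Un[OF meager_C meager_fam[OF G(1)]]])
  moreover have "x0 \<in> cyl (pre x0 n)" by (simp add: mem_cyl_pre)
  moreover have "cyl (pre x0 n) \<subseteq> U" using n V V1 by blast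
  ultimately show "\<exists>V. open V \<and> V \<noteq> {} \<and> V \<subseteq> U \<and> meager (- Good m \<inter> V)"
    using open_cyl by blast
qed

end

section \<open>Convergent sequences of generic finite changes\<close>

context generic_iso begin

lemma meager_eventually_nonzero: "meager {x :: nat \<Rightarrow> nat. \<forall>n\<ge>N. x n \<noteq> 0}"
proof (rule meager_nowhere_dense)
  have "{x :: nat \<Rightarrow> nat. \<forall>n\<ge>N. x n \<noteq> 0} = (\<Inter>n\<in>{N..}. {x. x n \<noteq> 0})" by auto
  moreover have "closed {x :: nat \<Rightarrow> nat. x n \<noteq> 0}" for n
  proof -
    have "open ((\<lambda>x :: nat \<Rightarrow> nat. x n) -` {0})"
      by (rule open_vimage[OF open_discrete continuous_on_product_coordinates])
    then show ?thesis by (simp add: closed_def vimage_def Collect_neg_eq[symmetric])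
  qed
  ultimately show "closed {x :: nat \<Rightarrow> nat. \<forall>n\<ge>N. x n \<noteq> 0}" by (simp only:) blast
  show "interior {x :: nat \<Rightarrow> nat. \<forall>n\<ge>N. x n \<noteq> 0} = {}"
  proof (rule interior_empty_cyl)
    fix x :: "nat \<Rightarrow> nat" and n
    show "\<exists>y\<in>cyl (pre x n). y \<notin> {x. \<forall>n\<ge>N. x n \<noteq> 0}"
      by (rule bexI[of _ "x(max n N := 0)"]) (auto simp: mem_cyl_pre intro!: exI[of _ "max n N"])
  qed
qed

text \<open>All changes are made beyond the coordinates that goodness of x protects. One zero of x0
  is left as it is, a later one is given the value of h, and the sequence is then altered further to
  escape \<open>F i\<close>; m' bounds the prefix that guarantees all this.\<close>

lemma generic_step:
  assumes x: "fm x0 x" "x \<in> Good b" and zero: "\<forall>K. \<exists>n\<ge>K. x0 n = 0"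
  shows "\<exists>x' m'. m < m' \<and> (\<forall>j<m. x' j = x j) \<and> fm x x' \<and> isoN b x x' \<and>
    cyl (pre x' m') \<inter> F i = {} \<and> (\<exists>j\<in>{m..<m'}. x0 j = 0 \<and> x' j = 0) \<and> (\<exists>j\<in>{m..<m'}. x0 j = 0 \<and> x' j = h j)"
proof -
  obtain K where K: "\<forall>n\<ge>K. x0 n = x n" using fmD[OF x(1)] by blast
  obtain N where N: "\<And>y. fm x y \<Longrightarrow> (\<forall>i<N. y i = x i) \<Longrightarrow> isoN b x y"
    using x(2) unfolding Good_def by blast
  \<comment> \<open>Beyond m the old prefix is kept, beyond N the class is kept, and beyond K the
    current x still agrees with x0, so that it is 0 at n0.\<close>
  obtain n0 where n0: "n0 \<ge> max (max m N) K" "x0 n0 = 0" using zero by blast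
  obtain n1 where n1: "n1 \<ge> Suc n0" "x0 n1 = 0" using zero by blast
  define y0 where "y0 = x(n1 := h n1)"
  have "\<not> cyl (pre y0 (Suc n1)) \<subseteq> F i"
  proof
    assume "cyl (pre y0 (Suc n1)) \<subseteq> F i"
    then have "cyl (pre y0 (Suc n1)) \<subseteq> {}"
      using interior_maximal[OF _ open_cyl] fam unfolding fam_def by metis
    moreover have "y0 \<in> cyl (pre y0 (Suc n1))" by (simp only: mem_cyl_pre) simp
    ultimately show False by blast
  qed
  then obtain y where y: "\<forall>i<Suc n1. y i = y0 i" "y \<in> - F i"
    unfolding mem_cyl_pre subset_iff by blast
  have "open (- F i)" using fam by (simp add: fam_def open_Compl)
  then obtain n2 where n2: "cyl (pre y n2) \<subseteq> - F i" using open_imp_cyl y(2) by blast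
  define m' where "m' = max n2 (Suc n1)"
  define x' where "x' j = (if j < m' then y j else x j)" for j
  have n1m: "n1 < m'" by (auto simp: m'_def)
  have "fm x x'" by (rule fmI[of m']) (simp add: x'_def)
  have agree: "x' j = x j" if "j < n1" for j
    using y(1) that by (simp add: x'_def y0_def m'_def)
  have "cyl (pre x' m') \<subseteq> cyl (pre y n2)" by (auto simp: mem_cyl_pre x'_def m'_def)
  then have "cyl (pre x' m') \<inter> F i = {}" using n2 by blast
  moreover have "x' n0 = 0" using agree[of n0] n0 n1 K by simp
  moreover have "x' n1 = h n1" using y(1) n1m by (simp add: x'_def y0_def)
  moreover have "isoN b x x'" by (rule N[OF \<open>fm x x'\<close>]) (use agree n0 n1 in auto)
  moreover have "\<forall>j<m. x' j = x j" using agree n0 n1 by auto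
  moreover have "m < m'" "n0 \<in> {m..<m'}" "n1 \<in> {m..<m'}" using n0 n1 n1m by auto
  ultimately show ?thesis using n0(2) n1(2) \<open>fm x x'\<close>
    by (intro exI[of _ x'] exI[of _ m']) blast
qed

text \<open>A fusion argument: the next isomorphism is followed by maps that fix more and more
  points, so both the composites and their inverses converge pointwise. The limit sequence escapes
  every \<open>F i\<close>, hence g is continuous at it and the limit bijection is an
  isomorphism.\<close>

lemma far_isomorphic:
  "\<exists>x z. isoT I ar {} (g x) (g z) \<and> (\<forall>N. \<exists>n\<ge>N. x n = 0 \<and> z n = 0) \<and> (\<forall>N. \<exists>n\<ge>N. x n = 0 \<and> z n = h n)"
proof -
  obtain G where G: "fam G" "(\<Union>m. - Good m) \<union> (\<Union>N. {x. \<forall>n\<ge>N. x n \<noteq> 0}) \<subseteq> (\<Union>k. G k)"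
    by (rule meager_saturate[OF meager_Un[OF meager_UN[OF meager_Good] meager_UN[OF meager_eventually_nonzero]]])
  obtain x0 where x0: "x0 \<notin> (\<Union>k. G k)"
    using baire[OF meager_fam[OF G(1)] open_UNIV] by auto
  have good: "y \<in> Good b" if "fm x0 y" for y b
  proof -
    have "y \<notin> (\<Union>k. G k)" using x0 G(1) fm_sym[OF that] unfolding fam_def by blast
    then show ?thesis using G(2) by blast
  qed
  have "x0 \<notin> (\<Union>N. {x. \<forall>n\<ge>N. x n \<noteq> 0})" using x0 G(2) by (meson UnI2 subsetD)
  then have zero: "\<forall>K. \<exists>n\<ge>K. x0 n = 0" by simp
  define P where "P = (\<lambda>(i::nat) (x, q, m::nat). fm x0 x \<and> bij q \<and>
    (\<forall>i\<in>I. \<forall>xs. length xs = ar i \<longrightarrow> (g x0 i xs \<longleftrightarrow> g x i (map q xs))))"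
  define Q where "Q = (\<lambda>i (x, q :: nat \<Rightarrow> nat, m) (x', q', m').  m < m' \<and> (\<forall>j<m. x' j = x j) \<and>
    (\<forall>j\<le>i. q' j = q j \<and> inv q' j = inv q j) \<and>
    cyl (pre x' m') \<inter> F i = {} \<and> (\<exists>j\<in>{m..<m'}. x0 j = 0 \<and> x' j = 0) \<and> (\<exists>j\<in>{m..<m'}. x0 j = 0 \<and> x' j = h j))"
  have "\<exists>f. \<forall>i. P i (f i) \<and> Q i (f i) (f (Suc i))"
  proof (rule dependent_nat_choice)
    have "P 0 (x0, id, 0)" by (simp add: P_def fm_def)
    then show "\<exists>s. P 0 s" by blast
  next
    fix s i assume "P i s"
    obtain x q m where s: "s = (x, q, m)" by (cases s)
    have x: "fm x0 x" and q: "bij q"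
      and iso: "\<And>i xs. i \<in> I \<Longrightarrow> length xs = ar i \<Longrightarrow> (g x0 i xs \<longleftrightarrow> g x i (map q xs))"
      using \<open>P i s\<close> by (auto simp: P_def s)
    \<comment> \<open>The new isomorphism fixes all numbers below b. As b exceeds each j \<le> i and
      each \<open>q j\<close>, composing with it changes neither the values of q nor those of its
      inverse at arguments up to i.\<close>
    define b where "b = Suc (i + (\<Sum>j\<le>i. q j))"
    have "q j \<le> (\<Sum>j\<le>i. q j)" if "j \<le> i" for j using that by (intro member_le_sum) auto
    then have b: "j < b" "q j < b" if "j \<le> i" for j
      using that by (force simp: b_def)+
    obtain x' m' where x': "m < m'" "\<forall>j<m. x' j = x j" "fm x x'" "isoN b x x'"
      "cyl (pre x' m') \<inter> F i = {}" "\<exists>j\<in>{m..<m'}. x0 j = 0 \<and> x' j = 0" "\<exists>j\<in>{m..<m'}. x0 j = 0 \<and> x' j = h j"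
      using generic_step[OF x good[OF x] zero] by metis
    obtain p where p: "bij p" "\<And>j. j < b \<Longrightarrow> p j = j"
        "\<And>i xs. i \<in> I \<Longrightarrow> length xs = ar i \<Longrightarrow> (g x i xs \<longleftrightarrow> g x' i (map p xs))"
      using x'(4) unfolding isoT_def by (auto simp: Id_on_def)
    have "inv (p \<circ> q) j = inv q j" if "j \<le> i" for j
    proof -
      have "inv p j = j" using p(1) p(2)[OF b(1)[OF that]] by (metis bij_inv_eq_iff)
      then show ?thesis using o_inv_distrib[OF p(1) q] by simp
    qed
    moreover have "fm x0 x'" using fm_trans x x'(3) by blast
    moreover have "bij (p \<circ> q)" using p(1) q by (rule bij_comp[rotated])
    moreover have "g x0 i xs \<longleftrightarrow> g x' i (map (p \<circ> q) xs)" if "i \<in> I" "length xs = ar i" for i xs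
      using iso[OF that] p(3)[of i "map q xs"] that by simp
    ultimately have "P (Suc i) (x', p \<circ> q, m') \<and> Q i s (x', p \<circ> q, m')"
      using x' p(2)[OF b(2)] unfolding P_def Q_def s prod.case comp_def by blast
    then show "\<exists>s'. P (Suc i) s' \<and> Q i s s'" by blast
  qed
  then obtain f where f: "\<And>i. P i (f i)" "\<And>i. Q i (f i) (f (Suc i))" by blast
  define x where "x i = fst (f i)" for i
  define q where "q i = fst (snd (f i))" for i
  define m where "m i = snd (snd (f i))" for i
  have f_eq: "f i = (x i, q i, m i)" for i by (simp add: x_def q_def m_def)
  have fmx: "fm x0 (x i)" and bq: "bij (q i)"
    and iso: "\<And>j xs. j \<in> I \<Longrightarrow> length xs = ar j \<Longrightarrow> (g x0 j xs \<longleftrightarrow> g (x i) j (map (q i) xs))" for i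
    using f(1)[of i] by (simp_all add: P_def f_eq)
  have Q: "m i < m (Suc i)" "\<forall>j<m i. x (Suc i) j = x i j"
    "\<forall>j\<le>i. q (Suc i) j = q i j \<and> inv (q (Suc i)) j = inv (q i) j"
    "cyl (pre (x (Suc i)) (m (Suc i))) \<inter> F i = {}" 
    "\<exists>j\<in>{m i..<m (Suc i)}. x0 j = 0 \<and> x (Suc i) j = 0"
    "\<exists>j\<in>{m i..<m (Suc i)}. x0 j = 0 \<and> x (Suc i) j = h j" for i
    using f(2)[of i] unfolding Q_def f_eq by simp_all
  have m_mono: "m i \<le> m k" if "i \<le> k" for i k
    using lift_Suc_mono_le[of m, OF less_imp_le[OF Q(1)] that] .
  have m_ge: "i \<le> m i" for i
    by (induction i) (use Q(1) Suc_leI le_less_trans in \<open>blast+\<close>)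
  have xk: "x k j = x i j" if "i \<le> k" "j < m i" for i j k
    using that(1) by (induction k rule: dec_induct) (use Q(2) m_mono that(2) less_le_trans in \<open>metis+\<close>)
  have qk: "q k j = q i j \<and> inv (q k) j = inv (q i) j" if "i \<le> k" "j \<le> i" for i j k
    using that(1) by (induction k rule: dec_induct) (use Q(3) that(2) le_trans in \<open>metis+\<close>)
  \<comment> \<open>The prefix of length \<open>m i\<close> is final from stage i on and i \<le>
    \<open>m i\<close>, so coordinate j is final at stage \<open>Suc j\<close>.\<close>
  define z where "z j = x (Suc j) j" for j
  have z: "z j = x i j" if "j < m i" for i j
  proof -
    have "j < m (Suc j)" using m_ge[of "Suc j"] by simp
    then show ?thesis using xk[of i "max i (Suc j)" j] xk[of "Suc j" "max i (Suc j)" j] that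
      by (simp add: z_def)
  qed
  have "z \<in> cyl (pre (x (Suc i)) (m (Suc i)))" for i using z by (simp only: mem_cyl_pre) blast
  then have zC: "z \<in> C" using Q(4) unfolding C_def by blast
  define r where "r j = q j j" for j
  define r' where "r' j = inv (q j) j" for j
  have r: "q i j = r j" "inv (q i) j = r' j" if "j \<le> i" for i j
    using qk[of j i j] that by (simp_all add: r_def r'_def)
  have "r (r' j) = j" for j
    using r(1)[of "r' j" "max j (r' j)"] r(2)[of j "max j (r' j)"] bq[of "max j (r' j)"]
    by (metis bij_inv_eq_iff max.cobounded1 max.cobounded2)
  moreover have "r' (r j) = j" for j
    using r(1)[of j "max j (r j)"] r(2)[of "r j" "max j (r j)"] bq[of "max j (r j)"]
    by (metis bij_inv_eq_iff max.cobounded1 max.cobounded2)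
  ultimately have "bij r" by (intro o_bij[of r']) (auto simp: fun_eq_iff)
  moreover have "g x0 i xs \<longleftrightarrow> g z i (map r xs)" if i: "i \<in> I" "length xs = ar i" for i xs
  proof -
    have len: "length (map r xs) = ar i" using i by simp
    obtain n where n: "\<And>x'. x' \<in> C \<Longrightarrow> (\<forall>j<n. x' j = z j) \<Longrightarrow> g x' i (map r xs) = g z i (map r xs)"
      by (rule contC[OF zC i(1) len]) blast
    \<comment> \<open>Stage k agrees with z on the n coordinates that decide the relation at z, and
      it is so late that \<open>q k\<close> has its final value r on all entries of xs.\<close>
    define k where "k = max n (sum_list xs)"
    have "x k \<in> C"
      using good[OF fmx[of k], of 0] by (simp add: Good_def)
    moreover have "\<forall>j<n. x k j = z j" using z[of _ k] m_ge[of k] by (simp add: k_def)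
    ultimately have "g (x k) i (map r xs) = g z i (map r xs)" by (rule n)
    moreover have "map (q k) xs = map r xs"
      using member_le_sum_list by (fastforce simp: k_def intro!: r(1))
    ultimately show ?thesis using iso[OF i, of k] by metis
  qed
  ultimately have "isoT I ar {} (g x0) (g z)" unfolding isoT_def by blast
  moreover have "\<exists>n\<ge>N. x0 n = 0 \<and> z n = 0" for N
  proof -
    obtain j where "j \<in> {m N..<m (Suc N)}" "x0 j = 0" "x (Suc N) j = 0"
      using Q(5)[of N] by blast
    then show ?thesis
      using m_ge[of N] z[of j "Suc N"] by (intro exI[of _ j]) auto
  qed
  moreover have "\<exists>n\<ge>N. x0 n = 0 \<and> z n = h n" for N
  proof -
    obtain j where "j \<in> {m N..<m (Suc N)}" "x0 j = 0" "x (Suc N) j = h j"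
      using Q(6)[of N] by blast
    then show ?thesis
      using m_ge[of N] z[of j "Suc N"] by (intro exI[of _ j]) auto
  qed
  ultimately show ?thesis by blast
qed

end

text \<open>Each of the countably many atomic statements and its negation is open modulo a meager
  set; off the saturated union of these errors g is continuous. The sequence h is left free so that
  the geometry can choose which displacement is far.\<close>

theorem borel_homomorphism_far_isomorphic:
  fixes g :: "(nat \<Rightarrow> nat) \<Rightarrow> nat \<Rightarrow> nat list \<Rightarrow> bool" and h :: "nat \<Rightarrow> nat"
  assumes borel: "\<And>i xs. i \<in> I \<Longrightarrow> length xs = ar i \<Longrightarrow> {x. g x i xs} \<in> sets borel"
    and hom: "\<And>x y. (\<forall>n. x n \<le> Suc (y n) \<and> y n \<le> Suc (x n)) \<Longrightarrow> iso_struct I ar (g x) (g y)"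
  obtains x z where "iso_struct I ar (g x) (g z)" "\<forall>N. \<exists>n\<ge>N. x n = 0 \<and> z n = 0" "\<forall>N. \<exists>n\<ge>N. x n = 0 \<and> z n = h n"
proof -
  define D where "D = (\<lambda>(i, xs). if i \<in> I \<and> length xs = ar i then {x. g x i xs} else {})"
  have bpD: "bp (D p)" for p
    using bp_borel[OF borel] by (auto simp: D_def bp_open split: prod.splits)
  obtain U where U: "\<And>p. open (U p)" "\<And>p. meager (D p - U p)" "\<And>p. meager (U p - D p)"
    using bpD unfolding bp_def by metis
  obtain V where V: "\<And>p. open (V p)" "\<And>p. meager (- D p - V p)" "\<And>p. meager (V p - - D p)"
    using bp_Compl[OF bpD] unfolding bp_def by metis
  define M where "M = (\<Union>p. ((D p - U p) \<union> (U p - D p)) \<union> ((- D p - V p) \<union> (V p - - D p)))"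
  have "meager M" unfolding M_def
    by (rule meager_UN[OF meager_Un[OF meager_Un[OF U(2,3)] meager_Un[OF V(2,3)]]])
  then obtain F where F: "fam F" "M \<subseteq> (\<Union>k. F k)" by (rule meager_saturate)
  have "generic_iso I ar g F"
  proof
    show "fam F" by (rule F(1))
    show "isoT I ar {} (g x) (g y)" if "\<forall>n. x n \<le> Suc (y n) \<and> y n \<le> Suc (x n)" for x y
      using hom[OF that] by (simp add: isoT_empty)
    fix x and i :: nat and xs :: "nat list" assume x: "x \<notin> (\<Union>k. F k)" and i: "i \<in> I" "length xs = ar i"
    define p where "p = (i, xs)"
    have D: "y \<in> D p \<longleftrightarrow> g y i xs" for y using i by (simp add: D_def p_def)
    have M: "(y \<in> D p \<longleftrightarrow> y \<in> U p) \<and> (y \<notin> D p \<longleftrightarrow> y \<in> V p)" if "y \<notin> (\<Union>k. F k)" for y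
    proof -
      have "y \<notin> M" using that F(2) by blast
      then show ?thesis unfolding M_def by blast
    qed
    have "\<exists>n. \<forall>x'. x' \<notin> (\<Union>k. F k) \<longrightarrow> x' \<in> cyl (pre x n) \<longrightarrow> g x' i xs = g x i xs"
    proof (cases "x \<in> D p")
      case True
      then have "x \<in> U p" using M[OF x] by blast
      then obtain n where "cyl (pre x n) \<subseteq> U p" using open_imp_cyl[OF U(1)] by blast
      then show ?thesis using M D True by blast
    next
      case False
      then have "x \<in> V p" using M[OF x] by blast
      then obtain n where "cyl (pre x n) \<subseteq> V p" using open_imp_cyl[OF V(1)] by blast
      then show ?thesis using M D False by blast
    qed
    then show "\<exists>n. \<forall>x'. x' \<notin> (\<Union>k. F k) \<longrightarrow> (\<forall>j<n. x' j = x j) \<longrightarrow> g x' i xs = g x i xs"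
      by (simp only: mem_cyl_pre)
  qed
  then show ?thesis using generic_iso.far_isomorphic[of I ar g F h] that isoT_empty by metis
qed

section \<open>Covering dimension of planar compacta\<close>


text \<open>Brick k is the unit column \<open>i k\<close> cut at height \<open>2 * j k\<close>, with
  odd columns lowered by 1. Touching two columns makes t an integer, touching two bricks of one
  column makes s an integer. So three bricks at a point other than a vertex would have pairwise
  different columns, or pairwise different places in one column, and three distinct integers are not
  pairwise adjacent.\<close>

lemma at_most_two_bricks:
  fixes t s :: real and i j :: "'k \<Rightarrow> int"
  assumes k: "\<And>k. k \<in> K \<Longrightarrow> i k \<le> t \<and> t \<le> i k + 1 \<and> 2 * j k - i k mod 2 \<le> s \<and> s \<le> 2 * j k - i k mod 2 + 2"
    and inj: "\<And>k l. k \<in> K \<Longrightarrow> l \<in> K \<Longrightarrow> i k = i l \<Longrightarrow> j k = j l \<Longrightarrow> k = l"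
    and ts: "\<not> (t \<in> \<int> \<and> s \<in> \<int>)"
    and K: "a \<in> K" "b \<in> K" "c \<in> K" "a \<noteq> b" "a \<noteq> c" "b \<noteq> c"
  shows False
proof -
  have near: "i k \<le> i l + 1" if "k \<in> K" "l \<in> K" for k l
    using k[OF that(1)] k[OF that(2)] by linarith
  have t: "t \<in> \<int>" if "k \<in> K" "l \<in> K" "i k \<noteq> i l" for k l
  proof -
    have "i k = i l + 1 \<or> i l = i k + 1" using near[of k l] near[of l k] that by linarith
    then have "t = of_int (i k) \<or> t = of_int (i l)"
      using k[OF that(1)] k[OF that(2)] by force
    then show ?thesis by auto
  qed
  have nearj: "j k \<le> j l + 1" if "k \<in> K" "l \<in> K" "i k = i l" for k l
    using k[OF that(1)] k[OF that(2)] that(3) by linarith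
  have s: "s \<in> \<int>" if "k \<in> K" "l \<in> K" "i k = i l" "k \<noteq> l" for k l
  proof -
    have "j k \<noteq> j l" using inj that by blast
    then have "j k = j l + 1 \<or> j l = j k + 1"
      using nearj[of k l] nearj[of l k] that by linarith
    then have "s = of_int (2 * j k - i k mod 2) \<or> s = of_int (2 * j l - i l mod 2)"
      using k[OF that(1)] k[OF that(2)] that(3) by force
    then show ?thesis using Ints_of_int by metis
  qed
  show False
  proof (cases "i a = i b \<or> i a = i c \<or> i b = i c")
    case True
    then have "s \<in> \<int>" using s K by blast
    then have eq: "i k = i l" if "k \<in> K" "l \<in> K" for k l using t that ts by blast
    have "j a \<noteq> j b" "j a \<noteq> j c" "j b \<noteq> j c" using inj eq K by blast+
    moreover have "j a \<le> j b + 1" "j b \<le> j a + 1" "j a \<le> j c + 1" "j c \<le> j a + 1"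
      "j b \<le> j c + 1" "j c \<le> j b + 1" using nearj eq K by blast+
    ultimately show False by linarith
  next
    case False
    moreover have "i a \<le> i b + 1" "i b \<le> i a + 1" "i a \<le> i c + 1" "i c \<le> i a + 1"
      "i b \<le> i c + 1" "i c \<le> i b + 1" using near K by blast+
    ultimately show False by linarith
  qed
qed

lemma card_ge3E:
  assumes "\<not> card A \<le> 2"
  obtains a b c where "a \<in> A" "b \<in> A" "c \<in> A" "a \<noteq> b" "a \<noteq> c" "b \<noteq> c"
proof -
  obtain T where T: "T \<subseteq> A" "card T = 3"
    using obtain_subset_with_card_n[of 3 A] assms by (metis Suc_leI not_le numeral_3_eq_3 numeral_2_eq_2)
  then show ?thesis using that unfolding card_3_iff by auto
qed

text \<open>For three different sets the sum of the distances is a continuous function without zeros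
  on the compact set S, so it has a positive minimum. A radius of at most a third of every such
  minimum prevents three neighbourhoods from meeting.\<close>

lemma swell_cover:
  fixes S :: "'a::metric_space set" and B :: "'k \<Rightarrow> 'a set"
  assumes S: "compact S" and K: "finite K" and B: "\<And>k. k \<in> K \<Longrightarrow> closed (B k) \<and> B k \<noteq> {}"
    and two: "\<And>x a b c. x \<in> S \<Longrightarrow> {a, b, c} \<subseteq> K \<Longrightarrow> x \<in> B a \<Longrightarrow> x \<in> B b \<Longrightarrow> x \<in> B c \<Longrightarrow> a = b \<or> a = c \<or> b = c"
    and e: "e > 0"
  obtains d where "0 < d" "d \<le> e" "\<And>x. x \<in> S \<Longrightarrow> card {k\<in>K. infdist x (B k) < d} \<le> 2"
proof -
  define T where "T = {(a, b, c). a \<in> K \<and> b \<in> K \<and> c \<in> K \<and> a \<noteq> b \<and> a \<noteq> c \<and> b \<noteq> c}"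
  define G where "G = (\<lambda>(a, b, c) x. infdist x (B a) + infdist x (B b) + infdist x (B c))"
  have finT: "finite T"
    by (rule finite_subset[of _ "K \<times> K \<times> K"]) (auto simp: T_def K)
  have "\<exists>m>0. \<forall>x\<in>S. m \<le> G t x" if t: "t \<in> T" for t
  proof (cases "S = {}")
    case False
    obtain a b c where abc: "t = (a, b, c)" by (cases t)
    have K3: "a \<in> K" "b \<in> K" "c \<in> K" "a \<noteq> b" "a \<noteq> c" "b \<noteq> c" using t by (auto simp: T_def abc)
    have "continuous_on S (G t)" unfolding G_def abc by (auto intro!: continuous_intros)
    then obtain x where x: "x \<in> S" "\<forall>y\<in>S. G t x \<le> G t y"
      using continuous_attains_inf[OF S False] by blast
    have pos: "infdist x (B k) > 0" if "k \<in> K" "x \<notin> B k" for k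
      using B[OF that(1)] that(2) in_closed_iff_infdist_zero[of "B k" x] infdist_nonneg[of x "B k"]
      by (simp add: less_le)
    have "x \<notin> B a \<or> x \<notin> B b \<or> x \<notin> B c" using two[OF x(1), of a b c] K3 by auto
    then have "G t x > 0"
      using pos K3 infdist_nonneg[of x "B a"] infdist_nonneg[of x "B b"] infdist_nonneg[of x "B c"]
      unfolding G_def abc by fastforce
    then show ?thesis using x(2) by blast
  qed (auto intro: exI[of _ 1])
  then obtain m where m: "\<And>t. t \<in> T \<Longrightarrow> m t > 0" "\<And>t x. t \<in> T \<Longrightarrow> x \<in> S \<Longrightarrow> m t \<le> G t x"
    by metis
  define d where "d = Min (insert e ((\<lambda>t. m t / 3) ` T))"
  have "d > 0" unfolding d_def using finT m(1) e by (subst Min_gr_iff) auto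
  moreover have "d \<le> e" unfolding d_def using finT by (intro Min_le) auto
  moreover have "card {k\<in>K. infdist x (B k) < d} \<le> 2" if x: "x \<in> S" for x
  proof (rule ccontr)
    assume "\<not> ?thesis"
    then obtain a b c where abc: "a \<in> {k\<in>K. infdist x (B k) < d}" "b \<in> {k\<in>K. infdist x (B k) < d}"
      "c \<in> {k\<in>K. infdist x (B k) < d}" "a \<noteq> b" "a \<noteq> c" "b \<noteq> c" by (rule card_ge3E)
    then have t: "(a, b, c) \<in> T" by (simp add: T_def)
    then have "d \<le> m (a, b, c) / 3" unfolding d_def using finT by (intro Min_le) auto
    moreover have "m (a, b, c) \<le> G (a, b, c) x" using m(2)[OF t x] .
    ultimately show False using abc by (simp add: G_def)
  qed
  ultimately show ?thesis by (rule that)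
qed

lemma interior_countable_Union_closed_empty:
  fixes \<F> :: "'a::polish_space set set"
  assumes "countable \<F>" "\<And>T. T \<in> \<F> \<Longrightarrow> closed T \<and> interior T = {}"
  shows "interior (\<Union>\<F>) = {}"
proof -
  have "euclidean interior_of \<Union>\<F> = {}"
    by (rule Baire_category_alt) (use assms completely_metrizable_space_euclidean in auto)
  then show ?thesis by simp
qed

text \<open>In a brick tiling three bricks meet only at vertices; as S has empty interior, some
  translate of the tiling has all its vertices outside S.\<close>

lemma cov_dim_le_1_planar:
  fixes S :: "(real^2) set"
  assumes S: "compact S" and int: "interior S = {}"
  shows "cov_dim_le S 1"
  unfolding cov_dim_le_def
proof (intro allI impI)
  fix \<U> :: "(real^2) set set"
  assume "finite \<U> \<and> (\<forall>U\<in>\<U>. openin (top_of_set S) U) \<and> \<Union>\<U> = S"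
  then have \<U>: "\<And>U. U \<in> \<U> \<Longrightarrow> openin (top_of_set S) U" "\<Union>\<U> = S" by auto
  show "\<exists>\<V>. finite \<V> \<and> (\<forall>V\<in>\<V>. openin (top_of_set S) V) \<and> \<Union>\<V> = S \<and> (\<forall>V\<in>\<V>. \<exists>U\<in>\<U>. V \<subseteq> U) \<and>
      (\<forall>x\<in>S. card {V \<in> \<V>. x \<in> V} \<le> 1 + 1)"
  proof (cases "S = {}")
    case True then show ?thesis by (intro exI[of _ "{}"]) auto
  next
    case False
    define \<C> where "\<C> = {W. open W \<and> S \<inter> W \<in> \<U>}"
    have "S \<subseteq> \<Union>\<C>"
    proof
      fix x assume "x \<in> S"
      then obtain U where "U \<in> \<U>" "x \<in> U" using \<U>(2) by auto
      then show "x \<in> \<Union>\<C>" using \<U>(1) unfolding \<C>_def openin_open by auto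
    qed
    moreover have "\<C> \<noteq> {}" using calculation False by auto
    ultimately obtain \<delta> where \<delta>: "\<delta> > 0" "\<And>T. T \<subseteq> S \<Longrightarrow> diameter T < \<delta> \<Longrightarrow> \<exists>W\<in>\<C>. T \<subseteq> W"
      using Lebesgue_number_lemma[OF S, of \<C>] unfolding \<C>_def by (metis (no_types, lifting) mem_Collect_eq)
    \<comment> \<open>A brick has sides h and its swelling adds at most h at each end, which bounds
      the diameter by 4 h, half the Lebesgue number \<delta>.\<close>
    define h where "h = \<delta> / 8"
    have h: "h > 0" using \<delta>(1) by (simp add: h_def)
    \<comment> \<open>This lattice contains all corners of the bricks. A translation vector w is bad
      for a lattice point only if it lies in one translate of S, and countably many such translates
      do not cover the plane.\<close>
    define v :: "int \<times> int \<Rightarrow> real^2" where "v = (\<lambda>(i, k). vector [i * h, k * h / 2])"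
    have "interior (\<Union>p. (+) (- v p) ` S) = {}"
    proof (rule interior_countable_Union_closed_empty)
      fix T assume "T \<in> range (\<lambda>p. (+) (- v p) ` S)"
      then obtain p where "T = (+) (- v p) ` S" by blast
      then show "closed T \<and> interior T = {}"
        using closed_translation[OF compact_imp_closed[OF S], of "- v p"] interior_translation[of "- v p" S] int
        by (simp only: image_empty simp_thms)
    qed simp
    then have "(\<Union>p. (+) (- v p) ` S) \<noteq> UNIV" by (metis UNIV_not_empty interior_UNIV)
    then obtain w where w: "w \<notin> (\<Union>p. (+) (- v p) ` S)" by blast
    have wv: "w + v p \<notin> S" for p
    proof
      assume "w + v p \<in> S"
      then have "- v p + (w + v p) \<in> (+) (- v p) ` S" by blast
      moreover have "- v p + (w + v p) = w" by simp
      ultimately show False using w by (metis UN_I UNIV_I)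
    qed
    define t where "t x = (x $ 1 - w $ 1) / h" for x :: "real^2"
    define s where "s x = 2 * (x $ 2 - w $ 2) / h" for x :: "real^2"
    define B where "B = (\<lambda>(i::int, j::int). {x\<in>S. i \<le> t x \<and> t x \<le> i + 1 \<and> 2 * j - i mod 2 \<le> s x \<and> s x \<le> 2 * j - i mod 2 + 2})"
    have ts: "\<not> (t x \<in> \<int> \<and> s x \<in> \<int>)" if "x \<in> S" for x
    proof
      assume "t x \<in> \<int> \<and> s x \<in> \<int>"
      then obtain i k where ik: "t x = of_int i" "s x = of_int k" by (auto elim!: Ints_cases)
      have "x = w + v (i, k)"
        using ik h by (simp add: vec_eq_iff forall_2 v_def t_def s_def field_simps)
      then show False using wv that by auto
    qed
    have closedB: "closed (B p)" for p
    proof -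
      have "closed {x. i \<le> t x \<and> t x \<le> i + 1 \<and> 2 * j - i mod 2 \<le> s x \<and> s x \<le> 2 * j - i mod 2 + 2}" for i j :: int
        unfolding t_def s_def by (intro closed_Collect_conj closed_Collect_le continuous_intros) (use h in auto)
      then have "closed (S \<inter> {x. i \<le> t x \<and> t x \<le> i + 1 \<and> 2 * j - i mod 2 \<le> s x \<and> s x \<le> 2 * j - i mod 2 + 2})" for i j :: int
        using S compact_imp_closed by blast
      then show ?thesis by (auto simp: B_def Int_def split: prod.splits)
    qed
    define K where "K = {p. B p \<noteq> {}}"
    have "finite K"
    proof -
      have "compact (t ` S)" "compact (s ` S)"
        unfolding t_def s_def by (intro compact_continuous_image S continuous_intros; use h in simp)+
      then have "bounded (t ` S)" "bounded (s ` S)" by (simp_all add: compact_imp_bounded)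
      then obtain M1 M2 where "\<forall>y\<in>t ` S. norm y \<le> M1" "\<forall>y\<in>s ` S. norm y \<le> M2"
        unfolding bounded_iff by blast
      then have M: "\<And>x. x \<in> S \<Longrightarrow> \<bar>t x\<bar> \<le> M1" "\<And>x. x \<in> S \<Longrightarrow> \<bar>s x\<bar> \<le> M2"
        by simp_all
      have "K \<subseteq> {- \<lceil>M1\<rceil> - 1..\<lceil>M1\<rceil>} \<times> {- \<lceil>M2\<rceil> - 2..\<lceil>M2\<rceil> + 1}"
      proof
        fix p assume "p \<in> K"
        then obtain i j x where p: "p = (i, j)" and x: "x \<in> S" and
          b: "i \<le> t x" "t x \<le> i + 1" "2 * j - i mod 2 \<le> s x" "s x \<le> 2 * j - i mod 2 + 2"
          by (cases p) (auto simp: K_def B_def)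
        have m: "0 \<le> i mod 2" "i mod 2 \<le> 1" by auto
        have "of_int i \<le> M1" "- M1 \<le> of_int (i + 1)" "of_int (2 * j - i mod 2) \<le> M2" "- M2 \<le> of_int (2 * j - i mod 2 + 2)"
          using M[OF x] b by auto
        then have "i \<le> \<lceil>M1\<rceil>" "- (i + 1) \<le> \<lceil>M1\<rceil>" "2 * j - i mod 2 \<le> \<lceil>M2\<rceil>" "- (2 * j - i mod 2 + 2) \<le> \<lceil>M2\<rceil>"
          using le_of_int_ceiling[of M1] le_of_int_ceiling[of M2] by linarith+
        moreover have "0 \<le> \<lceil>M2\<rceil>" using M(2)[OF x] by linarith
        ultimately show "p \<in> {- \<lceil>M1\<rceil> - 1..\<lceil>M1\<rceil>} \<times> {- \<lceil>M2\<rceil> - 2..\<lceil>M2\<rceil> + 1}"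
          using m unfolding p by auto
      qed
      then show ?thesis by (rule finite_subset) simp
    qed
    obtain d where d: "0 < d" "d \<le> h" "\<And>x. x \<in> S \<Longrightarrow> card {k\<in>K. infdist x (B k) < d} \<le> 2"
    proof (rule swell_cover[OF S \<open>finite K\<close> _ _ h])
      show "closed (B k) \<and> B k \<noteq> {}" if "k \<in> K" for k using that closedB by (simp add: K_def)
      fix x a b c assume x: "x \<in> S" and abc: "x \<in> B a" "x \<in> B b" "x \<in> B c"
      show "a = b \<or> a = c \<or> b = c"
      proof (rule ccontr)
        assume "\<not> (a = b \<or> a = c \<or> b = c)"
        then have ne: "a \<noteq> b" "a \<noteq> c" "b \<noteq> c" by auto
        have bk: "of_int (fst k) \<le> t x \<and> t x \<le> of_int (fst k) + 1 \<and>
            2 * of_int (snd k) - of_int (fst k mod 2) \<le> s x \<and> s x \<le> 2 * of_int (snd k) - of_int (fst k mod 2) + 2"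
          if "k \<in> {a, b, c}" for k
        proof -
          have "x \<in> B k" using that abc by blast
          then show ?thesis by (cases k) (simp add: B_def)
        qed
        show False
          by (rule at_most_two_bricks[of "{a, b, c}" fst "t x" snd "s x" a b c])
             (use bk ts[OF x] ne in \<open>simp_all add: prod_eq_iff\<close>)
      qed
    qed (rule that)
    define V where "V k = {x\<in>S. infdist x (B k) < d}" for k
    have "openin (top_of_set S) (V k)" for k
    proof -
      have "open {x. infdist x (B k) < d}"
        by (intro open_Collect_less continuous_intros)
      then show ?thesis unfolding openin_open by (intro exI[of _ "{x. infdist x (B k) < d}"]) (auto simp: V_def)
    qed
    moreover have "\<Union>(V ` K) = S"
    proof
      show "S \<subseteq> \<Union>(V ` K)"
      proof
        fix x assume x: "x \<in> S"
        define i where "i = \<lfloor>t x\<rfloor>"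
        define j where "j = \<lfloor>(s x + i mod 2) / 2\<rfloor>"
        have "of_int j \<le> (s x + i mod 2) / 2" "(s x + i mod 2) / 2 \<le> of_int j + 1"
          unfolding j_def by linarith+
        moreover have "of_int i \<le> t x" "t x \<le> of_int i + 1" unfolding i_def by linarith+
        ultimately have "x \<in> B (i, j)" using x by (simp add: B_def)
        then have "x \<in> V (i, j)" "(i, j) \<in> K" using x d(1) by (auto simp: V_def K_def)
        then show "x \<in> \<Union>(V ` K)" by blast
      qed
    qed (auto simp: V_def)
    moreover have "\<exists>U\<in>\<U>. V k \<subseteq> U" if k: "k \<in> K" for k
    proof -
      have "dist x y \<le> 4 * h" if x: "x \<in> V k" and y: "y \<in> V k" for x y
      proof -
        have ne: "B k \<noteq> {}" using k by (simp add: K_def)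
        obtain x' where x': "x' \<in> B k" "infdist x (B k) = dist x x'"
          using infdist_attains_inf[OF closedB ne] by blast
        obtain y' where y': "y' \<in> B k" "infdist y (B k) = dist y y'"
          using infdist_attains_inf[OF closedB ne] by blast
        obtain i j where ij: "k = (i, j)" by (cases k)
        have "\<bar>t x' - t y'\<bar> \<le> 1" "\<bar>s x' - s y'\<bar> \<le> 2" using x'(1) y'(1) by (auto simp: B_def ij)
        moreover have "x' $ 1 - y' $ 1 = (t x' - t y') * h" "x' $ 2 - y' $ 2 = (s x' - s y') * h / 2"
          using h by (simp_all add: t_def s_def field_simps)
        moreover have "\<bar>a * h\<bar> \<le> b * h" if "\<bar>a\<bar> \<le> b" for a b
          using mult_right_mono[OF that less_imp_le[OF h]] h by (simp add: abs_mult)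
        ultimately have "\<bar>x' $ 1 - y' $ 1\<bar> \<le> h" "\<bar>x' $ 2 - y' $ 2\<bar> \<le> h" by fastforce+
        moreover have "dist x' y' \<le> \<bar>x' $ 1 - y' $ 1\<bar> + \<bar>x' $ 2 - y' $ 2\<bar>"
          unfolding dist_norm using norm_le_l1_cart[of "x' - y'"] by (simp add: sum_2)
        ultimately have "dist x' y' \<le> 2 * h" by linarith
        moreover have "dist x x' \<le> h" "dist y y' \<le> h" using x y x'(2) y'(2) d(2) by (auto simp: V_def)
        moreover have "dist x y \<le> dist x x' + dist x' y' + dist y y'"
          using dist_triangle[of x y x'] dist_triangle[of x' y y'] by (simp add: dist_commute)
        ultimately show ?thesis by linarith
      qed
      then have "diameter (V k) \<le> 4 * h" using h by (intro diameter_le) (auto simp: dist_norm)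
      then have "diameter (V k) < \<delta>" using \<delta>(1) by (simp add: h_def)
      moreover have "V k \<subseteq> S" by (auto simp: V_def)
      ultimately obtain W where "W \<in> \<C>" "V k \<subseteq> W" using \<delta>(2) by blast
      then show ?thesis using \<open>V k \<subseteq> S\<close> unfolding \<C>_def by blast
    qed
    moreover have "card {X \<in> V ` K. x \<in> X} \<le> 1 + 1" if x: "x \<in> S" for x
    proof -
      have "{X \<in> V ` K. x \<in> X} = V ` {k\<in>K. infdist x (B k) < d}" using x by (auto simp: V_def)
      then have "card {X \<in> V ` K. x \<in> X} \<le> card {k\<in>K. infdist x (B k) < d}"
        using \<open>finite K\<close> by (simp add: card_image_le)
      then show ?thesis using d(3)[OF x] by simp
    qed
    ultimately show ?thesis using \<open>finite K\<close> by (intro exI[of _ "V ` K"]) auto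
  qed
qed

text \<open>The cover by the complements of a and of b is refined by a partition into relatively
  open sets. The member containing a lies in the complement of b, so it and the union of the others
  disconnect S.\<close>

lemma not_cov_dim_le_0:
  fixes S :: "'a::t1_space set"
  assumes S: "connected S" and ab: "a \<in> S" "b \<in> S" "a \<noteq> b"
  shows "\<not> cov_dim_le S 0"
proof
  assume c: "cov_dim_le S 0"
  have "openin (top_of_set S) (S - {c})" for c
    by (metis Diff_eq closed_singleton openin_open_Int open_Compl)
  moreover have "S - {a} \<union> (S - {b}) = S" using ab by auto
  ultimately have "finite {S - {a}, S - {b}} \<and> (\<forall>U\<in>{S - {a}, S - {b}}. openin (top_of_set S) U) \<and> \<Union>{S - {a}, S - {b}} = S"
    by simp
  then have "\<exists>\<V>. finite \<V> \<and> (\<forall>V\<in>\<V>. openin (top_of_set S) V) \<and> \<Union>\<V> = S \<and>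
      (\<forall>V\<in>\<V>. \<exists>U\<in>{S - {a}, S - {b}}. V \<subseteq> U) \<and> (\<forall>x\<in>S. card {V\<in>\<V>. x \<in> V} \<le> 0 + 1)"
    using c unfolding cov_dim_le_def by (elim allE impE)
  then obtain \<V> where *: "finite \<V>" "\<forall>V\<in>\<V>. openin (top_of_set S) V" "\<Union>\<V> = S"
      "\<forall>V\<in>\<V>. \<exists>U\<in>{S - {a}, S - {b}}. V \<subseteq> U" "\<forall>x\<in>S. card {V\<in>\<V>. x \<in> V} \<le> 0 + 1"
    by (elim exE conjE)
  then have \<V>: "finite \<V>" "\<And>V. V \<in> \<V> \<Longrightarrow> openin (top_of_set S) V" "\<Union>\<V> = S"
      "\<And>V. V \<in> \<V> \<Longrightarrow> V \<subseteq> S - {a} \<or> V \<subseteq> S - {b}" "\<And>x. x \<in> S \<Longrightarrow> card {V \<in> \<V>. x \<in> V} \<le> 1"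
    by simp_all
  obtain A where A: "A \<in> \<V>" "a \<in> A" using ab \<V>(3) by blast
  have disj: "x \<notin> V" if "x \<in> A" "V \<in> \<V>" "V \<noteq> A" for x V
  proof
    assume "x \<in> V"
    then have "card {A, V} \<le> card {V \<in> \<V>. x \<in> V}" using \<V>(1) A that by (intro card_mono) auto
    then show False using \<V>(5)[of x] that A \<V>(3) by (auto simp: card_insert_if)
  qed
  have "openin (top_of_set S) (\<Union>(\<V> - {A}))" using \<V>(2) by (intro openin_Union) auto
  moreover have "openin (top_of_set S) A" using \<V>(2) A by blast
  moreover have "S \<subseteq> A \<union> \<Union>(\<V> - {A})" using \<V>(3) by auto
  moreover have "A \<inter> \<Union>(\<V> - {A}) = {}" using disj by blast
  moreover have "b \<notin> A" using \<V>(4)[OF A(1)] A(2) by auto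
  then have "b \<in> \<Union>(\<V> - {A})" using \<V>(3) ab(2) by auto
  ultimately show False using S A(2) unfolding connected_openin by blast
qed

lemma covering_dimension_planar:
  fixes S :: "(real^2) set"
  assumes "compact S" "interior S = {}" "connected S" "a \<in> S" "b \<in> S" "a \<noteq> b"
  shows "covering_dimension S 1"
  using cov_dim_le_1_planar[OF assms(1,2)] not_cov_dim_le_0[OF assms(3-6)] assms(4)
  by (auto simp: covering_dimension_def)

section \<open>A staircase with a step at every rational\<close>


definition rat_enum :: "nat \<Rightarrow> real" where
  "rat_enum i = of_rat (nat_to_rat_surj i)"

lemma rat_enum_surj: "q \<in> \<rat> \<Longrightarrow> \<exists>i. rat_enum i = q"
  unfolding rat_enum_def using surj_nat_to_rat_surj by (metis Rats_cases surj_def)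

lemma rat_enum_Rats: "rat_enum i \<in> \<rat>"
  by (simp add: rat_enum_def)

definition wt :: "real \<Rightarrow> nat \<Rightarrow> real" where
  "wt t i = (if rat_enum i < t then (1/2) ^ i else 0)"

text \<open>Strictly increasing with a jump at every rational; its generalised inverse is the staircase below.\<close>

definition jump :: "real \<Rightarrow> real" where
  "jump t = t + (\<Sum>i. wt t i)"

lemma wt_bounds: "0 \<le> wt t i" "wt t i \<le> (1/2) ^ i"
  by (auto simp: wt_def)

lemma summable_half: "summable (\<lambda>i. (1/2 :: real) ^ i)"
  by (rule summable_geometric) simp

lemma summable_wt: "summable (wt t)"
  by (rule summable_comparison_test'[OF summable_half]) (simp add: wt_def)

lemma wt_mono: "s \<le> t \<Longrightarrow> wt s i \<le> wt t i"
  by (auto simp: wt_def)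

lemma jump_bounds: "t \<le> jump t" "jump t \<le> t + 2"
proof -
  have "0 \<le> suminf (wt t)" by (rule suminf_nonneg[OF summable_wt wt_bounds(1)])
  then show "t \<le> jump t" by (simp add: jump_def)
  have "suminf (wt t) \<le> (\<Sum>i. (1/2) ^ i)"
    by (rule suminf_le[OF wt_bounds(2) summable_wt summable_half])
  also have "\<dots> = 2" by (simp add: suminf_geometric)
  finally show "jump t \<le> t + 2" by (simp add: jump_def)
qed

lemma jump_diff: assumes "s \<le> t" shows "t - s \<le> jump t - jump s"
  using suminf_le[OF wt_mono[OF assms] summable_wt summable_wt] by (simp add: jump_def)

lemma jump_strict_mono: "s < t \<Longrightarrow> jump s < jump t"
  using jump_diff[of s t] by simp

lemma jump_le_iff: "jump s \<le> jump t \<longleftrightarrow> s \<le> t"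
  using jump_strict_mono by (metis linorder_not_less order_le_less)

text \<open>Right after q the sum gains the weight of an index that enumerates q, while the summand
  t itself supplies the further growth t - q.\<close>

lemma jump_gap:
  assumes "q \<in> \<rat>"
  shows "\<exists>d>0. \<forall>t>q. jump q + d + (t - q) \<le> jump t"
proof -
  obtain i where i: "rat_enum i = q" using rat_enum_surj[OF assms] by blast
  have "jump q + (1/2) ^ i + (t - q) \<le> jump t" if t: "t > q" for t
  proof -
    define d where "d j = wt t j - wt q j" for j
    have "sum d {i} \<le> suminf d"
    proof (rule sum_le_suminf)
      show "summable d" unfolding d_def by (intro summable_diff summable_wt)
      show "0 \<le> d j" if "j \<in> - {i}" for j using wt_mono[of q t j] t by (simp add: d_def)
    qed simp
    also have "suminf d = suminf (wt t) - suminf (wt q)"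
      unfolding d_def by (rule suminf_diff[OF summable_wt summable_wt, symmetric])
    finally have "(1/2) ^ i \<le> suminf (wt t) - suminf (wt q)"
      using i t by (simp add: d_def wt_def)
    then show ?thesis by (simp add: jump_def)
  qed
  then show ?thesis by (intro exI[of _ "(1/2) ^ i"]) simp
qed

text \<open>Close to v no rational among the first N is crossed, so only the tail of the series can
  change. That tail is at most twice the N-th power of 1/2, whence the bound e / 4.\<close>

lemma jump_continuous_irrational:
  assumes v: "v \<notin> \<rat>" and e: "e > 0"
  shows "\<exists>d>0. \<forall>t. \<bar>t - v\<bar> < d \<longrightarrow> \<bar>jump t - jump v\<bar> < e"
proof -
  obtain N where N: "(1/2 :: real) ^ N < e / 4"
    using real_arch_pow_inv[of "e / 4" "1/2"] e by auto
  obtain d where d: "d > 0" "\<And>x. x \<in> rat_enum ` {..<N} \<Longrightarrow> x \<noteq> v \<Longrightarrow> d \<le> dist v x"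
    using finite_set_avoid[of "rat_enum ` {..<N}" v] by auto
  have "\<bar>jump t - jump v\<bar> < e" if t: "\<bar>t - v\<bar> < min d (e / 2)" for t
  proof -
    define f where "f i = wt t i - wt v i" for i
    have f0: "f i = 0" if "i < N" for i
    proof -
      have "rat_enum i \<noteq> v" using rat_enum_Rats v by metis
      then have "d \<le> \<bar>v - rat_enum i\<bar>" using d(2)[of "rat_enum i"] that by (simp add: dist_real_def)
      then show ?thesis using t by (auto simp: f_def wt_def)
    qed
    have sf: "summable f" unfolding f_def by (intro summable_diff summable_wt)
    have "suminf f = (\<Sum>i. f (i + N)) + sum f {..<N}"
      by (rule suminf_split_initial_segment[OF sf])
    also have "sum f {..<N} = 0" using f0 by simp
    finally have "suminf f = (\<Sum>i. f (i + N))" by simp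
    moreover have "norm (\<Sum>i. f (i + N)) \<le> (\<Sum>i. (1/2) ^ N * (1/2) ^ i)"
    proof (rule norm_suminf_le)
      show "norm (f (i + N)) \<le> (1/2) ^ N * (1/2) ^ i" for i
        by (simp add: f_def wt_def power_add)
      show "summable (\<lambda>i. (1/2 :: real) ^ N * (1/2) ^ i)" by (intro summable_mult summable_half)
    qed
    moreover have "(\<Sum>i. (1/2 :: real) ^ N * (1/2) ^ i) = (1/2) ^ N * 2"
      by (subst suminf_mult[OF summable_half]) (simp add: suminf_geometric)
    ultimately have "\<bar>suminf f\<bar> < e / 2" using N by simp
    moreover have "jump t - jump v = (t - v) + suminf f"
      unfolding f_def jump_def by (simp add: suminf_diff[OF summable_wt summable_wt, symmetric])
    ultimately show ?thesis using t by linarith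
  qed
  then show ?thesis using d(1) e by (intro exI[of _ "min d (e / 2)"]) auto
qed

definition stair :: "real \<Rightarrow> real" where
  "stair r = Sup {t. jump t \<le> r}"

lemma bdd_above_jump: "bdd_above {t. jump t \<le> r}"
  by (rule bdd_aboveI[of _ r]) (use jump_bounds(1) order_trans in blast)

lemma jump_le_imp: "jump t \<le> r \<Longrightarrow> t \<le> stair r"
  unfolding stair_def by (rule cSup_upper) (simp_all add: bdd_above_jump)

lemma jump_gt_imp: assumes "r < jump t" shows "stair r \<le> t"
  unfolding stair_def
proof (rule cSup_least)
  have "jump (r - 2) \<le> r" using jump_bounds(2)[of "r - 2"] by simp
  then show "{t. jump t \<le> r} \<noteq> {}" by blast
  show "x \<le> t" if "x \<in> {t. jump t \<le> r}" for x
  proof -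
    have "jump x \<le> jump t" using that assms by simp
    then show ?thesis by (simp add: jump_le_iff)
  qed
qed

lemma stair_jump [simp]: "stair (jump t) = t"
proof (rule antisym)
  show "t \<le> stair (jump t)" by (rule jump_le_imp) simp
  show "stair (jump t) \<le> t"
    by (rule field_le_epsilon) (intro jump_gt_imp jump_strict_mono, simp)
qed

lemma stair_mono: assumes "r \<le> s" shows "stair r \<le> stair s"
proof (rule ccontr)
  assume "\<not> ?thesis"
  then obtain t where t: "stair s < t" "t < stair r" using dense[of "stair s" "stair r"] by auto
  then have "jump t \<le> r" using jump_gt_imp by (meson not_le)
  then show False using jump_le_imp[of t s] assms t by simp
qed

lemma stair_less_imp: "stair r < stair s \<Longrightarrow> r < s"
  using stair_mono by (meson not_le)

text \<open>A monotone function with open range has no jumps, and \<open>stair\<close> attains every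
  t at \<open>jump t\<close>.\<close>

lemma continuous_stair: "continuous_on UNIV stair"
proof (rule continuous_onI_mono)
  have "range stair = UNIV" using stair_jump by (metis surjI)
  then show "open (range stair)" by simp
qed (rule stair_mono)

definition flat :: "real set" where
  "flat = {r. \<exists>e>0. \<forall>s. \<bar>s - r\<bar> < e \<longrightarrow> stair s = stair r}"

lemma flatI:
  assumes "a < r" "r < b" "stair a = stair b" shows "r \<in> flat"
proof -
  have "stair s = stair r" if "\<bar>s - r\<bar> < min (r - a) (b - r)" for s
  proof -
    have "a \<le> s" "s \<le> b" using that by linarith+
    then show ?thesis
      using stair_mono[of a s] stair_mono[of s b] stair_mono[of a r] stair_mono[of r b] assms by auto
  qed
  moreover have "min (r - a) (b - r) > 0" using assms by simp
  ultimately show ?thesis unfolding flat_def by blast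
qed

lemma flatE:
  assumes "r \<in> flat"
  obtains a b where "a < r" "r < b" "stair a = stair r" "stair b = stair r"
proof -
  obtain e where e: "e > 0" "\<And>s. \<bar>s - r\<bar> < e \<Longrightarrow> stair s = stair r" using assms unfolding flat_def by blast
  have "stair (r - e / 2) = stair r" "stair (r + e / 2) = stair r" using e(1) by (auto intro!: e(2))
  then show ?thesis using e(1) by (intro that[of "r - e / 2" "r + e / 2"]) simp_all
qed

lemma open_flat: "open flat"
proof (subst open_subopen, rule ballI)
  fix r assume "r \<in> flat"
  then obtain a b where ab: "a < r" "r < b" "stair a = stair r" "stair b = stair r" by (rule flatE)
  then have "{a<..<b} \<subseteq> flat" using flatI[of a _ b] by auto
  then show "\<exists>T. open T \<and> r \<in> T \<and> T \<subseteq> flat" using ab by (intro exI[of _ "{a<..<b}"]) auto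
qed

lemma flat_rational_level:
  assumes "q \<in> \<rat>" shows "\<exists>r\<in>flat. stair r = q"
proof -
  obtain d where d: "d > 0" "\<And>t. t > q \<Longrightarrow> jump q + d + (t - q) \<le> jump t"
    using jump_gap[OF assms] by blast
  have s: "stair r = q" if r: "jump q \<le> r" "r \<le> jump q + d" for r
  proof (rule antisym)
    show "q \<le> stair r" using r by (intro jump_le_imp)
    show "stair r \<le> q"
    proof (rule field_le_epsilon)
      fix e :: real assume "e > 0"
      then show "stair r \<le> q + e" using d(2)[of "q + e"] r by (intro jump_gt_imp) simp
    qed
  qed
  have "jump q + d / 2 \<in> flat"
    by (rule flatI[of "jump q" _ "jump q + d"]) (use d(1) s in auto)
  then show ?thesis using s[of "jump q + d / 2"] d(1) by (intro bexI[of _ "jump q + d / 2"]) auto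
qed

text \<open>On an interval \<open>stair\<close> either is constant or passes a rational value, and
  each rational value is taken on a whole gap.\<close>

lemma flat_dense: assumes "a < b" shows "\<exists>r\<in>flat. a < r \<and> r < b"
proof -
  obtain a' where a': "a < a'" "a' < b" using dense assms by blast
  obtain b' where b': "a' < b'" "b' < b" using dense a' by blast
  show ?thesis
  proof (cases "stair a' = stair b'")
    case True
    then show ?thesis using flatI[of a' "(a' + b') / 2" b'] a' b'
      by (intro bexI[of _ "(a' + b') / 2"]) auto
  next
    case False
    then have "stair a' < stair b'" using stair_mono[of a' b'] b' by simp
    then obtain q where q: "q \<in> \<rat>" "stair a' < q" "q < stair b'" using Rats_dense_in_real by blast
    then obtain r where "r \<in> flat" "stair r = q" using flat_rational_level by blast
    moreover have "a' < r" "r < b'" using calculation q stair_less_imp by auto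
    ultimately show ?thesis using a' b' by (intro bexI[of _ r]) auto
  qed
qed

text \<open>If \<open>stair\<close> has the value v on an interval from a to b, then
  \<open>jump\<close> leaps over this interval at v, which contradicts its continuity at irrational
  points.\<close>

lemma flat_level_rational: assumes "r \<in> flat" shows "stair r \<in> \<rat>"
proof (rule ccontr)
  define v where "v = stair r"
  assume "stair r \<notin> \<rat>"
  then have v: "v \<notin> \<rat>" by (simp add: v_def)
  obtain a b where ab: "a < r" "r < b" "stair a = v" "stair b = v" using flatE[OF assms] v_def by metis
  then obtain d where d: "d > 0" "\<And>t. \<bar>t - v\<bar> < d \<Longrightarrow> \<bar>jump t - jump v\<bar> < (b - a) / 2"
    using jump_continuous_irrational[OF v, of "(b - a) / 2"] by auto
  have "jump (v - d / 2) \<le> a"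
    using jump_gt_imp[of a "v - d / 2"] ab d(1) by fastforce
  moreover have "b < jump (v + d / 2)"
    using jump_le_imp[of "v + d / 2" b] ab d(1) by fastforce
  moreover have "\<bar>jump (v - d / 2) - jump v\<bar> < (b - a) / 2" "\<bar>jump (v + d / 2) - jump v\<bar> < (b - a) / 2"
    using d(1) by (intro d(2); simp)+
  then have "jump v - jump (v - d / 2) < (b - a) / 2" "jump (v + d / 2) - jump v < (b - a) / 2"
    by (simp_all only: abs_less_iff minus_diff_eq)
  ultimately show False by (simp add: field_simps)
qed

definition lo :: "real \<Rightarrow> real" where "lo q = Inf {r. stair r = q}"
definition hi :: "real \<Rightarrow> real" where "hi q = Sup {r. stair r = q}"

lemma stair_level: "stair r = q \<longleftrightarrow> lo q \<le> r \<and> r \<le> hi q"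
proof -
  define S where "S = {r. stair r = q}"
  have "jump q \<in> S" by (simp add: S_def)
  then have ne: "S \<noteq> {}" by blast
  have bd: "jump (q - 1) \<le> r" "r \<le> jump (q + 1)" if "r \<in> S" for r
    using that stair_less_imp[of "jump (q - 1)" r] stair_less_imp[of r "jump (q + 1)"] by (auto simp: S_def)
  have bb: "bdd_below S" "bdd_above S"
    using bd by (auto intro: bdd_belowI[of _ "jump (q - 1)"] bdd_aboveI[of _ "jump (q + 1)"])
  have cl: "closed S"
    using continuous_closed_vimage[of "{q}" stair] continuous_stair
    by (simp add: S_def vimage_def continuous_on_eq_continuous_at)
  have "lo q \<in> S" unfolding lo_def S_def[symmetric] by (rule closed_contains_Inf[OF ne bb(1) cl])
  moreover have "hi q \<in> S" unfolding hi_def S_def[symmetric] by (rule closed_contains_Sup[OF ne bb(2) cl])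
  moreover have "lo q \<le> r" "r \<le> hi q" if "r \<in> S" for r
    unfolding lo_def hi_def S_def[symmetric] using that bb by (auto intro: cInf_lower cSup_upper)
  ultimately show ?thesis
    using stair_mono[of "lo q" r] stair_mono[of r "hi q"] by (auto simp: S_def)
qed

lemma lo_le_hi: "lo q \<le> hi q"
  using stair_level[of "jump q" q] by simp

lemma stair_lo [simp]: "stair (lo q) = q" and stair_hi [simp]: "stair (hi q) = q"
  using stair_level lo_le_hi by blast+

lemma flat_iff: "r \<in> flat \<longleftrightarrow> lo (stair r) < r \<and> r < hi (stair r)"
proof
  assume "r \<in> flat"
  then obtain a b where ab: "a < r" "r < b" "stair a = stair r" "stair b = stair r" by (rule flatE)
  then show "lo (stair r) < r \<and> r < hi (stair r)" using stair_level[of a] stair_level[of b] by force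
next
  assume "lo (stair r) < r \<and> r < hi (stair r)"
  then show "r \<in> flat" by (intro flatI[of "lo (stair r)" r "hi (stair r)"]) auto
qed

lemma flat_gap: "lo q < r \<Longrightarrow> r < hi q \<Longrightarrow> r \<in> flat \<and> stair r = q"
  using stair_level[of r q] flat_iff by auto

lemma lo_hi_not_flat: "lo q \<notin> flat" "hi q \<notin> flat"
  by (simp_all add: flat_iff)

lemma lo_less_hi: "q \<in> \<rat> \<Longrightarrow> lo q < hi q"
  using flat_rational_level[of q] flat_iff by force

text \<open>Identifies the gaps in the set of radii that carry full circles, as needed for the gap
  hypothesis of \<open>connected_by_section\<close>.\<close>

lemma consecutive_not_flat:
  assumes ab: "a < b" "a \<notin> flat" "b \<notin> flat" and fl: "\<And>r. a < r \<Longrightarrow> r < b \<Longrightarrow> r \<in> flat"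
  shows "\<exists>q\<in>\<rat>. a = lo q \<and> b = hi q"
proof -
  define r where "r = (a + b) / 2"
  define q where "q = stair r"
  have r: "a < r" "r < b" using ab(1) by (auto simp: r_def)
  then have "r \<in> flat" using fl by blast
  then have q: "q \<in> \<rat>" "lo q < r" "r < hi q" using flat_level_rational flat_iff by (auto simp: q_def)
  have "\<not> a < lo q" using fl[of "lo q"] lo_hi_not_flat q(2) r by auto
  moreover have "\<not> lo q < a" using flat_gap[of q a] q r ab by auto
  moreover have "\<not> hi q < b" using fl[of "hi q"] lo_hi_not_flat q(3) r by auto
  moreover have "\<not> b < hi q" using flat_gap[of q b] q r ab by auto
  ultimately show ?thesis using q(1) by (intro bexI[of _ q]) auto
qed

text \<open>The jump at the rational -1 lifts \<open>jump t\<close> to at least t + d for t > -1,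
  hence above 0 already for some t < 0. So the level 0 is reached only at positive radii, and the
  wheel stays away from the centre.\<close>

lemma stair_nonneg_imp_pos: assumes "0 \<le> stair r" shows "0 < r"
proof -
  obtain d where d: "d > 0" "\<And>t. t > -1 \<Longrightarrow> jump (-1) + d + (t - -1) \<le> jump t"
    using jump_gap[of "-1"] by auto
  define t where "t = - min 1 d / 2"
  have "t > -1" "t < 0" using d(1) by (auto simp: t_def min_def)
  have "jump t \<ge> d + t" using d(2)[OF \<open>t > -1\<close>] jump_bounds(1)[of "-1"] by simp
  moreover have "d + t > 0" using d(1) by (auto simp: t_def min_def)
  ultimately have "0 < jump t" by linarith
  then show ?thesis using jump_gt_imp[of r t] assms \<open>t < 0\<close> by fastforce
qed

section \<open>Attaching whiskers to a compact set\<close>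


text \<open>Connectedness im kleinen at every point, in metric form. Over all points it yields local
  connectedness, and it is easier to check because the connected set need not be a
  neighbourhood.\<close>

definition im_kleinen :: "'a::metric_space set \<Rightarrow> bool" where
  "im_kleinen S \<longleftrightarrow> (\<forall>x\<in>S. \<forall>\<epsilon>>0. \<exists>\<delta>>0. \<forall>y\<in>S. dist x y < \<delta> \<longrightarrow>
     (\<exists>c. connected c \<and> c \<subseteq> S \<inter> ball x \<epsilon> \<and> x \<in> c \<and> y \<in> c))"

lemma im_kleinenD:
  assumes "im_kleinen S" "x \<in> S" "\<epsilon> > 0"
  obtains \<delta> where "\<delta> > 0" "\<And>y. y \<in> S \<Longrightarrow> dist x y < \<delta> \<Longrightarrow> \<exists>c. connected c \<and> c \<subseteq> S \<inter> ball x \<epsilon> \<and> x \<in> c \<and> y \<in> c"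
  using assms unfolding im_kleinen_def by metis

lemma im_kleinen_imp_locally_connected:
  assumes "im_kleinen S" shows "locally connected S"
  unfolding locally_connected_im_kleinen
proof (intro allI impI)
  fix v x assume "openin (top_of_set S) v \<and> x \<in> v"
  then obtain \<epsilon> where \<epsilon>: "x \<in> S" "\<epsilon> > 0" "ball x \<epsilon> \<inter> S \<subseteq> v" and vS: "v \<subseteq> S"
    by (metis openin_contains_ball openin_imp_subset subsetD)
  obtain \<delta> where \<delta>: "\<delta> > 0" "\<And>y. y \<in> S \<Longrightarrow> dist x y < \<delta> \<Longrightarrow> \<exists>c. connected c \<and> c \<subseteq> S \<inter> ball x \<epsilon> \<and> x \<in> c \<and> y \<in> c"
    by (rule im_kleinenD[OF assms \<epsilon>(1,2)]) blast
  define u where "u = S \<inter> ball x (min \<delta> \<epsilon>)"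
  have "openin (top_of_set S) u" unfolding u_def by (simp add: openin_open_Int)
  moreover have "x \<in> u" using \<epsilon> \<delta>(1) by (simp add: u_def)
  moreover have "u \<subseteq> v" using \<epsilon>(3) by (auto simp: u_def)
  moreover have "\<exists>c. connected c \<and> c \<subseteq> v \<and> x \<in> c \<and> y \<in> c" if "y \<in> u" for y
  proof -
    obtain c where "connected c" "c \<subseteq> S \<inter> ball x \<epsilon>" "x \<in> c" "y \<in> c"
      using \<delta>(2)[of y] \<open>y \<in> u\<close> by (auto simp: u_def)
    then show ?thesis using \<epsilon>(3) by blast
  qed
  ultimately show "\<exists>u. openin (top_of_set S) u \<and> x \<in> u \<and> u \<subseteq> v \<and>
      (\<forall>y. y \<in> u \<longrightarrow> (\<exists>c. connected c \<and> c \<subseteq> v \<and> x \<in> c \<and> y \<in> c))" by blast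
qed

lemma connected_Un_UN_meeting:
  assumes R: "connected R" and C: "\<And>i. i \<in> A \<Longrightarrow> connected (C i) \<and> C i \<inter> R \<noteq> {}"
  shows "connected (R \<union> (\<Union>i\<in>A. C i))"
proof (cases "R = {}")
  case True
  then have "A = {}" using C by auto
  then show ?thesis using R by simp
next
  case False
  have "connected (\<Union>(insert R ((\<lambda>i. R \<union> C i) ` A)))"
  proof (rule connected_Union)
    show "connected s" if "s \<in> insert R ((\<lambda>i. R \<union> C i) ` A)" for s
      using that R C by (auto intro: connected_Un simp: Int_commute)
    show "\<Inter>(insert R ((\<lambda>i. R \<union> C i) ` A)) \<noteq> {}" using False by auto
  qed
  moreover have "\<Union>(insert R ((\<lambda>i. R \<union> C i) ` A)) = R \<union> (\<Union>i\<in>A. C i)" by auto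
  ultimately show ?thesis by simp
qed

text \<open>Disjoint relatively open blocks are also relatively closed, so a connected set that
  contains one block cannot leave it.\<close>

lemma components_of_partition:
  assumes P: "\<Union>\<P> = S" "\<And>C. C \<in> \<P> \<Longrightarrow> connected C \<and> C \<noteq> {} \<and> openin (top_of_set S) C"
    and disj: "\<And>C D. C \<in> \<P> \<Longrightarrow> D \<in> \<P> \<Longrightarrow> C \<noteq> D \<Longrightarrow> C \<inter> D = {}"
  shows "components S = \<P>"
proof -
  have sub: "C \<in> components S" if C: "C \<in> \<P>" for C
    unfolding in_components_maximal
  proof (intro conjI allI impI)
    show "C \<noteq> {}" "C \<subseteq> S" "connected C" using P C by auto
    fix D assume D: "D \<noteq> {} \<and> C \<subseteq> D \<and> D \<subseteq> S \<and> connected D"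
    have "openin (top_of_set S) (\<Union>(\<P> - {C}))" using P(2) by (intro openin_Union) auto
    moreover have op: "openin (top_of_set D) (D \<inter> T)" if "openin (top_of_set S) T" for T
    proof -
      obtain W where "open W" "T = S \<inter> W" using \<open>openin (top_of_set S) T\<close> openin_open by metis
      moreover have "D \<inter> (S \<inter> W) = D \<inter> W" using D by blast
      ultimately show ?thesis by (simp add: openin_open_Int)
    qed
    ultimately have "openin (top_of_set D) (D \<inter> \<Union>(\<P> - {C}))" "openin (top_of_set D) (D \<inter> C)"
      using P(2)[OF C] by blast+
    moreover have "D \<subseteq> (D \<inter> \<Union>(\<P> - {C})) \<union> (D \<inter> C)" using D P(1) by auto
    moreover have "(D \<inter> \<Union>(\<P> - {C})) \<inter> (D \<inter> C) = {}" using disj C by blast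
    moreover have "D \<inter> C \<noteq> {}" using D P(2)[OF C] by auto
    ultimately have "D \<inter> \<Union>(\<P> - {C}) = {}" using D unfolding connected_openin by blast
    moreover have "D \<subseteq> \<Union>(\<P> - {C}) \<union> C" using D P(1) by blast
    ultimately have "D \<subseteq> C" by (meson Un_iff disjoint_iff subset_iff)
    then show "D = C" using D by (simp add: subset_antisym)
  qed
  moreover have "D \<in> \<P>" if D: "D \<in> components S" for D
  proof -
    obtain x where x: "x \<in> D" using in_components_nonempty[OF D] by auto
    then have "x \<in> \<Union>\<P>" using in_components_subset[OF D] P(1) by auto
    then obtain C where C: "C \<in> \<P>" "x \<in> C" by blast
    then have "D = C" using components_eq[OF D sub[OF C(1)]] x by blast
    then show ?thesis using C by simp
  qed
  ultimately show ?thesis by blast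
qed

lemma card_components_Un_le_2:
  assumes "connected X" "connected Y"
  shows "card (components (X \<union> Y)) \<le> 2"
proof -
  \<comment> \<open>If X is empty the choice is arbitrary; this is harmless because only an upper
    bound is wanted.\<close>
  define a where "a = (SOME x. x \<in> X)"
  define b where "b = (SOME x. x \<in> Y)"
  let ?S = "X \<union> Y"
  have "components ?S \<subseteq> {connected_component_set ?S a, connected_component_set ?S b}"
  proof
    fix D assume "D \<in> components ?S"
    then obtain x where x: "x \<in> ?S" "D = connected_component_set ?S x" by (auto simp: components_iff)
    have eq: "connected_component_set ?S x = connected_component_set ?S (SOME x. x \<in> Z)"
      if "Z = X \<or> Z = Y" "x \<in> Z" for Z
    proof -
      have "(SOME x. x \<in> Z) \<in> Z" using that(2) by (rule someI)
      then have "connected_component ?S x (SOME x. x \<in> Z)"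
        using that assms unfolding connected_component_def by (intro exI[of _ Z]) auto
      then show ?thesis by (simp add: connected_component_eq_eq connected_component_eq)
    qed
    show "D \<in> {connected_component_set ?S a, connected_component_set ?S b}"
      using x eq[of X] eq[of Y] by (auto simp: a_def b_def)
  qed
  then have "card (components ?S) \<le> card {connected_component_set ?S a, connected_component_set ?S b}"
    by (intro card_mono) auto
  also have "\<dots> \<le> 2" by (simp add: card_insert_if)
  finally show ?thesis .
qed

lemma connected_half_open_segment:
  fixes a b :: "'a::euclidean_space"
  shows "connected (closed_segment a b - {a})" "connected (closed_segment a b - {b})"
  using extreme_point_of_stillconvex[OF convex_closed_segment, of a a b]
    extreme_point_of_stillconvex[OF convex_closed_segment, of b a b]
  by (auto simp: extreme_point_of_segment intro: convex_connected)

text \<open>\<open>p i\<close> is the foot and \<open>e i\<close> the free end of whisker i.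
  Whiskers may share a foot, as disjointness is asked only off K; \<open>null\<close> makes their
  lengths tend to 0.\<close>

locale hairy_set =
  fixes K :: "'a::euclidean_space set" and A :: "'i set" and p e :: "'i \<Rightarrow> 'a"
  assumes compact_base: "compact K"
    and base_meets: "\<And>i. i \<in> A \<Longrightarrow> closed_segment (p i) (e i) \<inter> K = {p i}"
    and nondegenerate: "\<And>i. i \<in> A \<Longrightarrow> p i \<noteq> e i"
    and null: "\<And>\<epsilon>. \<epsilon> > 0 \<Longrightarrow> finite {i\<in>A. \<epsilon> \<le> dist (p i) (e i)}"
    and disjoint: "\<And>i j. i \<in> A \<Longrightarrow> j \<in> A \<Longrightarrow> i \<noteq> j \<Longrightarrow> closed_segment (p i) (e i) \<inter> closed_segment (p j) (e j) \<subseteq> K"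
begin

abbreviation seg :: "'i \<Rightarrow> 'a set" where "seg i \<equiv> closed_segment (p i) (e i)"

definition Y :: "'a set" where "Y = K \<union> (\<Union>i\<in>A. seg i)"

lemma p_in_K: "i \<in> A \<Longrightarrow> p i \<in> K"
  using base_meets by blast

lemma seg_near: "y \<in> seg i \<Longrightarrow> dist (p i) y \<le> dist (p i) (e i)"
  using dist_in_closed_segment[of y "p i" "e i"] by (simp add: dist_commute)

text \<open>A point at distance d from K is approached only by whiskers of length at least d / 2, of
  which there are finitely many. Subfamilies are allowed so that the complement of all but one
  whisker is known to be open.\<close>

lemma closed_partial:
  assumes "A' \<subseteq> A"
  shows "closed (K \<union> (\<Union>i\<in>A'. seg i))" (is "closed ?Z")
proof -
  have "\<exists>T. open T \<and> z \<in> T \<and> T \<subseteq> - ?Z" if z: "z \<in> - ?Z" for z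
  proof (cases "K = {}")
    case True
    then have "A' = {}" using assms p_in_K by auto
    then show ?thesis using True by (intro exI[of _ UNIV]) auto
  next
    case False
    define d where "d = infdist z K"
    have d: "d > 0" using z False compact_imp_closed[OF compact_base] 
      by (simp add: d_def infdist_pos_not_in_closed)
    define L where "L = {i\<in>A'. d / 2 \<le> dist (p i) (e i)}"
    have "finite L" using null[of "d / 2"] d assms by (auto simp: L_def intro: finite_subset[rotated])
    then have cl: "closed (\<Union>i\<in>L. seg i)" by (intro closed_UN) auto
    have "ball z (d / 2) - (\<Union>i\<in>L. seg i) \<subseteq> - ?Z"
    proof
      fix y assume y: "y \<in> ball z (d / 2) - (\<Union>i\<in>L. seg i)"
      have "y \<notin> K" using infdist_le[of y K z] y d by (auto simp: d_def)
      moreover have "y \<notin> seg i" if i: "i \<in> A'" for i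
      proof
        assume yi: "y \<in> seg i"
        then have "i \<notin> L" using y by blast
        then have "dist (p i) (e i) < d / 2" using i by (auto simp: L_def)
        then have "dist (p i) y < d / 2" using seg_near[OF yi] by simp
        moreover have "d \<le> dist z (p i)" using infdist_le[of "p i" K z] p_in_K i assms by (auto simp: d_def)
        ultimately show False using y dist_triangle[of z "p i" y] by (simp add: dist_commute)
      qed
      ultimately show "y \<in> - ?Z" by blast
    qed
    moreover have "open (ball z (d / 2) - (\<Union>i\<in>L. seg i))" using cl by (rule open_Diff[OF open_ball])
    moreover have "z \<in> ball z (d / 2) - (\<Union>i\<in>L. seg i)" using d z by (auto simp: L_def)
    ultimately show ?thesis by blast
  qed
  then have "open (- ?Z)" by (subst open_subopen) blast
  then show ?thesis by (simp add: closed_def)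
qed

lemma compact_Y: "compact Y"
proof -
  obtain b where b: "\<And>x. x \<in> K \<Longrightarrow> norm x \<le> b"
    using compact_imp_bounded[OF compact_base] bounded_iff by blast
  define L where "L = {i\<in>A. 1 \<le> dist (p i) (e i)}"
  have "finite L" using null[of 1] by (simp add: L_def)
  then have "compact (\<Union>i\<in>L. seg i)" by (intro compact_UN) auto
  moreover have "Y \<subseteq> (\<Union>i\<in>L. seg i) \<union> cball 0 (b + 1)"
  proof
    fix y assume "y \<in> Y"
    then consider "y \<in> K" | i where "i \<in> A" "y \<in> seg i" by (auto simp: Y_def)
    then show "y \<in> (\<Union>i\<in>L. seg i) \<union> cball 0 (b + 1)"
    proof cases
      case 1 then show ?thesis using b[of y] by auto
    next
      case 2
      show ?thesis
      proof (cases "i \<in> L")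
        case False
        then have "dist (p i) y \<le> 1" using seg_near[OF 2(2)] 2(1) by (auto simp: L_def)
        then have "norm y \<le> b + 1"
          using b[OF p_in_K[OF 2(1)]] norm_triangle_ineq2[of y "p i"] by (simp add: dist_norm norm_minus_commute)
        then show ?thesis by simp
      qed (use 2 in blast)
    qed
  qed
  then have "bounded Y"
    using calculation by (meson bounded_Un bounded_cball bounded_subset compact_imp_bounded)
  then show ?thesis using closed_partial[of A] by (simp add: compact_eq_bounded_closed Y_def)
qed

lemma connected_partial:
  assumes "connected R" "\<And>i. i \<in> A' \<Longrightarrow> p i \<in> R"
  shows "connected (R \<union> (\<Union>i\<in>A'. seg i))"
  by (rule connected_Un_UN_meeting) (use assms in auto)

lemma connected_Y: "connected K \<Longrightarrow> connected Y"
  unfolding Y_def using p_in_K by (intro connected_partial) auto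

text \<open>Near a point z of K a short whisker is reached through its foot, inside K, and then as a
  whole. The finitely many long whiskers either pass through z, and a subsegment serves, or stay at
  a positive distance. Near a point off K only one whisker is present.\<close>

lemma im_kleinen_Y:
  assumes K: "im_kleinen K"
  shows "im_kleinen Y"
  unfolding im_kleinen_def
proof (intro ballI allI impI)
  fix z \<epsilon> assume z: "z \<in> Y" and \<epsilon>: "(\<epsilon>::real) > 0"
  show "\<exists>\<delta>>0. \<forall>y\<in>Y. dist z y < \<delta> \<longrightarrow> (\<exists>c. connected c \<and> c \<subseteq> Y \<inter> ball z \<epsilon> \<and> z \<in> c \<and> y \<in> c)"
  proof (cases "z \<in> K")
    case True
    obtain d where d: "d > 0" "\<And>y. y \<in> K \<Longrightarrow> dist z y < d \<Longrightarrow> \<exists>c. connected c \<and> c \<subseteq> K \<inter> ball z \<epsilon> \<and> z \<in> c \<and> y \<in> c"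
      by (rule im_kleinenD[OF K True \<epsilon>]) blast
    define \<eta> where "\<eta> = min d \<epsilon> / 2"
    have \<eta>: "\<eta> > 0" "2 * \<eta> \<le> d" "2 * \<eta> \<le> \<epsilon>" using d(1) \<epsilon> by (auto simp: \<eta>_def)
    define L where "L = {i\<in>A. \<eta> \<le> dist (p i) (e i)}"
    define L' where "L' = {i\<in>L. z \<notin> seg i}"
    have "finite L" using null[OF \<eta>(1)] by (simp add: L_def)
    then have "closed (\<Union>i\<in>L'. seg i)" by (intro closed_UN) (auto simp: L'_def)
    then have "open (- (\<Union>i\<in>L'. seg i))" by (rule open_Compl)
    moreover have "z \<in> - (\<Union>i\<in>L'. seg i)" by (auto simp: L'_def)
    ultimately obtain d' where d': "d' > 0" "ball z d' \<subseteq> - (\<Union>i\<in>L'. seg i)" using openE by metis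
    have "\<exists>c. connected c \<and> c \<subseteq> Y \<inter> ball z \<epsilon> \<and> z \<in> c \<and> y \<in> c" if y: "y \<in> Y" "dist z y < min \<eta> d'" for y
    proof (cases "y \<in> K")
      case yK: True
      then have "dist z y < d" using y \<eta> by simp
      from d(2)[OF yK this] show ?thesis by (auto simp: Y_def)
    next
      case False
      then obtain i where i: "i \<in> A" "y \<in> seg i" using y by (auto simp: Y_def)
      show ?thesis
      proof (cases "i \<in> L")
        case True
        then have "i \<notin> L'" using d'(2) y(2) i by auto
        then have "z \<in> seg i" using True by (auto simp: L'_def)
        then have "closed_segment z y \<subseteq> seg i" using i(2) by (intro closed_segment_subset convex_closed_segment)
        then have "closed_segment z y \<subseteq> Y" using i(1) by (auto simp: Y_def)
        moreover have "closed_segment z y \<subseteq> ball z \<epsilon>"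
          using y(2) \<eta> \<epsilon> by (intro closed_segment_subset convex_ball) auto
        ultimately show ?thesis by (intro exI[of _ "closed_segment z y"]) auto
      next
        case False
        then have len: "dist (p i) (e i) < \<eta>" using i by (auto simp: L_def)
        then have "dist z (p i) < 2 * \<eta>"
          using y(2) seg_near[OF i(2)] dist_triangle[of z "p i" y] by (simp add: dist_commute)
        then have "dist z (p i) < d" using \<eta> by simp
        then obtain c where c: "connected c" "c \<subseteq> K \<inter> ball z \<epsilon>" "z \<in> c" "p i \<in> c"
          using d(2) p_in_K i(1) by blast
        have "seg i \<subseteq> ball z \<epsilon>"
        proof (intro closed_segment_subset convex_ball)
          show "p i \<in> ball z \<epsilon>" using c by auto
          have "dist y (e i) \<le> dist (p i) (e i)"
            using dist_in_closed_segment[OF i(2)] by simp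
          then show "e i \<in> ball z \<epsilon>" using dist_triangle[of z "e i" y] y(2) len \<eta> by simp
        qed
        moreover have "connected (c \<union> seg i)" using c by (intro connected_Un) auto
        ultimately show ?thesis using c i by (intro exI[of _ "c \<union> seg i"]) (auto simp: Y_def)
      qed
    qed
    then show ?thesis using \<eta>(1) d'(1) by (intro exI[of _ "min \<eta> d'"]) auto
  next
    case False
    then obtain i where i: "i \<in> A" "z \<in> seg i" using z by (auto simp: Y_def)
    have "closed (K \<union> (\<Union>j\<in>A - {i}. seg j))" by (rule closed_partial) auto
    moreover have "z \<notin> K \<union> (\<Union>j\<in>A - {i}. seg j)" using False disjoint[OF i(1)] i by blast
    ultimately obtain d where d: "d > 0" "ball z d \<subseteq> - (K \<union> (\<Union>j\<in>A - {i}. seg j))"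
      using openE[of "- (K \<union> (\<Union>j\<in>A - {i}. seg j))" z] by (auto simp: closed_def)
    have "\<exists>c. connected c \<and> c \<subseteq> Y \<inter> ball z \<epsilon> \<and> z \<in> c \<and> y \<in> c" if y: "y \<in> Y" "dist z y < min d \<epsilon>" for y
    proof -
      have "y \<in> ball z d" using y by simp
      then have "y \<in> seg i" using y(1) d(2) by (auto simp: Y_def)
      then have "closed_segment z y \<subseteq> seg i" using i(2) by (intro closed_segment_subset convex_closed_segment)
      then have "closed_segment z y \<subseteq> Y" using i(1) by (auto simp: Y_def)
      moreover have "closed_segment z y \<subseteq> ball z \<epsilon>"
        using y(2) \<epsilon> by (intro closed_segment_subset convex_ball) auto
      ultimately show ?thesis by (intro exI[of _ "closed_segment z y"]) auto
    qed
    then show ?thesis using d(1) \<epsilon> by (intro exI[of _ "min d \<epsilon>"]) auto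
  qed
qed

text \<open>The components are the half-open whiskers rooted at q and one further set R, formed by
  the rest of K and all whiskers rooted elsewhere.\<close>

lemma card_components_base:
  assumes q: "q \<in> K" and con: "connected (K - {q})" "K - {q} \<noteq> {}" and fin: "finite {i\<in>A. p i = q}"
  shows "card (components (Y - {q})) = Suc (card {i\<in>A. p i = q})"
proof -
  define J where "J = {i\<in>A. p i = q}"
  define R where "R = (K - {q}) \<union> (\<Union>i\<in>A - J. seg i)"
  define H where "H i = seg i - {q}" for i
  have qseg: "q \<notin> seg i" if "i \<in> A - J" for i
  proof
    assume "q \<in> seg i"
    then have "q \<in> {p i}" using q base_meets[of i] that by blast
    then show False using that by (simp add: J_def)
  qed
  have HK: "H i \<inter> K = {}" if "i \<in> J" for i using that base_meets[of i] by (auto simp: H_def J_def)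
  have eH: "e i \<in> H i" if "i \<in> J" for i using that nondegenerate[of i] by (auto simp: H_def J_def)
  have Hdisj: "H i \<inter> seg j = {}" if "i \<in> J" "j \<in> A" "i \<noteq> j" for i j
    using disjoint[of i j] HK[OF that(1)] that by (auto simp: H_def J_def)
  have eq: "\<Union>(insert R (H ` J)) = Y - {q}"
    using qseg by (auto simp: R_def H_def Y_def J_def)
  have "components (Y - {q}) = insert R (H ` J)"
  proof (rule components_of_partition[OF eq])
    fix C assume "C \<in> insert R (H ` J)"
    then consider "C = R" | i where "i \<in> J" "C = H i" by blast
    then show "connected C \<and> C \<noteq> {} \<and> openin (top_of_set (Y - {q})) C"
    proof cases
      case 1
      have "connected R" unfolding R_def
        by (rule connected_partial[OF con(1)]) (use p_in_K in \<open>auto simp: J_def\<close>)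
      moreover have "closed (\<Union>i\<in>J. seg i)" using fin by (intro closed_UN) (auto simp: J_def)
      moreover have "R = (Y - {q}) \<inter> - (\<Union>i\<in>J. seg i)"
      proof
        show "(Y - {q}) \<inter> - (\<Union>i\<in>J. seg i) \<subseteq> R" by (auto simp: R_def Y_def)
        have "x \<notin> seg j" if "x \<in> R" "j \<in> J" for x j
        proof
          assume "x \<in> seg j"
          have "x \<noteq> q" using that(1) qseg by (auto simp: R_def)
          then have "x \<in> H j" using \<open>x \<in> seg j\<close> by (simp add: H_def)
          then show False using that HK[OF that(2)] Hdisj[OF that(2)] by (fastforce simp: R_def)
        qed
        moreover have "R \<subseteq> Y - {q}" using eq by blast
        ultimately show "R \<subseteq> (Y - {q}) \<inter> - (\<Union>i\<in>J. seg i)" by blast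
      qed
      ultimately show ?thesis using 1 con(2) unfolding openin_open
        by (auto simp: R_def intro: exI[of _ "- (\<Union>i\<in>J. seg i)"])
    next
      case 2
      have "connected (H i)" using 2 connected_half_open_segment(1)[of "p i" "e i"] by (simp add: H_def J_def)
      moreover have "closed (K \<union> (\<Union>j\<in>A - {i}. seg j))" by (rule closed_partial) auto
      moreover have "H i = (Y - {q}) \<inter> - (K \<union> (\<Union>j\<in>A - {i}. seg j))"
        using HK[OF 2(1)] Hdisj[OF 2(1)] 2(1) q by (auto simp: H_def Y_def J_def)
      moreover have "H i \<noteq> {}" using eH[OF 2(1)] by blast
      ultimately show ?thesis using 2(2) unfolding openin_open by blast
    qed
  next
    fix C D assume "C \<in> insert R (H ` J)" "D \<in> insert R (H ` J)" "C \<noteq> D"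
    moreover have "H i \<inter> R = {}" if "i \<in> J" for i
      using HK[OF that] Hdisj[OF that] that by (fastforce simp: R_def J_def)
    moreover have "H i \<inter> H j = {}" if "i \<in> J" "j \<in> J" "i \<noteq> j" for i j
      using Hdisj[of i j] that by (auto simp: H_def J_def)
    ultimately show "C \<inter> D = {}" by blast
  qed
  moreover have "R \<notin> H ` J"
    using con(2) HK by (auto simp: R_def)
  moreover have "inj_on H J"
    using Hdisj eH by (intro inj_onI) (metis (no_types, lifting) DiffE H_def J_def disjoint_iff mem_Collect_eq)
  ultimately show ?thesis using fin by (simp add: card_image J_def)
qed

text \<open>A point of a whisker separates the outer part of that whisker from everything else; the
  outer part is empty when q is the free end, hence only an inequality.\<close>

lemma card_components_arm:
  assumes "q \<in> Y" "q \<notin> K" "connected K"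
  shows "card (components (Y - {q})) \<le> 2"
proof -
  obtain i where i: "i \<in> A" "q \<in> seg i" using assms by (auto simp: Y_def)
  have qj: "q \<notin> seg j" if "j \<in> A - {i}" for j using disjoint[OF i(1)] that i(2) assms(2) by blast
  have "q \<noteq> p i" using p_in_K[OF i(1)] assms(2) by auto
  define X where "X = (K \<union> (\<Union>j\<in>A - {i}. seg j)) \<union> (closed_segment (p i) q - {q})"
  define Z where "Z = closed_segment q (e i) - {q}"
  have "connected (K \<union> (\<Union>j\<in>A - {i}. seg j))"
    by (rule connected_partial[OF assms(3)]) (use p_in_K in auto)
  then have "connected X" unfolding X_def
  proof (rule connected_Un)
    show "connected (closed_segment (p i) q - {q})" by (rule connected_half_open_segment)
    show "(K \<union> (\<Union>j\<in>A - {i}. seg j)) \<inter> (closed_segment (p i) q - {q}) \<noteq> {}"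
      using p_in_K[OF i(1)] \<open>q \<noteq> p i\<close> by auto
  qed
  moreover have "connected Z" unfolding Z_def by (rule connected_half_open_segment)
  moreover have "Y - {q} = X \<union> Z"
    using i assms(2) qj Un_closed_segment[OF i(2)] by (auto simp: Y_def X_def Z_def)
  ultimately show ?thesis using card_components_Un_le_2 by metis
qed

end

section \<open>The wheel continuum\<close>


text \<open>Closedness provides the least point of \<beta> in the interval and then the greatest
  point of \<alpha> before it.\<close>

lemma consecutive_exists:
  fixes \<alpha> \<beta> :: "real set"
  assumes cl: "closed \<alpha>" "closed \<beta>" and ab: "a0 \<in> \<alpha>" "b0 \<in> \<beta>" "a0 < b0"
    and disj: "\<alpha> \<inter> \<beta> = {}"
  shows "\<exists>a\<in>\<alpha>. \<exists>b\<in>\<beta>. a0 \<le> a \<and> a < b \<and> b \<le> b0 \<and> (\<forall>r. a < r \<and> r < b \<longrightarrow> r \<notin> \<alpha> \<union> \<beta>)"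
proof -
  define B where "B = \<beta> \<inter> {a0..b0}"
  have B: "closed B" "B \<noteq> {}" "bdd_below B" using cl ab by (auto simp: B_def)
  define b where "b = Inf B"
  have b: "b \<in> B" unfolding b_def by (rule closed_contains_Inf[OF B(2,3,1)])
  define A where "A = \<alpha> \<inter> {a0..b}"
  have A: "closed A" "A \<noteq> {}" "bdd_above A" using cl ab b by (auto simp: A_def B_def)
  define a where "a = Sup A"
  have a: "a \<in> A" unfolding a_def by (rule closed_contains_Sup[OF A(2,3,1)])
  have "a \<noteq> b" using a b disj by (auto simp: A_def B_def)
  then have "a < b" using a by (simp add: A_def)
  moreover have "r \<notin> \<alpha> \<union> \<beta>" if r: "a < r" "r < b" for r
  proof
    assume "r \<in> \<alpha> \<union> \<beta>"
    then show False
    proof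
      assume "r \<in> \<alpha>"
      then have "r \<in> A" using r a by (auto simp: A_def)
      then have "r \<le> a" unfolding a_def by (rule cSup_upper[OF _ A(3)])
      then show False using r by simp
    next
      assume "r \<in> \<beta>"
      then have "r \<in> B" using r a b by (auto simp: A_def B_def)
      then have "b \<le> r" unfolding b_def by (rule cInf_lower[OF _ B(3)])
      then show False using r by simp
    qed
  qed
  ultimately show ?thesis using a b by (intro bexI[of _ a] bexI[of _ b]) (auto simp: A_def B_def)
qed

text \<open>A separation of W pulls back along \<sigma> to a partition of the closed parameter set
  \<open>Z \<inter> {s..t}\<close> into two closed sets, both nonempty by \<open>join\<close>. Two
  neighbouring parameters from different sets bound a gap of Z, and \<open>gap\<close> bridges it by
  a connected set.\<close>

lemma connected_by_section:
  fixes \<sigma> :: "real \<Rightarrow> 'a::topological_space"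
  assumes Z: "closed Z" and con: "continuous_on {s..t} \<sigma>"
    and \<sigma>: "\<And>r. r \<in> Z \<inter> {s..t} \<Longrightarrow> \<sigma> r \<in> W"
    and gap: "\<And>a b. a \<in> Z \<Longrightarrow> b \<in> Z \<Longrightarrow> s \<le> a \<Longrightarrow> a < b \<Longrightarrow> b \<le> t \<Longrightarrow> (\<forall>r. a < r \<and> r < b \<longrightarrow> r \<notin> Z) \<Longrightarrow>
      \<exists>T. connected T \<and> T \<subseteq> W \<and> \<sigma> a \<in> T \<and> \<sigma> b \<in> T"
    and join: "\<And>w. w \<in> W \<Longrightarrow> \<exists>r\<in>Z \<inter> {s..t}. \<exists>T. connected T \<and> T \<subseteq> W \<and> w \<in> T \<and> \<sigma> r \<in> T"
  shows "connected W"
proof (rule ccontr)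
  assume "\<not> connected W"
  then obtain E1 E2 where E: "openin (top_of_set W) E1" "openin (top_of_set W) E2" "E1 \<union> E2 = W"
      "E1 \<inter> E2 = {}" "E1 \<noteq> {}" "E2 \<noteq> {}"
    unfolding connected_openin_eq by blast
  have T: "T \<subseteq> E1 \<or> T \<subseteq> E2" if T: "connected T" "T \<subseteq> W" for T
  proof -
    obtain W1 W2 where W: "open W1" "E1 = W \<inter> W1" "open W2" "E2 = W \<inter> W2"
      using E(1,2) unfolding openin_open by blast
    have "T \<subseteq> W1 \<union> W2" "W1 \<inter> W2 \<inter> T = {}" using T(2) E(3,4) W by blast+
    then have "W1 \<inter> T = {} \<or> W2 \<inter> T = {}" using connectedD[OF T(1) W(1,3)] by blast
    then show ?thesis using T(2) E(3) W by blast
  qed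
  define Z' where "Z' = Z \<inter> {s..t}"
  have Z': "closed Z'" using Z by (auto simp: Z'_def)
  have con': "continuous_on Z' \<sigma>" using con by (rule continuous_on_subset) (auto simp: Z'_def)
  have \<sigma>': "\<sigma> ` Z' \<subseteq> W" using \<sigma> by (auto simp: Z'_def)
  define S where "S E = {r\<in>Z'. \<sigma> r \<in> E}" for E
  have opS: "openin (top_of_set Z') (S E)" if E': "openin (top_of_set W) E" for E
  proof -
    obtain V where V: "open V" "E = W \<inter> V" using E' unfolding openin_open by blast
    have "S E = Z' \<inter> \<sigma> -` V" using V \<sigma>' by (auto simp: S_def)
    then show ?thesis using continuous_openin_preimage_gen[OF con' V(1)] by simp
  qed
  have part: "S E1 \<union> S E2 = Z'" "S E1 \<inter> S E2 = {}" using E \<sigma>' by (auto simp: S_def)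
  have clS: "closed (S E1)" "closed (S E2)"
  proof -
    have "S E1 = Z' - S E2" "S E2 = Z' - S E1" using part by auto
    moreover have "closedin (top_of_set Z') (Z' - S E)" if "openin (top_of_set W) E" for E
      by (rule closedin_diff[OF _ opS[OF that]]) simp
    ultimately have "closedin (top_of_set Z') (S E1)" "closedin (top_of_set Z') (S E2)"
      using E(1,2) by metis+
    then show "closed (S E1)" "closed (S E2)" using Z' closedin_closed_trans by blast+
  qed
  have ne: "S E \<noteq> {}" if E': "E = E1 \<or> E = E2" for E
  proof -
    obtain w where w: "w \<in> E" "w \<in> W" using E' E by blast
    obtain r T' where r: "r \<in> Z'" and T': "connected T'" "T' \<subseteq> W" "w \<in> T'" "\<sigma> r \<in> T'"
      using join[OF w(2)] unfolding Z'_def by blast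
    then have "\<sigma> r \<in> E" using T[OF T'(1,2)] E' E(4) w by blast
    then show ?thesis using r by (auto simp: S_def)
  qed
  have no: False if E': "E = E1 \<and> E' = E2 \<or> E = E2 \<and> E' = E1" and r: "a0 \<in> S E" "b0 \<in> S E'" "a0 < b0" for E E' a0 b0
  proof -
    have "closed (S E)" "closed (S E')" "S E \<inter> S E' = {}" using E' clS part by auto
    then obtain a b where ab: "a \<in> S E" "b \<in> S E'" "a0 \<le> a" "a < b" "b \<le> b0" "\<forall>r. a < r \<and> r < b \<longrightarrow> r \<notin> S E \<union> S E'"
      using consecutive_exists[OF _ _ r] by blast
    have "S E \<union> S E' = Z'" using E' part by auto
    then have "\<forall>r. a < r \<and> r < b \<longrightarrow> r \<notin> Z" using ab by (auto simp: Z'_def S_def)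
    then obtain T' where T': "connected T'" "T' \<subseteq> W" "\<sigma> a \<in> T'" "\<sigma> b \<in> T'"
      using gap[of a b] ab by (auto simp: S_def Z'_def)
    then show False using T[OF T'(1,2)] ab(1,2) E' E(4) by (auto simp: S_def)
  qed
  obtain x1 x2 where x: "x1 \<in> S E1" "x2 \<in> S E2" using ne[of E1] ne[of E2] by auto
  then have "x1 \<noteq> x2" using part by auto
  then consider "x1 < x2" | "x2 < x1" by linarith
  then show False
  proof cases
    case 1 then show False using no[of E1 E2 x1 x2] x by simp
  next
    case 2 then show False using no[of E2 E1 x2 x1] x by simp
  qed
qed

definition ray :: "complex \<Rightarrow> real \<Rightarrow> real \<Rightarrow> complex set" where
  "ray u a b = (\<lambda>x. of_real x * u) ` {a..b}"

lemma connected_ray: "connected (ray u a b)"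
  unfolding ray_def by (intro connected_continuous_image continuous_intros) simp

lemma norm_sgn_mult: "of_real (norm z) * sgn z = (z :: complex)"
  by (cases "z = 0") (simp_all add: sgn_eq)

lemma power_eq_norm_power_iff:
  fixes z :: complex
  assumes "norm z > 0"
  shows "z ^ k = of_real (norm z) ^ k \<longleftrightarrow> sgn z ^ k = 1"
proof -
  have "(of_real (norm z) * sgn z) ^ k = of_real (norm z) ^ k * sgn z ^ k" by (rule power_mult_distrib)
  then have "z ^ k = of_real (norm z) ^ k * sgn z ^ k" by (simp only: norm_sgn_mult)
  then show ?thesis using assms by simp
qed

lemma sgn_polar: "norm u = 1 \<Longrightarrow> x > 0 \<Longrightarrow> sgn (of_real x * u) = (u :: complex)"
  by (simp add: sgn_eq norm_mult)

lemma connected_punctured_circle: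
  fixes p :: complex
  assumes r: "r > 0"
  shows "connected ({z. norm z = r} - {p})"
proof (cases "norm p = r")
  case False
  then have "{z. norm z = r} - {p} = sphere 0 r" by auto
  then show ?thesis by (simp add: connected_sphere)
next
  case True
  then have p0: "p \<noteq> 0" using r by auto
  have "{z. norm z = r} - {p} = (\<lambda>\<theta>. p * cis \<theta>) ` {0<..<2 * pi}"
  proof (intro equalityI subsetI)
    fix z assume z: "z \<in> {z. norm z = r} - {p}"
    define \<theta> where "\<theta> = Arg2pi (z / p)"
    have "norm (z / p) = 1" using z True r by (simp add: norm_divide)
    then have "z / p = cis \<theta>" using Arg2pi_eq[of "z / p"] by (simp add: \<theta>_def cis_conv_exp)
    then have zp: "z = p * cis \<theta>" using p0 by (simp add: field_simps)
    then have "\<theta> \<noteq> 0" using z by auto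
    then have "\<theta> \<in> {0<..<2 * pi}" using Arg2pi[of "z / p"] by (simp add: \<theta>_def)
    then show "z \<in> (\<lambda>\<theta>. p * cis \<theta>) ` {0<..<2 * pi}" using zp by blast
  next
    fix z assume "z \<in> (\<lambda>\<theta>. p * cis \<theta>) ` {0<..<2 * pi}"
    then obtain \<theta> where \<theta>: "0 < \<theta>" "\<theta> < 2 * pi" "z = p * cis \<theta>" by auto
    have "cis \<theta> \<noteq> 1"
      using Arg2pi_unique[of 1 \<theta> "cis \<theta>"] Arg2pi_unique[of 1 0 1] \<theta> by (auto simp: cis_conv_exp)
    then show "z \<in> {z. norm z = r} - {p}" using \<theta>(3) True p0 by (simp add: norm_mult)
  qed
  moreover have "connected ((\<lambda>\<theta>. p * cis \<theta>) ` {0<..<2 * pi})"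
    by (intro connected_continuous_image continuous_intros) simp
  ultimately show ?thesis by simp
qed

text \<open>\<open>N q\<close> is the number of spokes at the rational level q. Two spokes per gap
  keep the wheel connected after removal of a point; by \<open>N_finite\<close> only finitely many
  gaps have few spokes, which yields local connectedness.\<close>

locale wheel =
  fixes N :: "real \<Rightarrow> nat"
  assumes N_ge_2: "q \<in> \<rat> \<Longrightarrow> 2 \<le> N q"
    and N_finite: "finite {q\<in>\<rat> \<inter> {0..1}. N q \<le> m}"
begin

definition base :: "complex set" where
  "base = {z. 0 \<le> stair (norm z) \<and> stair (norm z) \<le> 1 \<and> (norm z \<in> flat \<longrightarrow> sgn z ^ N (stair (norm z)) = 1)}"

lemma base_pos: "z \<in> base \<Longrightarrow> 0 < norm z"
  using stair_nonneg_imp_pos[of "norm z"] by (simp add: base_def)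

lemma circle_in_base: "norm z \<notin> flat \<Longrightarrow> 0 \<le> stair (norm z) \<Longrightarrow> stair (norm z) \<le> 1 \<Longrightarrow> z \<in> base"
  by (simp add: base_def)

lemma radius_range: "0 \<le> stair r \<and> stair r \<le> 1 \<longleftrightarrow> lo 0 \<le> r \<and> r \<le> hi 1"
proof -
  have "0 \<le> stair r \<longleftrightarrow> lo 0 \<le> r" using stair_mono[of "lo 0" r] stair_mono[of r "lo 0"]
      stair_level[of r 0] by (metis linear order_antisym stair_lo)
  moreover have "stair r \<le> 1 \<longleftrightarrow> r \<le> hi 1" using stair_mono[of "hi 1" r] stair_mono[of r "hi 1"]
      stair_level[of r 1] by (metis linear order_antisym stair_hi)
  ultimately show ?thesis by blast
qed

lemma lo0_pos: "0 < lo 0"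
  by (rule stair_nonneg_imp_pos) simp

lemma spoke_in_base:
  assumes "u ^ N (stair x) = 1" "norm u = 1" "0 \<le> stair x" "stair x \<le> 1"
  shows "of_real x * u \<in> base"
proof -
  have "x > 0" using assms stair_nonneg_imp_pos by blast
  then show ?thesis using assms by (simp add: base_def norm_mult sgn_polar)
qed

lemma spoke_ray_in_base:
  assumes "u ^ N q = 1" "norm u = 1" "0 \<le> q" "q \<le> 1" "lo q \<le> a" "b \<le> hi q"
  shows "ray u a b \<subseteq> base"
proof
  fix z assume "z \<in> ray u a b"
  then obtain x where x: "a \<le> x" "x \<le> b" "z = of_real x * u" by (auto simp: ray_def)
  then have "stair x = q" using assms stair_level[of x q] by auto
  then show "z \<in> base" using spoke_in_base[of u x] assms x by simp
qed

lemma norm_root: "q \<in> \<rat> \<Longrightarrow> (u :: complex) ^ N q = 1 \<Longrightarrow> norm u = 1"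
  using N_ge_2[of q] by (metis le_zero_eq norm_ge_zero norm_one norm_power numeral_neq_zero power_eq_1_iff not_gr_zero)

text \<open>The spoke condition is split gap by gap: a point outside the open gap of q is free
  there, and inside it the equation for \<open>sgn z\<close> is multiplied by
  \<open>norm z ^ N q\<close> to become polynomial. Each condition is closed.\<close>

lemma closed_base: "closed base"
proof -
  have cs: "continuous_on UNIV (\<lambda>z :: complex. stair (norm z))"
    by (rule continuous_on_compose2[OF continuous_stair]) (auto intro!: continuous_intros)
  have "base = {z. 0 \<le> stair (norm z) \<and> stair (norm z) \<le> 1} \<inter>
      (\<Inter>q\<in>\<rat>. {z. norm z \<le> lo q \<or> hi q \<le> norm z \<or> z ^ N q = of_real (norm z) ^ N q})"
  proof (intro equalityI subsetI)
    fix z assume z: "z \<in> base"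
    have "norm z \<le> lo q \<or> hi q \<le> norm z \<or> z ^ N q = of_real (norm z) ^ N q" if "q \<in> \<rat>" for q
    proof (cases "lo q < norm z \<and> norm z < hi q")
      case True
      then have "sgn z ^ N q = 1" using z flat_gap[of q "norm z"] by (auto simp: base_def)
      then have "z ^ N q = of_real (norm z) ^ N q"
        using power_eq_norm_power_iff[OF base_pos[OF z]] by blast
      then show ?thesis by blast
    qed auto
    then show "z \<in> {z. 0 \<le> stair (norm z) \<and> stair (norm z) \<le> 1} \<inter>
      (\<Inter>q\<in>\<rat>. {z. norm z \<le> lo q \<or> hi q \<le> norm z \<or> z ^ N q = of_real (norm z) ^ N q})"
      using z by (auto simp: base_def)
  next
    fix z :: complex assume z: "z \<in> {z. 0 \<le> stair (norm z) \<and> stair (norm z) \<le> 1} \<inter>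
      (\<Inter>q\<in>\<rat>. {z. norm z \<le> lo q \<or> hi q \<le> norm z \<or> z ^ N q = of_real (norm z) ^ N q})"
    then have pos: "norm z > 0" using stair_nonneg_imp_pos[of "norm z"] by simp
    have "sgn z ^ N (stair (norm z)) = 1" if f: "norm z \<in> flat"
    proof -
      have "stair (norm z) \<in> \<rat>" using flat_level_rational[OF f] .
      then have "z ^ N (stair (norm z)) = of_real (norm z) ^ N (stair (norm z))"
        using z f flat_iff by fastforce
      then show ?thesis using power_eq_norm_power_iff[OF pos] by blast
    qed
    then show "z \<in> base" using z by (auto simp: base_def)
  qed
  moreover have "closed {z :: complex. 0 \<le> stair (norm z) \<and> stair (norm z) \<le> 1}"
    by (intro closed_Collect_conj closed_Collect_le cs continuous_on_const)
  moreover have "closed {z :: complex. norm z \<le> lo q \<or> hi q \<le> norm z \<or> z ^ N q = of_real (norm z) ^ N q}" for q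
    by (intro closed_Collect_disj closed_Collect_le closed_Collect_eq continuous_intros)
  ultimately show ?thesis by (metis (no_types, lifting) closed_INT closed_Int)
qed

lemma compact_base: "compact base"
proof -
  have "norm z \<le> hi 1" if "z \<in> base" for z using that radius_range[of "norm z"] by (simp add: base_def)
  then have "bounded base" unfolding bounded_iff by blast
  then show ?thesis using closed_base by (simp add: compact_eq_bounded_closed)
qed

lemma other_root:
  assumes q: "q \<in> \<rat>" shows "\<exists>u :: complex. u ^ N q = 1 \<and> u \<noteq> v"
proof -
  have "N q > 0" using N_ge_2[OF q] by simp
  then have "card {z :: complex. z ^ N q = 1} = N q" by (rule card_roots_unity_eq)
  then have "\<not> {z :: complex. z ^ N q = 1} \<subseteq> {v}"
    using N_ge_2[OF q] card_mono[of "{v}" "{z :: complex. z ^ N q = 1}"] by auto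
  then show ?thesis by blast
qed

text \<open>The section runs in the direction v opposite to p and thus misses p. Circles stay
  connected after losing a point, and every gap is crossed by a spoke in a direction other than that
  of p.\<close>

lemma connected_punctured_base:
  assumes p: "p \<in> base"
  shows "connected (base - {p})"
proof -
  have pp: "norm p > 0" using base_pos[OF p] .
  define v where "v = - sgn p"
  have v: "norm v = 1" using pp by (auto simp: v_def norm_sgn)
  have vp: "of_real x * v \<noteq> p" if "x > 0" for x
  proof
    assume "of_real x * v = p"
    then have "sgn p = v" using sgn_polar[OF v that] by simp
    then have "sgn p = 0" by (simp add: v_def)
    then show False using pp by (simp add: sgn_zero_iff)
  qed
  define C where "C x = {z :: complex. norm z = x} - {p}" for x
  have C: "connected (C x)" "C x \<subseteq> base - {p}" "of_real x * v \<in> C x" if x: "x \<in> - flat" "lo 0 \<le> x" "x \<le> hi 1" for x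
  proof -
    have x0: "x > 0" using x lo0_pos by linarith
    then show "connected (C x)" unfolding C_def by (rule connected_punctured_circle)
    show "C x \<subseteq> base - {p}" using x radius_range[of x] by (auto simp: C_def intro: circle_in_base)
    show "of_real x * v \<in> C x" using x0 vp[OF x0] v by (simp add: C_def norm_mult)
  qed
  have q01: "0 \<le> q \<and> q \<le> 1" if "lo 0 \<le> lo q" "hi q \<le> hi 1" for q
    using stair_mono[OF that(1)] stair_mono[OF that(2)] by simp
  show ?thesis
  proof (rule connected_by_section[where Z = "- flat" and s = "lo 0" and t = "hi 1" and \<sigma> = "\<lambda>x. of_real x * v"])
    show "closed (- flat)" using open_flat by (rule closed_Compl)
    show "continuous_on {lo 0..hi 1} (\<lambda>x. of_real x * v)" by (intro continuous_intros)
    show "of_real r * v \<in> base - {p}" if "r \<in> - flat \<inter> {lo 0..hi 1}" for r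
      using that C(2,3)[of r] by auto
  next
    fix a b assume ab: "a \<in> - flat" "b \<in> - flat" "lo 0 \<le> a" "a < b" "b \<le> hi 1" "\<forall>r. a < r \<and> r < b \<longrightarrow> r \<notin> - flat"
    then obtain q where q: "q \<in> \<rat>" "a = lo q" "b = hi q" using consecutive_not_flat[of a b] by auto
    obtain u where u: "u ^ N q = 1" "u \<noteq> sgn p" using other_root[OF q(1)] by blast
    have nu: "norm u = 1" using norm_root[OF q(1) u(1)] .
    have a0: "a > 0" using ab lo0_pos by linarith
    have up: "of_real x * u \<noteq> p" if "x > 0" for x using sgn_polar[OF nu that] u(2) by auto
    have R: "ray u a b \<subseteq> base - {p}"
    proof -
      have "ray u a b \<subseteq> base" by (rule spoke_ray_in_base[OF u(1) nu]) (use q q01[of q] ab in auto)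
      moreover have "p \<notin> ray u a b"
      proof
        assume "p \<in> ray u a b"
        then obtain x where "a \<le> x" "p = of_real x * u" by (auto simp: ray_def)
        then show False using up[of x] a0 by simp
      qed
      ultimately show ?thesis by blast
    qed
    have au: "of_real a * u \<in> C a \<inter> ray u a b" "of_real b * u \<in> C b \<inter> ray u a b"
      using up[of a] up[of b] a0 ab nu by (auto simp: C_def ray_def norm_mult)
    have "connected ((C a \<union> ray u a b) \<union> C b)"
      using C(1)[of a] C(1)[of b] connected_ray[of u a b] ab au by (intro connected_Un) auto
    moreover have "(C a \<union> ray u a b) \<union> C b \<subseteq> base - {p}" using C(2)[of a] C(2)[of b] R ab by auto
    moreover have "of_real a * v \<in> C a" "of_real b * v \<in> C b" using C(3) ab by auto
    ultimately show "\<exists>T. connected T \<and> T \<subseteq> base - {p} \<and> of_real a * v \<in> T \<and> of_real b * v \<in> T"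
      by (intro exI[of _ "(C a \<union> ray u a b) \<union> C b"]) auto
  next
    fix w assume w: "w \<in> base - {p}"
    define x where "x = norm w"
    have xr: "lo 0 \<le> x" "x \<le> hi 1" using w radius_range[of x] by (auto simp: base_def x_def)
    show "\<exists>r\<in>- flat \<inter> {lo 0..hi 1}. \<exists>T. connected T \<and> T \<subseteq> base - {p} \<and> w \<in> T \<and> of_real r * v \<in> T"
    proof (cases "x \<in> flat")
      case False
      have "w \<in> C x" using w by (simp add: C_def x_def)
      then show ?thesis using False xr C[of x] by (intro bexI[of _ x] exI[of _ "C x"]) auto
    next
      case True
      define q where "q = stair x"
      have q: "q \<in> \<rat>" "lo q < x" "x < hi q" using True flat_level_rational flat_iff by (auto simp: q_def)
      have q01': "0 \<le> q" "q \<le> 1" using radius_range[of x] xr by (auto simp: q_def)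
      then have ends: "lo 0 \<le> lo q" "lo q \<le> hi 1" "lo 0 \<le> hi q" "hi q \<le> hi 1"
        using radius_range[of "lo q"] radius_range[of "hi q"] by auto
      define u where "u = sgn w"
      have u: "u ^ N q = 1" using w True by (simp add: base_def u_def q_def x_def)
      have nu: "norm u = 1" using norm_root[OF q(1) u] .
      have wu: "w = of_real x * u" by (simp add: u_def x_def norm_sgn_mult)
      \<comment> \<open>p cannot block both ways along the spoke, since it would then coincide with
        w.\<close>
      have "p \<notin> ray u (lo q) x \<or> p \<notin> ray u x (hi q)"
      proof (rule ccontr)
        assume "\<not> ?thesis"
        then have pr: "p \<in> ray u (lo q) x" "p \<in> ray u x (hi q)" by blast+
        obtain x1 where x1: "lo q \<le> x1" "x1 \<le> x" "p = of_real x1 * u" using pr(1) by (auto simp: ray_def)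
        obtain x2 where x2: "x \<le> x2" "p = of_real x2 * u" using pr(2) by (auto simp: ray_def)
        note x12 = x1(1,2) x2(1) x1(3) x2(2)
        have "x1 > 0" using x12(1) ends lo0_pos by linarith
        then have "norm p = x1" unfolding x1(3) using nu by (simp add: norm_mult)
        moreover have "norm p = x2" unfolding x2(2) using \<open>x1 > 0\<close> x12(2,3) nu by (simp add: norm_mult)
        ultimately have "x1 = x" using x12 by simp
        then show False using w wu x12 by auto
      qed
      then obtain a b r where abr: "p \<notin> ray u a b" "a \<le> x" "x \<le> b" "a \<le> r" "r \<le> b" "lo q \<le> a" "b \<le> hi q" "r \<in> - flat" "lo 0 \<le> r" "r \<le> hi 1"
        using q lo_hi_not_flat[of q] ends by (metis ComplI less_imp_le order_refl)
      have R: "ray u a b \<subseteq> base - {p}"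
        using spoke_ray_in_base[OF u nu q01' abr(6,7)] abr(1) by blast
      have ru: "of_real r * u \<in> ray u a b" "w \<in> ray u a b" using abr wu by (auto simp: ray_def)
      have "of_real r * u \<in> C r"
        using ru(1) R abr lo0_pos nu by (auto simp: C_def norm_mult)
      then have "connected (ray u a b \<union> C r)"
        using C(1)[of r] abr ru connected_ray[of u a b] by (intro connected_Un) auto
      then show ?thesis using abr R C(2,3)[of r] ru
        by (intro bexI[of _ r] exI[of _ "ray u a b \<union> C r"]) auto
    qed
  qed
qed

lemma three_points: "\<exists>z\<in>base. z \<noteq> p \<and> z \<noteq> p'"
proof -
  define a where "a = complex_of_real (lo 0)"
  have n: "norm (a * v) = lo 0" if "norm v = 1" for v using that lo0_pos by (simp add: a_def norm_mult)
  have b: "a * v \<in> base" if "norm v = 1" for v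
    by (rule circle_in_base) (simp_all add: n[OF that] lo_hi_not_flat)
  have a0: "a \<noteq> 0" using lo0_pos by (simp add: a_def)
  have "a * 1 \<noteq> a * (-1)" "a * 1 \<noteq> a * \<i>" "a * (-1) \<noteq> a * \<i>"
    unfolding mult_cancel_left using a0 by (simp_all add: complex_eq_iff)
  moreover have "a * 1 \<in> base" "a * (-1) \<in> base" "a * \<i> \<in> base" by (rule b; simp)+
  ultimately show ?thesis by metis
qed

lemma base_minus_nonempty: "base - {p} \<noteq> {}"
  using three_points[of p p] by blast

lemma connected_base: "connected base"
proof -
  obtain p where p: "p \<in> base" using three_points by blast
  obtain p' where p': "p' \<in> base" "p' \<noteq> p" using three_points by blast
  obtain z where z: "z \<in> base" "z \<noteq> p" "z \<noteq> p'" using three_points by blast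
  have "connected ((base - {p}) \<union> (base - {p'}))"
    using z by (intro connected_Un connected_punctured_base p p') auto
  moreover have "(base - {p}) \<union> (base - {p'}) = base" using p' by auto
  ultimately show ?thesis by simp
qed

end

section \<open>Local connectedness of the wheel\<close>

context wheel begin

lemma spoke_near:
  assumes q: "q \<in> \<rat>" and v: "norm v = 1" and e: "2 * pi / real (N q) \<le> \<eta>"
  shows "\<exists>t. \<bar>t\<bar> \<le> \<eta> \<and> (v * cis t) ^ N q = 1"
proof -
  define n where "n = N q"
  have n: "n > 0" using N_ge_2[OF q] by (simp add: n_def)
  define \<theta> where "\<theta> = Arg v"
  have "v \<noteq> 0" using v by auto
  then have vc: "v = cis \<theta>" using v by (simp add: \<theta>_def cis_Arg sgn_eq)
  define k where "k = \<lfloor>\<theta> * n / (2 * pi)\<rfloor>"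
  define t where "t = 2 * pi * k / n - \<theta>"
  have "of_int k \<le> \<theta> * n / (2 * pi)" "\<theta> * n / (2 * pi) < of_int k + 1"
    unfolding k_def by linarith+
  then have "k * (2 * pi) \<le> \<theta> * n" "\<theta> * n < (k + 1) * (2 * pi)"
    by (simp_all add: field_simps)
  then have "2 * pi * k / n \<le> \<theta>" "\<theta> \<le> (2 * pi * k + 2 * pi) / n"
    using n by (simp_all add: pos_divide_le_eq pos_le_divide_eq algebra_simps)
  then have "t \<le> 0" "- t \<le> 2 * pi / n" unfolding t_def add_divide_distrib by linarith+
  then have "\<bar>t\<bar> \<le> \<eta>" using e by (simp add: n_def)
  moreover have "(v * cis t) ^ n = 1"
  proof -
    have "v * cis t = cis (2 * pi * k / n)" by (simp add: vc cis_mult t_def)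
    then have "(v * cis t) ^ n = cis (real n * (2 * pi * k / n))" by (simp only: Complex.DeMoivre)
    also have "real n * (2 * pi * k / n) = 2 * pi * of_int k" using n by simp
    finally show ?thesis by simp
  qed
  ultimately show ?thesis unfolding n_def by blast
qed

lemma root_separation:
  assumes z: "z \<noteq> 0" and k: "k > 0"
  shows "\<exists>\<delta>>0. \<forall>y. dist z y < \<delta> \<longrightarrow> sgn y ^ k = (1 :: complex) \<longrightarrow> sgn z ^ k = 1 \<longrightarrow> sgn y = sgn z"
proof -
  have fin: "finite {u :: complex. u ^ k = 1}" using card_roots_unity_eq[OF k] k card.infinite by fastforce
  obtain d where d: "d > 0" "\<And>u. u ^ k = 1 \<Longrightarrow> u \<noteq> sgn z \<Longrightarrow> d \<le> dist (sgn z) u"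
    using finite_set_avoid[OF fin, of "sgn z"] by auto
  have "isCont sgn z" using z by (intro continuous_intros) auto
  then obtain \<delta> where "\<delta> > 0" "\<And>y. dist y z < \<delta> \<Longrightarrow> dist (sgn y) (sgn z) < d"
    using d(1) unfolding continuous_at_eps_delta by blast
  then show ?thesis using d(2) by (intro exI[of _ \<delta>]) (force simp: dist_commute)
qed

lemma arg_quotient:
  assumes z: "(z :: complex) \<noteq> 0" and e: "\<eta> > 0"
  shows "\<exists>\<delta>>0. \<forall>y. dist z y < \<delta> \<longrightarrow> y \<noteq> 0 \<and> (\<exists>t. \<bar>t\<bar> \<le> \<eta> \<and> sgn y = sgn z * cis t)"
proof -
  have "isCont (\<lambda>y. Arg (y / z)) z"
  proof (rule continuous_at_compose[of z "\<lambda>y. y / z" Arg, unfolded comp_def])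
    show "isCont (\<lambda>y. y / z) z" using z by (intro continuous_intros)
    show "isCont Arg (z / z)" using z by (intro continuous_at_Arg) (simp add: complex_nonpos_Reals_iff)
  qed
  then obtain d where d: "d > 0" "\<And>y. dist y z < d \<Longrightarrow> dist (Arg (y / z)) (Arg (z / z)) < \<eta>"
    using e unfolding continuous_at_eps_delta by blast
  have "y \<noteq> 0 \<and> (\<exists>t. \<bar>t\<bar> \<le> \<eta> \<and> sgn y = sgn z * cis t)" if y: "dist z y < min d (norm z)" for y
  proof
    show y0: "y \<noteq> 0" using y by auto
    have "\<bar>Arg (y / z)\<bar> < \<eta>" using d(2)[of y] y z by (simp add: dist_commute dist_real_def)
    moreover have "sgn z * sgn (y / z) = sgn (z * (y / z))" by (simp only: sgn_mult)
    then have "sgn z * cis (Arg (y / z)) = sgn y"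
      using y0 z by (simp add: cis_Arg del: sgn_mult sgn_divide)
    ultimately show "\<exists>t. \<bar>t\<bar> \<le> \<eta> \<and> sgn y = sgn z * cis t"
      by (intro exI[of _ "Arg (y / z)"]) auto
  qed
  then show ?thesis using d(1) z by (intro exI[of _ "min d (norm z)"]) auto
qed

definition sector :: "complex \<Rightarrow> real \<Rightarrow> real \<Rightarrow> real \<Rightarrow> complex set" where
  "sector v \<eta> s t = {w\<in>base. norm w \<in> {s..t} \<and> (\<exists>\<theta>. \<bar>\<theta>\<bar> \<le> \<eta> \<and> sgn w = v * cis \<theta>)}"

text \<open>Here the section runs along the central direction v. In every gap between s and t the
  spokes are so close, by \<open>fine\<close>, that one of them lies in the sector and joins its
  arcs on the two sides of the gap.\<close>

lemma connected_sector:
  assumes v: "norm v = 1" and \<eta>: "\<eta> \<ge> 0" and st: "s \<notin> flat" "t \<notin> flat" "s \<le> t" "lo 0 \<le> s" "t \<le> hi 1"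
    and fine: "\<And>q. q \<in> \<rat> \<Longrightarrow> s \<le> lo q \<Longrightarrow> hi q \<le> t \<Longrightarrow> 2 * pi / real (N q) \<le> \<eta>"
  shows "connected (sector v \<eta> s t)"
proof -
  define arc where "arc x = (\<lambda>\<theta>. of_real x * (v * cis \<theta>)) ` {-\<eta>..\<eta>}" for x
  have pos: "x > 0" if "s \<le> x" for x using that st lo0_pos by linarith
  have con_arc: "connected (arc x)" for x
    unfolding arc_def by (intro connected_continuous_image continuous_intros) simp
  have arc: "arc x \<subseteq> sector v \<eta> s t" if x: "x \<in> - flat" "s \<le> x" "x \<le> t" for x
  proof
    fix w assume "w \<in> arc x"
    then obtain \<theta> where \<theta>0: "w = of_real x * (v * cis \<theta>)" "\<theta> \<in> {-\<eta>..\<eta>}" unfolding arc_def by (rule imageE)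
    then have \<theta>: "\<bar>\<theta>\<bar> \<le> \<eta>" "w = of_real x * (v * cis \<theta>)" by auto
    have nw: "norm w = x" using \<theta>(2) v pos[OF x(2)] by (simp add: norm_mult)
    have "sgn w = v * cis \<theta>" unfolding \<theta>(2) using pos[OF x(2)] v by (intro sgn_polar) (simp_all add: norm_mult)
    moreover have "w \<in> base" using x st radius_range[of x] by (intro circle_in_base) (auto simp: nw)
    ultimately show "w \<in> sector v \<eta> s t" using \<theta>(1) x nw by (auto simp: sector_def)
  qed
  have arcI: "of_real x * (v * cis \<theta>) \<in> arc x" if "\<bar>\<theta>\<bar> \<le> \<eta>" for x \<theta>
    unfolding arc_def using that by (intro imageI) auto
  have mid: "of_real x * v \<in> arc x" for x unfolding arc_def using \<eta> by (intro image_eqI[of _ _ 0]) auto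
  have q01: "0 \<le> q \<and> q \<le> 1" if "s \<le> lo q" "hi q \<le> t" for q
    using stair_mono[of "lo 0" "lo q"] stair_mono[of "hi q" "hi 1"] that st by simp
  have rays: "ray u a b \<subseteq> sector v \<eta> s t"
    if u: "u ^ N q = 1" "norm u = 1" "\<exists>\<theta>. \<bar>\<theta>\<bar> \<le> \<eta> \<and> u = v * cis \<theta>" and q: "s \<le> lo q" "hi q \<le> t" "lo q \<le> a" "b \<le> hi q" for u q a b
  proof
    fix w assume w: "w \<in> ray u a b"
    then obtain x where x: "a \<le> x" "x \<le> b" "w = of_real x * u" by (auto simp: ray_def)
    have x0: "x > 0" using pos[of x] x q by linarith
    have "w \<in> base" using spoke_ray_in_base[OF u(1,2), of a b] q01[OF q(1,2)] q w by blast
    moreover have "norm w = x" "sgn w = u" unfolding x(3) using x0 u(2) by (simp_all add: norm_mult sgn_polar)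
    ultimately show "w \<in> sector v \<eta> s t" using u(3) x q by (auto simp: sector_def)
  qed
  show ?thesis
  proof (rule connected_by_section[where Z = "- flat" and s = s and t = t and \<sigma> = "\<lambda>x. of_real x * v"])
    show "closed (- flat)" using open_flat by (rule closed_Compl)
    show "continuous_on {s..t} (\<lambda>x. of_real x * v)" by (intro continuous_intros)
    show "of_real r * v \<in> sector v \<eta> s t" if "r \<in> - flat \<inter> {s..t}" for r
      using that arc[of r] mid[of r] by auto
  next
    fix a b assume ab: "a \<in> - flat" "b \<in> - flat" "s \<le> a" "a < b" "b \<le> t" "\<forall>r. a < r \<and> r < b \<longrightarrow> r \<notin> - flat"
    then obtain q where q: "q \<in> \<rat>" "a = lo q" "b = hi q" using consecutive_not_flat[of a b] by auto
    have fq: "2 * pi / real (N q) \<le> \<eta>" using fine[OF q(1)] q ab by simp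
    obtain \<theta> where \<theta>: "\<bar>\<theta>\<bar> \<le> \<eta>" "(v * cis \<theta>) ^ N q = 1" using spoke_near[OF q(1) v fq] by blast
    define u where "u = v * cis \<theta>"
    have nu: "norm u = 1" using v by (simp add: u_def norm_mult)
    have R: "ray u a b \<subseteq> sector v \<eta> s t"
      by (rule rays[of u q]) (use \<theta> nu q ab in \<open>auto simp: u_def\<close>)
    have au: "of_real a * u \<in> arc a \<inter> ray u a b" "of_real b * u \<in> arc b \<inter> ray u a b"
      using arcI[OF \<theta>(1)] ab by (auto simp: u_def ray_def)
    have "connected ((arc a \<union> ray u a b) \<union> arc b)"
      using con_arc connected_ray[of u a b] au by (intro connected_Un) auto
    moreover have "(arc a \<union> ray u a b) \<union> arc b \<subseteq> sector v \<eta> s t" using arc[of a] arc[of b] R ab by auto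
    ultimately show "\<exists>T. connected T \<and> T \<subseteq> sector v \<eta> s t \<and> of_real a * v \<in> T \<and> of_real b * v \<in> T"
      using mid by (intro exI[of _ "(arc a \<union> ray u a b) \<union> arc b"]) auto
  next
    fix w assume w: "w \<in> sector v \<eta> s t"
    define x where "x = norm w"
    have x: "s \<le> x" "x \<le> t" using w by (auto simp: sector_def x_def)
    obtain \<theta> where \<theta>: "\<bar>\<theta>\<bar> \<le> \<eta>" "sgn w = v * cis \<theta>" using w by (auto simp: sector_def)
    have wx: "w = of_real x * sgn w" by (simp add: x_def norm_sgn_mult)
    have on_arc: "of_real y * sgn w \<in> arc y" for y using arcI[OF \<theta>(1)] \<theta>(2) by simp
    show "\<exists>r\<in>- flat \<inter> {s..t}. \<exists>T. connected T \<and> T \<subseteq> sector v \<eta> s t \<and> w \<in> T \<and> of_real r * v \<in> T"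
    proof (cases "x \<in> flat")
      case False
      then show ?thesis using x con_arc arc[of x] mid[of x] on_arc[of x] wx
        by (intro bexI[of _ x] exI[of _ "arc x"]) auto
    next
      case True
      define q where "q = stair x"
      have q: "q \<in> \<rat>" "lo q < x" "x < hi q" using True flat_level_rational flat_iff by (auto simp: q_def)
      have ends: "s \<le> lo q" "hi q \<le> t"
        using flat_gap[of q s] flat_gap[of q t] st(1,2) q x by (meson less_le_trans le_less_trans not_le)+
      have u: "sgn w ^ N q = 1" using w True by (simp add: sector_def base_def q_def x_def)
      have R: "ray (sgn w) (lo q) x \<subseteq> sector v \<eta> s t"
        by (rule rays[of "sgn w" q]) (use u norm_root[OF q(1) u] \<theta> ends q in auto)
      have "of_real (lo q) * sgn w \<in> ray (sgn w) (lo q) x" "w \<in> ray (sgn w) (lo q) x"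
        using q wx by (auto simp: ray_def)
      then have "connected (ray (sgn w) (lo q) x \<union> arc (lo q))"
        using connected_ray[of "sgn w"] con_arc[of "lo q"] on_arc[of "lo q"] by (intro connected_Un) auto
      moreover have "lo q \<in> - flat \<inter> {s..t}" using ends q lo_hi_not_flat lo_le_hi[of q] by auto
      ultimately show ?thesis using R arc[of "lo q"] mid[of "lo q"] \<open>w \<in> ray (sgn w) (lo q) x\<close>
        by (intro bexI[of _ "lo q"] exI[of _ "ray (sgn w) (lo q) x \<union> arc (lo q)"]) auto
    qed
  qed
qed

lemma ray_ball:
  assumes "norm u = 1" "\<bar>a - x\<bar> < \<epsilon>" "\<bar>b - x\<bar> < \<epsilon>"
  shows "ray u a b \<subseteq> ball (of_real x * u) \<epsilon>"
proof
  fix w assume "w \<in> ray u a b"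
  then obtain y where y: "a \<le> y" "y \<le> b" "w = of_real y * u" by (auto simp: ray_def)
  have "dist (of_real x * u) w = norm (of_real (x - y) * u)"
    unfolding y(3) dist_norm by (simp add: algebra_simps)
  also have "\<dots> = \<bar>x - y\<bar>" using assms(1) by (simp only: norm_mult norm_of_real mult_1_right)
  finally show "w \<in> ball (of_real x * u) \<epsilon>" using assms(2,3) y by auto
qed

text \<open>At a radius inside a gap, z has only its own spoke nearby. Otherwise y is moved along
  its spoke to the edge of its gap facing r, and from there to z through a thin sector. The sector
  is connected because the gaps with few spokes that lie on its side are not entirely contained in a
  small neighbourhood of r.\<close>

lemma im_kleinen_base: "im_kleinen base"
  unfolding im_kleinen_def
proof (intro ballI allI impI)
  fix z \<epsilon> assume z: "z \<in> base" and \<epsilon>: "(\<epsilon>::real) > 0"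
  define r where "r = norm z"
  define v where "v = sgn z"
  have r0: "r > 0" using base_pos[OF z] by (simp add: r_def)
  then have z0: "z \<noteq> 0" by (auto simp: r_def)
  have v: "norm v = 1" using z0 by (simp add: v_def norm_sgn)
  have zv: "z = of_real r * v" by (simp add: r_def v_def norm_sgn_mult)
  have rr: "0 \<le> stair r" "stair r \<le> 1" "lo 0 \<le> r" "r \<le> hi 1"
    using z radius_range[of r] by (auto simp: base_def r_def)
  show "\<exists>\<delta>>0. \<forall>y\<in>base. dist z y < \<delta> \<longrightarrow> (\<exists>c. connected c \<and> c \<subseteq> base \<inter> ball z \<epsilon> \<and> z \<in> c \<and> y \<in> c)"
  proof (cases "r \<in> flat")
    case True
    define q where "q = stair r"
    have q: "q \<in> \<rat>" "lo q < r" "r < hi q" using True flat_level_rational flat_iff by (auto simp: q_def)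
    have zq: "sgn z ^ N q = 1" using z True by (simp add: base_def q_def r_def)
    obtain d where d: "d > 0" "\<And>y. dist z y < d \<Longrightarrow> sgn y ^ N q = 1 \<Longrightarrow> sgn y = sgn z"
      using root_separation[OF z0, of "N q"] N_ge_2[OF q(1)] zq by auto
    define \<delta> where "\<delta> = Min {d, \<epsilon>, r - lo q, hi q - r}"
    have \<delta>: "\<delta> > 0" "\<delta> \<le> d" "\<delta> \<le> \<epsilon>" "\<delta> \<le> r - lo q" "\<delta> \<le> hi q - r" using d \<epsilon> q by (auto simp: \<delta>_def)
    have "\<exists>c. connected c \<and> c \<subseteq> base \<inter> ball z \<epsilon> \<and> z \<in> c \<and> y \<in> c" if y: "y \<in> base" "dist z y < \<delta>" for y
    proof -
      define x where "x = norm y"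
      have xr: "\<bar>x - r\<bar> < \<delta>" using norm_triangle_ineq3[of y z] y(2) by (simp add: x_def r_def dist_norm norm_minus_commute)
      then have xq: "lo q < x" "x < hi q" using \<delta> by linarith+
      then have xf: "x \<in> flat" "stair x = q" using flat_gap by auto
      then have "sgn y ^ N q = 1" using y(1) by (simp add: base_def x_def)
      then have "sgn y = v" using d(2)[of y] y(2) \<delta> by (simp add: v_def)
      then have yv: "y = of_real x * v" using norm_sgn_mult[of y] by (simp add: x_def)
      have "ray v (min r x) (max r x) \<subseteq> base"
        by (rule spoke_ray_in_base[where q = q]) (use zq v rr xq q in \<open>auto simp: v_def q_def\<close>)
      moreover have "ray v (min r x) (max r x) \<subseteq> ball z \<epsilon>"
        unfolding zv by (rule ray_ball[OF v]) (use xr \<delta> \<epsilon> in auto)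
      moreover have "z \<in> ray v (min r x) (max r x)" "y \<in> ray v (min r x) (max r x)"
        unfolding ray_def by (subst zv, rule imageI, simp) (subst yv, rule imageI, simp)
      ultimately show ?thesis using connected_ray by blast
    qed
    then show ?thesis using \<delta>(1) by blast
  next
    case False
    have "continuous_on UNIV cis" by (rule continuous_on_cis) (rule continuous_on_id)
    then have "isCont cis 0" by (simp add: continuous_on_eq_continuous_at)
    moreover have "\<epsilon> / (2 * (r + 1)) > 0" using \<epsilon> r0 by simp
    ultimately obtain \<eta>' where \<eta>': "\<eta>' > 0" "\<And>t. dist t 0 < \<eta>' \<Longrightarrow> dist (cis t) (cis 0) < \<epsilon> / (2 * (r + 1))"
      unfolding continuous_at_eps_delta by blast
    define \<eta> where "\<eta> = \<eta>' / 2"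
    have \<eta>: "\<eta> > 0" "\<And>t. \<bar>t\<bar> \<le> \<eta> \<Longrightarrow> norm (cis t - 1) < \<epsilon> / (2 * (r + 1))"
      using \<eta>' by (auto simp: \<eta>_def dist_norm)
    have inball: "w \<in> ball z \<epsilon>" if w: "\<bar>norm w - r\<bar> < \<epsilon> / 2" "\<bar>t\<bar> \<le> \<eta>" "sgn w = v * cis t" for w t
    proof -
      have ww: "w = of_real (norm w) * (v * cis t)" using norm_sgn_mult[of w] w(3) by simp
      have "norm (w - of_real r * (v * cis t)) = norm (of_real (norm w - r) * (v * cis t))"
        by (subst ww) (simp add: algebra_simps)
      also have "\<dots> = \<bar>norm w - r\<bar>" using v by (simp only: norm_mult norm_of_real norm_cis mult_1_right)
      finally have 1: "norm (w - of_real r * (v * cis t)) < \<epsilon> / 2" using w(1) by simp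
      have "norm (of_real r * (v * cis t) - z) = norm (of_real r * (v * (cis t - 1)))"
        unfolding zv by (simp add: algebra_simps)
      also have "\<dots> = r * norm (cis t - 1)" using v r0 by (simp add: norm_mult)
      also have "\<dots> \<le> r * (\<epsilon> / (2 * (r + 1)))" using \<eta>(2)[OF w(2)] r0 by (intro mult_left_mono) auto
      also have "\<dots> < \<epsilon> / 2" using r0 \<epsilon> by (simp add: field_simps)
      finally have 2: "norm (of_real r * (v * cis t) - z) < \<epsilon> / 2" .
      have "norm (w - z) < \<epsilon>" using norm_triangle_ineq[of "w - of_real r * (v * cis t)" "of_real r * (v * cis t) - z"] 1 2 by simp
      then show ?thesis by (simp add: dist_norm norm_minus_commute)
    qed
    \<comment> \<open>With more than m spokes, neighbouring spokes are at most \<eta> apart. S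
      consists of the edges of the remaining, finitely many gaps.\<close>
    obtain m :: nat where m: "2 * pi / \<eta> \<le> m" using real_arch_simple by blast
    define S where "S = lo ` {q\<in>\<rat> \<inter> {0..1}. N q \<le> m} \<union> hi ` {q\<in>\<rat> \<inter> {0..1}. N q \<le> m}"
    have "finite S" unfolding S_def using N_finite by auto
    from finite_set_avoid[OF this, of r]
    obtain d where d: "d > 0" "\<And>x. x \<in> S \<Longrightarrow> x \<noteq> r \<Longrightarrow> d \<le> dist r x" by auto
    obtain d' where d': "d' > 0" "\<And>y. dist z y < d' \<Longrightarrow> \<exists>t. \<bar>t\<bar> \<le> \<eta> \<and> sgn y = v * cis t"
      using arg_quotient[OF z0 \<eta>(1)] unfolding v_def by blast
    define \<delta> where "\<delta> = Min {d, d', \<epsilon> / 2}"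
    have \<delta>: "\<delta> > 0" "\<delta> \<le> d" "\<delta> \<le> d'" "\<delta> \<le> \<epsilon> / 2" using d d' \<epsilon> by (auto simp: \<delta>_def)
    have "\<exists>c. connected c \<and> c \<subseteq> base \<inter> ball z \<epsilon> \<and> z \<in> c \<and> y \<in> c" if y: "y \<in> base" "dist z y < \<delta>" for y
    proof -
      define x where "x = norm y"
      have xr: "\<bar>x - r\<bar> < \<delta>" using norm_triangle_ineq3[of y z] y(2) by (simp add: x_def r_def dist_norm norm_minus_commute)
      have xx: "0 \<le> stair x" "stair x \<le> 1" using y(1) by (auto simp: base_def x_def)
      obtain t0 where t0: "\<bar>t0\<bar> \<le> \<eta>" "sgn y = v * cis t0" using d'(2)[of y] y(2) \<delta> by auto
      have nsy: "norm (sgn y) = 1" using t0 v by (simp add: norm_mult)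
      have yy: "y = of_real x * sgn y" by (simp add: x_def norm_sgn_mult)
      \<comment> \<open>The witness is x itself, or the end of its gap on the side of r; since r
        lies in no gap, this end is between r and x.\<close>
      have "\<exists>x'. x' \<notin> flat \<and> stair x' = stair x \<and> min r x \<le> x' \<and> x' \<le> max r x \<and> ray (sgn y) (min x x') (max x x') \<subseteq> base"
      proof (cases "x \<in> flat")
        case False
        have "ray (sgn y) x x \<subseteq> base" using y(1) yy by (auto simp: ray_def)
        then show ?thesis using False by (intro exI[of _ x]) auto
      next
        case True
        define q where "q = stair x"
        have q: "q \<in> \<rat>" "lo q < x" "x < hi q" using True flat_level_rational flat_iff by (auto simp: q_def)
        have yq: "sgn y ^ N q = 1" using y(1) True by (simp add: base_def q_def x_def)
        have R: "ray (sgn y) a b \<subseteq> base" if "lo q \<le> a" "b \<le> hi q" for a b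
          by (rule spoke_ray_in_base[OF yq nsy]) (use that xx in \<open>auto simp: q_def\<close>)
        have "r \<le> lo q \<or> hi q \<le> r" using flat_gap[of q r] \<open>r \<notin> flat\<close> by linarith
        then show ?thesis
        proof
          assume "r \<le> lo q"
          then show ?thesis using q R[of "min x (lo q)" "max x (lo q)"] lo_hi_not_flat
            by (intro exI[of _ "lo q"]) (auto simp: q_def[symmetric])
        next
          assume "hi q \<le> r"
          then show ?thesis using q R[of "min x (hi q)" "max x (hi q)"] lo_hi_not_flat
            by (intro exI[of _ "hi q"]) (auto simp: q_def[symmetric])
        qed
      qed
      then obtain x' where x': "x' \<notin> flat" "stair x' = stair x" "min r x \<le> x'" "x' \<le> max r x"
          "ray (sgn y) (min x x') (max x x') \<subseteq> base" by blast
      have x'r: "\<bar>x' - r\<bar> < \<delta>" using x'(3,4) xr by linarith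
      have x'x: "0 \<le> stair x'" "stair x' \<le> 1" "lo 0 \<le> x'" "x' \<le> hi 1"
        using x'(2) xx radius_range[of x'] by auto
      define W where "W = sector v \<eta> (min r x') (max r x')"
      have "connected W" unfolding W_def
      proof (rule connected_sector[OF v])
        fix q assume q: "q \<in> \<rat>" "min r x' \<le> lo q" "hi q \<le> max r x'"
        have lh: "lo q < hi q" by (rule lo_less_hi[OF q(1)])
        have "\<bar>lo q - r\<bar> < d" "\<bar>hi q - r\<bar> < d" using q(2,3) lh x'r \<delta>(2) by linarith+
        \<comment> \<open>Within distance d of r the only possible element of S is r itself, and the
          two ends of a rational gap are different.\<close>
        then have "\<not> (lo q \<in> S \<and> hi q \<in> S)" using d(2)[of "lo q"] d(2)[of "hi q"] lh by (fastforce simp: dist_real_def)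
        moreover have "0 \<le> q" "q \<le> 1"
          using stair_mono[OF q(2)] stair_mono[OF q(3)] rr(1,2) x'x(1,2) by (auto simp: min_def max_def split: if_splits)
        ultimately have "N q > m" using q(1) by (auto simp: S_def)
        then have "2 * pi / \<eta> \<le> N q" using m by linarith
        then show "2 * pi / real (N q) \<le> \<eta>" using \<eta>(1) \<open>N q > m\<close> by (simp add: field_simps)
      qed (use \<eta>(1) False x' rr x'x in \<open>auto simp: min_def max_def\<close>)
      have Wball: "W \<subseteq> base \<inter> ball z \<epsilon>"
      proof
        fix w assume "w \<in> W"
        then obtain t where w: "w \<in> base" "min r x' \<le> norm w" "norm w \<le> max r x'" "\<bar>t\<bar> \<le> \<eta>" "sgn w = v * cis t"
          by (auto simp: W_def sector_def)
        have "\<bar>norm w - r\<bar> < \<epsilon> / 2" using w(2,3) x'r \<delta>(4) by linarith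
        then show "w \<in> base \<inter> ball z \<epsilon>" using w inball by blast
      qed
      have "z \<in> W" using z \<eta>(1) by (auto simp: W_def sector_def r_def[symmetric] v_def intro!: exI[of _ 0])
      let ?R = "ray (sgn y) (min x x') (max x x')"
      have Rball: "?R \<subseteq> ball z \<epsilon>"
      proof
        fix w assume "w \<in> ?R"
        then obtain s where s: "min x x' \<le> s" "s \<le> max x x'" "w = of_real s * sgn y" by (auto simp: ray_def)
        have "w \<in> base" using \<open>w \<in> ?R\<close> x'(5) by blast
        have "lo 0 \<le> s" using s(1) x'x(3) radius_range[of x] xx by linarith
        then have "s > 0" using lo0_pos by linarith
        then have "norm w = s" "sgn w = v * cis t0" unfolding s(3) using nsy t0(2) by (simp_all add: norm_mult sgn_polar)
        moreover have "\<bar>s - r\<bar> < \<epsilon> / 2" using s(1,2) x'r xr \<delta>(4) by linarith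
        ultimately show "w \<in> ball z \<epsilon>" using inball t0(1) by metis
      qed
      have "of_real x' * sgn y \<in> ?R" by (auto simp: ray_def)
      moreover have "of_real x' * sgn y \<in> W"
      proof -
        have "x' > 0" using x'x(3) lo0_pos by linarith
        then have "norm (of_real x' * sgn y) = x'" "sgn (of_real x' * sgn y) = v * cis t0"
          using nsy t0(2) by (simp_all add: norm_mult sgn_polar)
        then show ?thesis using calculation x'(5) t0(1) by (auto simp: W_def sector_def)
      qed
      ultimately have "connected (W \<union> ?R)" using \<open>connected W\<close> connected_ray by (intro connected_Un) auto
      moreover have "y \<in> ?R" unfolding ray_def by (subst yy, rule imageI) simp
      ultimately show ?thesis using Wball Rball x'(5) \<open>z \<in> W\<close> by (intro exI[of _ "W \<union> ?R"]) auto
    qed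
    then show ?thesis using \<delta>(1) by blast
  qed
qed

end

section \<open>Twists and marked wheels\<close>


lemma components_homeomorphism_image:
  assumes h: "homeomorphism S T f g" and C: "C \<in> components S"
  shows "f ` C \<in> components T"
  unfolding in_components_maximal
proof (intro conjI allI impI)
  have C': "C \<noteq> {}" "C \<subseteq> S" "connected C" "\<forall>D. D \<noteq> {} \<and> C \<subseteq> D \<and> D \<subseteq> S \<and> connected D \<longrightarrow> D = C"
    using C unfolding in_components_maximal by simp_all
  show "f ` C \<noteq> {}" using C'(1) by simp
  show "f ` C \<subseteq> T" using C'(2) homeomorphism_image1[OF h] by blast
  show "connected (f ` C)"
    using C' homeomorphism_cont1[OF h] by (meson connected_continuous_image continuous_on_subset)
  fix D assume D: "D \<noteq> {} \<and> f ` C \<subseteq> D \<and> D \<subseteq> T \<and> connected D"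
  have "connected (g ` D)"
    using D homeomorphism_cont2[OF h] by (meson connected_continuous_image continuous_on_subset)
  moreover have "g ` D \<subseteq> S" using D homeomorphism_image2[OF h] by blast
  moreover have "C \<subseteq> g ` D"
  proof
    fix x assume "x \<in> C"
    then have "f x \<in> D" "g (f x) = x" using D C'(2) homeomorphism_apply1[OF h] by auto
    then show "x \<in> g ` D" by (metis imageI)
  qed
  ultimately have "g ` D = C" using D C'(4)[rule_format, of "g ` D"] by blast
  moreover have "f ` g ` D = D" using D homeomorphism_apply2[OF h] by (force simp: image_image)
  ultimately show "D = f ` C" by simp
qed

lemma card_components_homeomorphism:
  assumes h: "homeomorphism S T f g"
  shows "card (components S) = card (components T)"
proof (rule bij_betw_same_card)
  show "bij_betw ((`) f) (components S) (components T)"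
  proof (rule bij_betw_byWitness[where f' = "(`) g"])
    show "\<forall>C\<in>components S. g ` f ` C = C"
      using homeomorphism_apply1[OF h] in_components_subset by (force simp: image_image)
    show "\<forall>C\<in>components T. f ` g ` C = C"
      using homeomorphism_apply2[OF h] in_components_subset by (force simp: image_image)
    show "(`) f ` components S \<subseteq> components T"
      using components_homeomorphism_image[OF h] by blast
    show "(`) g ` components T \<subseteq> components S"
      using components_homeomorphism_image[OF homeomorphism_symD[OF h]] by blast
  qed
qed

lemma card_components_punctured:
  assumes h: "homeomorphism S T f g" and a: "a \<in> S"
  shows "card (components (S - {a})) = card (components (T - {f a}))"
proof (rule card_components_homeomorphism)
  show "homeomorphism (S - {a}) (T - {f a}) f g"
  proof (rule homeomorphism_of_subsets[OF h])
    have "inj_on f S" using h by (metis homeomorphism_apply1 inj_onI)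
    then show "f ` (S - {a}) = T - {f a}"
      using a homeomorphism_image1[OF h] by (auto simp: inj_on_def)
  qed auto
qed

text \<open>A tent at \<open>(1/2) ^ n\<close>, supported between 3/4 and 5/4 of that level, so that
  it vanishes at all the other levels. Its height \<open>(1/2) ^ n\<close> is the fraction of a full
  turn by which the n-th marked point moves when \<open>x n\<close> changes by 1.\<close>

definition bump :: "nat \<Rightarrow> real \<Rightarrow> real" where
  "bump n t = max 0 (1 - 4 * \<bar>2 ^ n * t - 1\<bar>) * (1/2) ^ n"

lemma bump_bounds: "0 \<le> bump n t" "bump n t \<le> (1/2) ^ n"
  by (auto simp: bump_def mult_left_le_one_le)

lemma bump_level: "bump n ((1/2) ^ m) = (if n = m then (1/2) ^ n else 0)"
proof (cases n m rule: linorder_cases)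
  case less
  then obtain k where "m = Suc (n + k)" using less_iff_Suc_add by auto
  then have "(2 :: real) ^ n * (1/2) ^ m = (1/2) ^ Suc k"
    by (simp add: power_add power_one_over field_simps)
  moreover have "(1/2 :: real) ^ Suc k \<le> 1/2" using power_le_one[of "1/2 :: real" k] by simp
  ultimately have "4 * \<bar>2 ^ n * (1/2) ^ m - 1\<bar> \<ge> (2 :: real)" by simp
  then show ?thesis using less by (simp add: bump_def)
next
  case equal
  have "(2 :: real) ^ m * (1/2) ^ m = 1" by (simp add: power_mult_distrib[symmetric])
  then show ?thesis using equal by (simp add: bump_def)
next
  case greater
  then obtain k where "n = Suc (m + k)" using less_iff_Suc_add by auto
  then have "(2 :: real) ^ n * (1/2) ^ m = 2 ^ Suc k"
    by (simp add: power_add power_one_over field_simps)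
  moreover have "(2 :: real) ^ Suc k \<ge> 2" using one_le_power[of "2 :: real" k] by simp
  ultimately have "(2 :: real) ^ n * (1/2) ^ m \<ge> 2" by metis
  then have "4 * \<bar>2 ^ n * (1/2) ^ m - 1\<bar> \<ge> (4 :: real)" by argo
  then show ?thesis using greater by (simp add: bump_def)
qed

lemma continuous_bump: "continuous_on UNIV (bump n)"
  unfolding bump_def by (intro continuous_intros)

text \<open>Local finiteness lets a single denominator at a rational level serve all tents, and it
  turns \<open>twist\<close> into a finite sum at each level.\<close>

lemma finite_bump: assumes "0 \<le> t" shows "finite {n. bump n t \<noteq> 0}"
proof (cases "t = 0")
  case False
  then have t: "t > 0" using assms by simp
  obtain M where M: "2 / t < (2 :: real) ^ M" using real_arch_pow[of 2 "2 / t"] by auto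
  have "bump n t = 0" if "n \<ge> M" for n
  proof -
    have "(2 :: real) ^ M \<le> 2 ^ n" using that by (intro power_increasing) auto
    then have "2 ^ M * t \<le> 2 ^ n * t" using t by (intro mult_right_mono) auto
    moreover have "2 < 2 ^ M * t" using M t by (simp add: field_simps)
    ultimately have "2 < 2 ^ n * t" by linarith
    then show ?thesis by (simp add: bump_def)
  qed
  then have "{n. bump n t \<noteq> 0} \<subseteq> {..<M}" using not_le by (auto simp: not_le[symmetric])
  then show ?thesis by (rule finite_subset) simp
qed (simp add: bump_def)

lemma bump_rational: "t \<in> \<rat> \<Longrightarrow> bump n t \<in> \<rat>"
  unfolding bump_def max_def abs_if by (auto intro!: Rats_mult Rats_diff Rats_power Rats_divide Rats_minus_iff[THEN iffD2])

lemma rational_denominator: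
  assumes "(x :: real) \<in> \<rat>" shows "\<exists>d::nat. d > 0 \<and> real d * x \<in> \<int>"
proof -
  obtain a b where ab: "b > 0" "x = of_int a / of_int b" using assms by (rule Rats_cases') auto
  then have "real (nat b) * x = of_int a" by simp
  then show ?thesis using ab(1) by (intro exI[of _ "nat b"]) auto
qed

lemma common_denominator:
  fixes f :: "nat \<Rightarrow> real"
  assumes fin: "finite {n. f n \<noteq> 0}" and rat: "\<And>n. f n \<in> \<rat>"
  shows "\<exists>d::nat. d > 0 \<and> (\<forall>n. real d * f n \<in> \<int>)"
proof -
  obtain d where d: "\<And>n. d n > 0" "\<And>n. real (d n) * f n \<in> \<int>"
    using rational_denominator[OF rat] by metis
  define S where "S = {n. f n \<noteq> 0}"
  have "real (prod d S) * f n \<in> \<int>" for n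
  proof (cases "n \<in> S")
    case True
    then have "prod d S = d n * prod d (S - {n})" using fin by (intro prod.remove) (auto simp: S_def)
    then have "real (prod d S) * f n = real (prod d (S - {n})) * (real (d n) * f n)" by simp
    then show ?thesis using d(2)[of n] by (metis Ints_mult Ints_of_nat)
  qed (simp add: S_def)
  moreover have "prod d S > 0" using d(1) by (simp add: prod_pos)
  ultimately show ?thesis by blast
qed

text \<open>\<open>N q\<close> is a common denominator \<open>D q\<close> of all tent values at q,
  multiplied by \<open>ix q + 2\<close>, where \<open>ix q\<close> is an index of q in the
  enumeration of the rationals. The extra factor gives at least two spokes and makes the numbers
  tend to infinity.\<close>

lemma spoke_numbers_exist:
  "\<exists>N :: real \<Rightarrow> nat. (\<forall>q\<in>\<rat>. 2 \<le> N q) \<and> (\<forall>m. finite {q\<in>\<rat> \<inter> {0..1}. N q \<le> m}) \<and>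
     (\<forall>q\<in>\<rat>. 0 \<le> q \<longrightarrow> (\<forall>n. real (N q) * bump n q \<in> \<int>))"
proof -
  have "\<exists>d::nat. d > 0 \<and> (q \<in> \<rat> \<and> 0 \<le> q \<longrightarrow> (\<forall>n. real d * bump n q \<in> \<int>))" for q
    using common_denominator[of "\<lambda>n. bump n q"] finite_bump[of q] bump_rational[of q] by (cases "q \<in> \<rat> \<and> 0 \<le> q") auto
  then obtain D :: "real \<Rightarrow> nat" where D: "\<And>q. D q > 0" "\<And>q n. q \<in> \<rat> \<Longrightarrow> 0 \<le> q \<Longrightarrow> real (D q) * bump n q \<in> \<int>"
    by metis
  define ix where "ix q = (SOME i. rat_enum i = q)" for q
  have ix: "rat_enum (ix q) = q" if "q \<in> \<rat>" for q
    unfolding ix_def using rat_enum_surj[OF that] by (rule someI_ex)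
  define N where "N q = (ix q + 2) * D q" for q
  have "(ix q + 2) * 1 \<le> N q" for q unfolding N_def using D(1)[of q] by (intro mult_le_mono2) simp
  then have "ix q + 2 \<le> N q" for q by simp
  then have "2 \<le> N q" "ix q \<le> N q" for q using le_trans add_leD2 add_leD1 by blast+
  moreover have "finite {q\<in>\<rat> \<inter> {0..1}. N q \<le> m}" for m
  proof (rule finite_subset[of _ "rat_enum ` {..m}"])
    show "{q\<in>\<rat> \<inter> {0..1}. N q \<le> m} \<subseteq> rat_enum ` {..m}"
    proof
      fix q assume q: "q \<in> {q\<in>\<rat> \<inter> {0..1}. N q \<le> m}"
      then have "ix q \<le> m" using calculation(2)[of q] by simp
      then show "q \<in> rat_enum ` {..m}" using ix[of q] q by (metis (no_types, lifting) IntD1 atMost_iff imageI mem_Collect_eq)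
    qed
  qed simp
  moreover have "real (N q) * bump n q \<in> \<int>" if "q \<in> \<rat>" "0 \<le> q" for q n
  proof -
    have "real (N q) * bump n q = real (ix q + 2) * (real (D q) * bump n q)" by (simp add: N_def algebra_simps)
    then show ?thesis using D(2)[OF that, of n] by (metis Ints_mult Ints_of_nat)
  qed
  ultimately show ?thesis by blast
qed

definition twist :: "(nat \<Rightarrow> int) \<Rightarrow> real \<Rightarrow> real" where
  "twist d t = (\<Sum>n. of_int (d n) * bump n t)"

lemma twist_term_bound:
  assumes "\<And>n. \<bar>d n\<bar> \<le> 1" shows "norm (of_int (d n) * bump n t) \<le> (1/2) ^ n"
proof -
  have "\<bar>real_of_int (d n)\<bar> \<le> 1" using assms[of n] by linarith
  then have "\<bar>real_of_int (d n)\<bar> * \<bar>bump n t\<bar> \<le> 1 * (1/2) ^ n"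
    using bump_bounds[of n t] by (intro mult_mono) auto
  then show ?thesis by (simp add: abs_mult)
qed

text \<open>This is where the restriction to changes by at most 1 enters: it makes the series of
  tents converge uniformly, so that the angle is continuous also at level 0, where the tents
  accumulate.\<close>

lemma continuous_twist:
  assumes "\<And>n. \<bar>d n\<bar> \<le> 1" shows "continuous_on UNIV (twist d)"
proof (rule uniform_limit_theorem)
  show "uniform_limit UNIV (\<lambda>n t. \<Sum>i<n. of_int (d i) * bump i t) (twist d) sequentially"
    unfolding twist_def
    by (rule Weierstrass_m_test[where M = "\<lambda>n. (1/2) ^ n"])
       (use twist_term_bound[OF assms] summable_half in auto)
  show "\<forall>\<^sub>F n in sequentially. continuous_on UNIV (\<lambda>t. \<Sum>i<n. of_int (d i) * bump i t)"
    by (intro always_eventually allI continuous_on_sum continuous_on_mult continuous_on_const continuous_bump)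
qed simp

lemma twist_finite:
  assumes "0 \<le> t" shows "twist d t = (\<Sum>n\<in>{n. bump n t \<noteq> 0}. of_int (d n) * bump n t)"
  unfolding twist_def by (rule suminf_finite[OF finite_bump[OF assms]]) auto

lemma twist_minus: "0 \<le> t \<Longrightarrow> twist (\<lambda>n. - d n) t = - twist d t"
  by (simp add: twist_finite sum_negf)

lemma twist_level: "twist d ((1/2) ^ m) = of_int (d m) * (1/2) ^ m"
proof -
  have "{n. bump n ((1/2) ^ m) \<noteq> 0} = {m}" by (auto simp: bump_level)
  then show ?thesis using twist_finite[of "(1/2) ^ m" d] by (simp add: bump_level)
qed

section \<open>Rotations of the wheel and the attached whiskers\<close>

locale spinning_wheel = wheel +
  assumes N_bump: "q \<in> \<rat> \<Longrightarrow> 0 \<le> q \<Longrightarrow> real (N q) * bump n q \<in> \<int>"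
begin

lemma N_twist: assumes "q \<in> \<rat>" "0 \<le> q" shows "real (N q) * twist d q \<in> \<int>"
proof -
  have "real (N q) * twist d q = (\<Sum>n\<in>{n. bump n q \<noteq> 0}. of_int (d n) * (real (N q) * bump n q))"
    using twist_finite[OF assms(2)] by (simp add: sum_distrib_left mult_ac)
  moreover have "\<dots> \<in> \<int>" by (intro Ints_sum Ints_mult Ints_of_int N_bump assms)
  ultimately show ?thesis by (simp only:)
qed

definition spin :: "(nat \<Rightarrow> int) \<Rightarrow> complex \<Rightarrow> complex" where
  "spin d z = z * cis (2 * pi * twist d (stair (norm z)))"

lemma norm_spin [simp]: "norm (spin d z) = norm z"
  by (simp add: spin_def norm_mult)

lemma spin_inverse: "0 \<le> stair (norm z) \<Longrightarrow> spin (\<lambda>n. - d n) (spin d z) = z"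
  unfolding spin_def[of "\<lambda>n. - d n"] norm_spin by (simp add: spin_def twist_minus mult.assoc cis_mult)

lemma continuous_spin: assumes "\<And>n. \<bar>d n\<bar> \<le> 1" shows "continuous_on UNIV (spin d)"
proof -
  have "continuous_on UNIV (\<lambda>z :: complex. stair (norm z))"
    by (rule continuous_on_compose2[OF continuous_stair]) (auto intro!: continuous_intros)
  then have "continuous_on UNIV (\<lambda>z :: complex. twist d (stair (norm z)))"
    by (rule continuous_on_compose2[OF continuous_twist[OF assms]]) auto
  then show ?thesis unfolding spin_def by (intro continuous_intros)
qed

lemma cis_power_Ints: assumes "real k * x \<in> \<int>" shows "cis (2 * pi * x) ^ k = 1"
proof -
  have "cis (2 * pi * x) ^ k = cis (real k * (2 * pi * x))" by (rule Complex.DeMoivre)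
  also have "real k * (2 * pi * x) = 2 * pi * (real k * x)" by simp
  finally show ?thesis using assms by simp
qed

text \<open>Circles are invariant under any twist. Across the gap at q the angle is constant, and it
  is a multiple of the angle between neighbouring spokes by \<open>N_twist\<close>.\<close>

lemma spin_base: assumes z: "z \<in> base" shows "spin d z \<in> base"
proof -
  have "sgn (spin d z) ^ N (stair (norm z)) = 1" if f: "norm z \<in> flat"
  proof -
    define q where "q = stair (norm z)"
    have q: "q \<in> \<rat>" "0 \<le> q" using flat_level_rational[OF f] z by (auto simp: q_def base_def)
    have "sgn (spin d z) = sgn z * cis (2 * pi * twist d q)"
      unfolding spin_def q_def[symmetric] by (simp add: sgn_mult sgn_eq[of "cis _"])
    moreover have "sgn z ^ N q = 1" using z f by (simp add: base_def q_def)
    ultimately show ?thesis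
      using cis_power_Ints[OF N_twist[OF q]] by (simp add: q_def power_mult_distrib)
  qed
  then show ?thesis using z by (simp add: base_def)
qed

definition mid :: "nat \<Rightarrow> real" where
  "mid n = (lo ((1/2) ^ n) + hi ((1/2) ^ n)) / 2"

lemma level_rat: "(1/2 :: real) ^ n \<in> \<rat>"
  by (intro Rats_power) simp

lemma level_range: "0 \<le> (1/2 :: real) ^ n" "(1/2 :: real) ^ n \<le> 1"
  by (simp_all add: power_le_one)

lemma mid_gap: "lo ((1/2) ^ n) < mid n" "mid n < hi ((1/2) ^ n)"
  using lo_less_hi[OF level_rat[of n]] by (auto simp: mid_def)

lemma stair_mid: "stair (mid n) = (1/2) ^ n"
  using flat_gap[OF mid_gap] by blast

lemma mid_pos: "0 < mid n"
  by (rule stair_nonneg_imp_pos) (simp add: stair_mid)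

definition pin :: "nat \<Rightarrow> real \<Rightarrow> complex" where
  "pin n k = of_real (mid n) * cis (2 * pi * (k * (1/2) ^ n))"

lemma norm_pin: "norm (pin n k) = mid n"
  using mid_pos[of n] by (simp add: pin_def norm_mult)

text \<open>The n-th tent equals \<open>(1/2) ^ n\<close> at its own level, so \<open>N_bump\<close>
  makes the number of spokes there a multiple of \<open>2 ^ n\<close>; every integral position k is
  a spoke direction.\<close>

lemma pin_root: "k \<in> \<int> \<Longrightarrow> cis (2 * pi * (k * (1/2) ^ n)) ^ N ((1/2) ^ n) = 1"
proof (rule cis_power_Ints)
  assume "k \<in> \<int>"
  moreover have "real (N ((1/2) ^ n)) * (1/2) ^ n \<in> \<int>"
    using N_bump[OF level_rat level_range(1), of n n] by (simp add: bump_level)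
  ultimately have "k * (real (N ((1/2) ^ n)) * (1/2) ^ n) \<in> \<int>" by (rule Ints_mult)
  then show "real (N ((1/2) ^ n)) * (k * (1/2) ^ n) \<in> \<int>" by (simp only: mult_ac)
qed

lemma pin_in_base: "k \<in> \<int> \<Longrightarrow> pin n k \<in> base"
  unfolding pin_def using pin_root level_range by (intro spoke_in_base) (simp_all add: stair_mid)

text \<open>w stands for the quotient of a whisker point by its foot. The bound keeps the whisker
  inside its gap, away from all other spokes, and of length at most \<open>(1/2) ^ n\<close>. The
  factor \<open>real n + 3\<close> dominates the norm of each direction j + i with j \<le> n +
  1.\<close>

lemma arm_size_exists:
  "\<exists>\<eta>>0. \<eta> * (real n + 3) * mid n \<le> (1/2) ^ n \<and>
     (\<forall>w :: complex. norm (w - 1) \<le> \<eta> * (real n + 3) \<longrightarrow>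
        lo ((1/2) ^ n) < mid n * norm w \<and> mid n * norm w < hi ((1/2) ^ n) \<and>
        (sgn w ^ N ((1/2) ^ n) = 1 \<longrightarrow> sgn w = 1))"
proof -
  obtain d where d: "d > 0" "\<And>y. dist 1 y < d \<Longrightarrow> sgn y ^ N ((1/2) ^ n) = 1 \<Longrightarrow> sgn y = (1 :: complex)"
    using root_separation[of 1 "N ((1/2) ^ n)"] N_ge_2[OF level_rat[of n]] by auto
  \<comment> \<open>The four bounds separate the roots of unity, respect the inner and the outer
    edge of the gap, and limit the length. Finally c is divided by
    \<open>real n + 3\<close>.\<close>
  define c where "c = Min {d / 2, (mid n - lo ((1/2) ^ n)) / (2 * mid n), (hi ((1/2) ^ n) - mid n) / (2 * mid n), (1/2) ^ n / mid n}"
  have c: "c > 0"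
    unfolding c_def using d(1) mid_gap[of n] mid_pos[of n] by (subst Min_gr_iff) auto
  have "c \<le> d / 2 \<and> c \<le> (mid n - lo ((1/2) ^ n)) / (2 * mid n) \<and> c \<le> (hi ((1/2) ^ n) - mid n) / (2 * mid n) \<and> c \<le> (1/2) ^ n / mid n"
    unfolding c_def by (intro conjI Min_le) simp_all
  note c = c conjunct1[OF this] conjunct2[OF this, THEN conjunct1] conjunct2[OF this, THEN conjunct2, THEN conjunct1] conjunct2[OF this, THEN conjunct2, THEN conjunct2]
  have c': "c * mid n < mid n - lo ((1/2) ^ n)" "c * mid n < hi ((1/2) ^ n) - mid n" "c * mid n \<le> (1/2) ^ n"
    using c(3-5) mid_pos[of n] mid_gap[of n] by (simp_all add: field_simps)
  have "lo ((1/2) ^ n) < mid n * norm w \<and> mid n * norm w < hi ((1/2) ^ n) \<and> (sgn w ^ N ((1/2) ^ n) = 1 \<longrightarrow> sgn w = 1)"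
    if w: "norm (w - 1) \<le> c" for w :: complex
  proof -
    have "\<bar>norm w - 1\<bar> \<le> c" using norm_triangle_ineq3[of w 1] w by simp
    then have "mid n * \<bar>norm w - 1\<bar> \<le> mid n * c" using mid_pos[of n] by (intro mult_left_mono) auto
    moreover have "\<bar>mid n * (norm w - 1)\<bar> = mid n * \<bar>norm w - 1\<bar>" using mid_pos[of n] by (simp add: abs_mult)
    ultimately have "\<bar>mid n * norm w - mid n\<bar> \<le> c * mid n"
      by (simp add: right_diff_distrib mult.commute)
    then have "lo ((1/2) ^ n) < mid n * norm w" "mid n * norm w < hi ((1/2) ^ n)" using c'(1,2) by linarith+
    moreover have "dist 1 w < d" using w c(2) d(1) by (simp add: dist_norm norm_minus_commute)
    ultimately show ?thesis using d(2) by blast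
  qed
  moreover have "c / (real n + 3) * (real n + 3) = c" by simp
  ultimately show ?thesis using c(1) c'(3) by (intro exI[of _ "c / (real n + 3)"]) simp
qed

definition arm :: "nat \<Rightarrow> real" where
  "arm n = (SOME \<eta>. \<eta> > 0 \<and> \<eta> * (real n + 3) * mid n \<le> (1/2) ^ n \<and>
     (\<forall>w :: complex. norm (w - 1) \<le> \<eta> * (real n + 3) \<longrightarrow>
        lo ((1/2) ^ n) < mid n * norm w \<and> mid n * norm w < hi ((1/2) ^ n) \<and>
        (sgn w ^ N ((1/2) ^ n) = 1 \<longrightarrow> sgn w = 1)))"

lemma arm:
  fixes w :: complex
  shows "arm n > 0" "arm n * (real n + 3) * mid n \<le> (1/2) ^ n"
  "norm (w - 1) \<le> arm n * (real n + 3) \<Longrightarrow> lo ((1/2) ^ n) < mid n * norm w"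
  "norm (w - 1) \<le> arm n * (real n + 3) \<Longrightarrow> mid n * norm w < hi ((1/2) ^ n)"
  "norm (w - 1) \<le> arm n * (real n + 3) \<Longrightarrow> sgn w ^ N ((1/2) ^ n) = 1 \<Longrightarrow> sgn w = 1"
  using someI_ex[OF arm_size_exists[of n], folded arm_def] by blast+

text \<open>Relative to the foot the whisker points in the direction j + i: the imaginary part makes
  it leave the spoke, and different j give different slopes. Multiplication by the foot makes the
  construction equivariant under rotation.\<close>

definition tip :: "nat \<Rightarrow> nat \<Rightarrow> real \<Rightarrow> complex" where
  "tip n j k = pin n k * (1 + of_real (arm n) * (of_nat j + \<i>))"

definition arms :: "(nat \<times> nat) set" where
  "arms = {(n, j). j \<le> Suc n}"

lemma norm_dir: assumes "j \<le> Suc n" shows "norm (of_nat j + \<i> :: complex) \<le> real n + 3"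
proof -
  have "norm (of_nat j + \<i> :: complex) \<le> real j + 1" using norm_triangle_ineq[of "of_nat j" \<i>] by simp
  then show ?thesis using assms by linarith
qed

lemma seg_point:
  assumes "w \<in> closed_segment (pin n k) (tip n j k)"
  obtains s where "0 \<le> s" "s \<le> 1" "w = pin n k * (1 + of_real (s * arm n) * (of_nat j + \<i>))"
proof -
  obtain s where "0 \<le> s" "s \<le> 1" "w = (1 - s) *\<^sub>R pin n k + s *\<^sub>R tip n j k"
    using assms by (auto simp: in_segment)
  then show ?thesis by (intro that[of s]) (simp_all add: tip_def scaleR_conv_of_real algebra_simps)
qed

text \<open>The quotient v of a whisker point by its foot is close to 1. If the point is on a spoke,
  then \<open>sgn v\<close> is a root of unity near 1, hence 1; so v is real, which happens only at
  the foot.\<close>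

lemma seg_level:
  assumes j: "j \<le> Suc n" and w: "w \<in> closed_segment (pin n k) (tip n j k)"
  shows "norm w \<in> flat" "stair (norm w) = (1/2) ^ n"
    and "k \<in> \<int> \<Longrightarrow> w \<in> base \<Longrightarrow> w = pin n k"
proof -
  obtain s where s: "0 \<le> s" "s \<le> 1" "w = pin n k * (1 + of_real (s * arm n) * (of_nat j + \<i>))"
    using w by (rule seg_point)
  define v where "v = 1 + of_real (s * arm n) * (of_nat j + \<i> :: complex)"
  have "norm (v - 1) = s * arm n * norm (of_nat j + \<i> :: complex)"
    using s(1) arm(1)[of n] by (simp add: v_def norm_mult)
  also have "\<dots> \<le> 1 * arm n * (real n + 3)"
    using s arm(1)[of n] norm_dir[OF j] by (intro mult_mono) auto
  finally have v: "norm (v - 1) \<le> arm n * (real n + 3)" by simp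
  have wv: "w = pin n k * v" using s(3) by (simp add: v_def)
  have nw: "norm w = mid n * norm v" unfolding wv norm_mult norm_pin ..
  show 1: "norm w \<in> flat" "stair (norm w) = (1/2) ^ n"
    using flat_gap[of "(1/2) ^ n" "norm w"] arm(3,4)[OF v] by (simp_all add: nw)
  assume k: "k \<in> \<int>" and wb: "w \<in> base"
  have "sgn w = cis (2 * pi * (k * (1/2) ^ n)) * sgn v"
    unfolding wv pin_def using mid_pos[of n] by (simp add: sgn_mult sgn_eq[of "cis _"] sgn_of_real)
  then have "sgn v ^ N ((1/2) ^ n) = 1"
    using wb 1 pin_root[OF k, of n] by (simp add: base_def power_mult_distrib)
  then have "sgn v = 1" using arm(5)[OF v] by blast
  then have "v = of_real (norm v)" using norm_sgn_mult[of v] by simp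
  then have "Im v = 0" by (metis Im_complex_of_real)
  then have "s * arm n = 0" by (simp add: v_def)
  then show "w = pin n k" by (simp add: wv v_def)
qed

definition disc :: "(nat \<Rightarrow> nat) \<Rightarrow> complex set" where
  "disc x = base \<union> (\<Union>(n, j)\<in>arms. closed_segment (pin n (x n)) (tip n j (x n)))"

lemma dist_pin_tip: assumes "j \<le> Suc n" shows "dist (pin n k) (tip n j k) \<le> (1/2) ^ n"
proof -
  have "dist (pin n k) (tip n j k) = norm (pin n k * (of_real (arm n) * (of_nat j + \<i>)))"
    by (simp add: dist_norm tip_def algebra_simps norm_minus_commute)
  also have "\<dots> = mid n * (arm n * norm (of_nat j + \<i> :: complex))"
    using arm(1)[of n] by (simp add: norm_mult norm_pin)
  also have "\<dots> \<le> mid n * (arm n * (real n + 3))"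
    using arm(1)[of n] mid_pos[of n] norm_dir[OF assms] by (intro mult_left_mono) auto
  also have "\<dots> \<le> (1/2) ^ n" using arm(2)[of n] by (simp add: mult_ac)
  finally show ?thesis .
qed

lemma hairy_disc:
  fixes x :: "nat \<Rightarrow> nat"
  shows "hairy_set base arms (\<lambda>(n, j). pin n (x n)) (\<lambda>(n, j). tip n j (x n))"
proof
  show "compact base" by (rule compact_base)
next
  fix i assume "i \<in> arms"
  then obtain n j where i: "i = (n, j)" "j \<le> Suc n" by (auto simp: arms_def)
  show "closed_segment ((\<lambda>(n, j). pin n (x n)) i) ((\<lambda>(n, j). tip n j (x n)) i) \<inter> base = {(\<lambda>(n, j). pin n (x n)) i}"
    using seg_level(3)[OF i(2), of _ "x n"] pin_in_base[of "real (x n)" n] by (auto simp: i(1))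
  have "pin n (x n) \<noteq> 0" using norm_pin[of n "x n"] mid_pos[of n] by auto
  moreover have "of_real (arm n) * (of_nat j + \<i>) \<noteq> 0"
    using arm(1)[of n] by (auto simp: complex_eq_iff)
  ultimately show "(\<lambda>(n, j). pin n (x n)) i \<noteq> (\<lambda>(n, j). tip n j (x n)) i"
    by (simp add: i(1) tip_def)
next
  fix \<epsilon> :: real assume "\<epsilon> > 0"
  then obtain M where M: "(1/2 :: real) ^ M < \<epsilon>" using real_arch_pow_inv[of \<epsilon> "1/2"] by auto
  show "finite {i\<in>arms. \<epsilon> \<le> dist ((\<lambda>(n, j). pin n (x n)) i) ((\<lambda>(n, j). tip n j (x n)) i)}"
  proof (rule finite_subset)
    show "{i\<in>arms. \<epsilon> \<le> dist ((\<lambda>(n, j). pin n (x n)) i) ((\<lambda>(n, j). tip n j (x n)) i)} \<subseteq> {..M} \<times> {..Suc M}"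
    proof
      fix i assume i: "i \<in> {i\<in>arms. \<epsilon> \<le> dist ((\<lambda>(n, j). pin n (x n)) i) ((\<lambda>(n, j). tip n j (x n)) i)}"
      then obtain n j where nj: "i = (n, j)" "j \<le> Suc n" by (auto simp: arms_def)
      have "\<epsilon> \<le> (1/2) ^ n" using i dist_pin_tip[OF nj(2), of "x n"] by (simp add: nj(1))
      then have "(1/2 :: real) ^ M < (1/2) ^ n" using M by (rule less_le_trans[rotated])
      then have "n < M" by (subst (asm) power_strict_decreasing_iff) simp_all
      then show "i \<in> {..M} \<times> {..Suc M}" using nj by simp
    qed
  qed simp
next
  fix i i' assume ii: "i \<in> arms" "i' \<in> arms" "i \<noteq> i'"
  obtain n j where i: "i = (n, j)" "j \<le> Suc n" using ii(1) by (auto simp: arms_def)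
  obtain m l where i': "i' = (m, l)" "l \<le> Suc m" using ii(2) by (auto simp: arms_def)
  have "w \<in> base" if w: "w \<in> closed_segment (pin n (x n)) (tip n j (x n))" "w \<in> closed_segment (pin m (x m)) (tip m l (x m))" for w
  proof -
    have "(1/2 :: real) ^ n = (1/2) ^ m" using seg_level(2)[OF i(2) w(1)] seg_level(2)[OF i'(2) w(2)] by simp
    then have nm: "n = m" by (simp add: power_inject_exp')
    obtain s where s: "w = pin n (x n) * (1 + of_real (s * arm n) * (of_nat j + \<i>))" by (rule seg_point[OF w(1)])
    obtain s' where s': "w = pin m (x m) * (1 + of_real (s' * arm m) * (of_nat l + \<i>))" by (rule seg_point[OF w(2)])
    have "pin n (x n) \<noteq> 0" using norm_pin[of n "x n"] mid_pos[of n] by auto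
    moreover have "pin n (x n) * (1 + of_real (s * arm n) * (of_nat j + \<i>)) = pin n (x n) * (1 + of_real (s' * arm n) * (of_nat l + \<i>))"
      using s s' nm by metis
    ultimately have "of_real (s * arm n) * (of_nat j + \<i>) = of_real (s' * arm n) * (of_nat l + \<i> :: complex)"
      unfolding mult_cancel_left add_left_cancel by blast
    \<comment> \<open>Imaginary parts equate the two parameters, and real parts with j \<noteq> l
      force them to vanish: two whiskers on one foot meet only there. Whiskers of different n lie in
      different gaps.\<close>
    then have "s * arm n = s' * arm n" "s * arm n * j = s' * arm n * l" by (simp_all add: complex_eq_iff)
    moreover have "j \<noteq> l" using ii(3) nm i i' by simp
    ultimately have "s * arm n = 0" by auto
    then have "w = pin n (x n)" using s by simp
    then show ?thesis using pin_in_base[of "real (x n)" n] by simp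
  qed
  then show "closed_segment ((\<lambda>(n, j). pin n (x n)) i) ((\<lambda>(n, j). tip n j (x n)) i) \<inter>
      closed_segment ((\<lambda>(n, j). pin n (x n)) i') ((\<lambda>(n, j). tip n j (x n)) i') \<subseteq> base"
    by (auto simp: i(1) i'(1))
qed

lemma disc_Y: "hairy_set.Y base arms (\<lambda>(n, j). pin n (x n)) (\<lambda>(n, j). tip n j (x n)) = disc x" for x :: "nat \<Rightarrow> nat"
  unfolding hairy_set.Y_def[OF hairy_disc] disc_def by (auto split: prod.splits)

lemma compact_disc: "compact (disc x)"
  using hairy_set.compact_Y[OF hairy_disc[of x]] by (simp add: disc_Y)

lemma connected_disc: "connected (disc x)"
  using hairy_set.connected_Y[OF hairy_disc[of x] connected_base] by (simp add: disc_Y)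

lemma locally_connected_disc: "locally connected (disc x)"
  using im_kleinen_imp_locally_connected[OF hairy_set.im_kleinen_Y[OF hairy_disc[of x] im_kleinen_base]]
  by (simp add: disc_Y)

lemma pin_inject: assumes "pin n k = pin m l" shows "n = m"
proof -
  have "(1/2 :: real) ^ n = (1/2) ^ m" using assms norm_pin[of n k] norm_pin[of m l] stair_mid by metis
  then show ?thesis by (simp add: power_inject_exp')
qed

text \<open>The indices j \<le> n + 1 give n + 2 whiskers at this foot, and the rest of the
  continuum is one more component.\<close>

lemma card_components_pin: "card (components (disc x - {pin n (x n)})) = n + 3"
proof -
  have eq: "{i\<in>arms. (\<lambda>(n, j). pin n (x n)) i = pin n (x n)} = {n} \<times> {..Suc n}"
    using pin_inject by (auto simp: arms_def)
  show ?thesis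
    using hairy_set.card_components_base[OF hairy_disc[of x] pin_in_base connected_punctured_base[OF pin_in_base] base_minus_nonempty, of "real (x n)" n]
    by (simp add: disc_Y eq)
qed

lemma card_components_other:
  assumes q: "q \<in> disc x" "\<And>n. q \<noteq> pin n (x n)"
  shows "card (components (disc x - {q})) \<le> 2"
proof (cases "q \<in> base")
  case True
  have eq: "{i\<in>arms. (\<lambda>(n, j). pin n (x n)) i = q} = {}" using q(2) by auto
  show ?thesis
    using hairy_set.card_components_base[OF hairy_disc[of x] True connected_punctured_base[OF True] base_minus_nonempty]
    by (simp add: disc_Y eq)
next
  case False
  show ?thesis
    using hairy_set.card_components_arm[OF hairy_disc[of x] _ False connected_base] q(1) by (simp add: disc_Y)
qed

text \<open>The number of components left after removing a point is topological. The value n + 3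
  exceeds 2, so it singles out the marked points and even determines the index n.\<close>

lemma homeomorphism_pin:
  assumes h: "homeomorphism (disc x) (disc z) f g"
  shows "f (pin n (x n)) = pin n (z n)"
proof -
  have p: "pin n (x n) \<in> disc x" using pin_in_base[of "real (x n)" n] by (simp add: disc_def)
  then have fp: "f (pin n (x n)) \<in> disc z" using homeomorphism_image1[OF h] by blast
  have c: "card (components (disc z - {f (pin n (x n))})) = n + 3"
    using card_components_punctured[OF h p] by (simp add: card_components_pin)
  then obtain m where m: "f (pin n (x n)) = pin m (z m)"
    using card_components_other[OF fp] by fastforce
  then have "m = n" using c card_components_pin[of z m] by simp
  then show ?thesis using m by simp
qed

text \<open>The whole n-th bunch of whiskers lies in one gap, where the twist is the rotation by
  \<open>d n\<close> steps of \<open>2 * pi / 2 ^ n\<close>; it carries feet to feet and ends to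
  ends.\<close>

lemma spin_disc:
  assumes d: "\<And>n. real (y n) = real (x n) + of_int (d n)"
  shows "spin d ` disc x \<subseteq> disc y"
proof -
  have "spin d w \<in> disc y" if nj: "(n, j) \<in> arms" and w: "w \<in> closed_segment (pin n (x n)) (tip n j (x n))" for n j w
  proof -
    have j: "j \<le> Suc n" using nj by (simp add: arms_def)
    define c where "c = cis (2 * pi * (of_int (d n) * (1/2) ^ n))"
    have "spin d w = w * c" using seg_level(2)[OF j w] by (simp add: spin_def c_def twist_level)
    moreover have "pin n (y n) = pin n (x n) * c"
      by (simp add: pin_def c_def d cis_mult algebra_simps)
    moreover have "tip n j (y n) = tip n j (x n) * c"
      using calculation(2) by (simp add: tip_def)
    moreover have "linear (\<lambda>z. z * c)" by (simp add: linear_iff algebra_simps scaleR_conv_of_real)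
    then have "closed_segment (pin n (x n) * c) (tip n j (x n) * c) = (\<lambda>z. z * c) ` closed_segment (pin n (x n)) (tip n j (x n))"
      by (rule closed_segment_linear_image)
    ultimately have "spin d w \<in> closed_segment (pin n (y n)) (tip n j (y n))" using w by auto
    then show ?thesis using nj by (auto simp: disc_def)
  qed
  moreover have "spin d w \<in> disc y" if "w \<in> base" for w using spin_base[OF that] by (simp add: disc_def)
  moreover have "w \<in> base \<or> (\<exists>(n, j)\<in>arms. w \<in> closed_segment (pin n (x n)) (tip n j (x n)))" if "w \<in> disc x" for w
    using that by (auto simp: disc_def)
  ultimately show ?thesis by fastforce
qed

lemma disc_level: assumes "z \<in> disc x" shows "0 \<le> stair (norm z)"
  using assms seg_level(2) by (auto simp: disc_def base_def arms_def)

lemma disc_homeomorphic: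
  assumes near: "\<And>n. x n \<le> Suc (y n) \<and> y n \<le> Suc (x n)"
  shows "disc x homeomorphic disc y"
proof -
  define d where "d n = int (y n) - int (x n)" for n
  have d1: "\<bar>d n\<bar> \<le> 1" "\<bar>- d n\<bar> \<le> 1" for n using near[of n] by (auto simp: d_def)
  have dxy: "real (y n) = real (x n) + of_int (d n)" "real (x n) = real (y n) + of_int (- d n)" for n by (simp_all add: d_def)
  have inv: "spin d (spin (\<lambda>n. - d n) z) = z" if "0 \<le> stair (norm z)" for z
    using spin_inverse[OF that, of "\<lambda>n. - d n"] by simp
  have "homeomorphism (disc x) (disc y) (spin d) (spin (\<lambda>n. - d n))"
  proof (rule homeomorphismI)
    show "continuous_on (disc x) (spin d)"
      by (rule continuous_on_subset[OF continuous_spin[OF d1(1)] subset_UNIV])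
    show "continuous_on (disc y) (spin (\<lambda>n. - d n))"
      by (rule continuous_on_subset[OF continuous_spin[of "\<lambda>n. - d n", OF d1(2)] subset_UNIV])
    show "spin d ` disc x \<subseteq> disc y" by (rule spin_disc[OF dxy(1)])
    show "spin (\<lambda>n. - d n) ` disc y \<subseteq> disc x" by (rule spin_disc[OF dxy(2)])
    show "spin (\<lambda>n. - d n) (spin d z) = z" if "z \<in> disc x" for z using spin_inverse disc_level[OF that] by blast
    show "spin d (spin (\<lambda>n. - d n) z) = z" if "z \<in> disc y" for z using inv disc_level[OF that] by blast
  qed
  then show ?thesis unfolding homeomorphic_def by blast
qed

end

section \<open>Non-homeomorphic wheels and the Borel reduction\<close>


context spinning_wheel begin

text \<open>The levels \<open>(1/2) ^ n\<close> decrease to 0 and \<open>stair\<close> is positive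
  just beyond \<open>hi 0\<close>, so the marked radii shrink to the radius of the limit
  circle.\<close>

lemma mid_tendsto: assumes "\<delta> > 0" shows "\<exists>M. \<forall>n\<ge>M. hi 0 < mid n \<and> mid n < hi 0 + \<delta>"
proof -
  have "stair (hi 0 + \<delta>) \<noteq> 0" using stair_level[of "hi 0 + \<delta>" 0] assms by simp
  moreover have "stair (hi 0) \<le> stair (hi 0 + \<delta>)" using assms by (intro stair_mono) simp
  ultimately have "stair (hi 0 + \<delta>) > 0" by simp
  then obtain M where M: "(1/2 :: real) ^ M < stair (hi 0 + \<delta>)" using real_arch_pow_inv[of _ "1/2"] by auto
  have "hi 0 < mid n \<and> mid n < hi 0 + \<delta>" if "n \<ge> M" for n
  proof
    show "hi 0 < mid n" by (rule stair_less_imp) (simp add: stair_mid)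
    have "(1/2 :: real) ^ n \<le> (1/2) ^ M" using that by (intro power_decreasing) auto
    then have "stair (mid n) < stair (hi 0 + \<delta>)" unfolding stair_mid using M by (rule le_less_trans)
    then show "mid n < hi 0 + \<delta>" by (rule stair_less_imp)
  qed
  then show ?thesis by blast
qed

lemma pin_0: "pin n 0 = of_real (mid n)"
  by (simp add: pin_def)

lemma pin_half: assumes "n \<ge> 1" shows "pin n (real (2 ^ n div 2)) = - of_real (mid n)"
proof -
  obtain m where n: "n = Suc m" using assms by (cases n) auto
  have "real (2 ^ n div 2) * (1/2) ^ n = 1/2" unfolding n by (simp add: power_one_over field_simps)
  then have "pin n (real (2 ^ n div 2)) = of_real (mid n) * cis (2 * pi * (1/2))" unfolding pin_def by (simp only:)
  then show ?thesis by simp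
qed

text \<open>The marked points with \<open>x n = 0\<close> converge to the point b of the limit
  circle at angle 0. Their images are again marked points; along one subsequence they lie at angle 0
  and along another at angle pi, at radii above \<open>hi 0\<close>. Continuity at b with tolerance
  \<open>hi 0\<close> would bring two such images closer than \<open>2 * hi 0\<close>.\<close>

lemma disc_not_homeomorphic:
  fixes x z :: "nat \<Rightarrow> nat"
  assumes near: "\<forall>M. \<exists>n\<ge>M. x n = 0 \<and> z n = 0" and far: "\<forall>M. \<exists>n\<ge>M. x n = 0 \<and> z n = 2 ^ n div 2"
  shows "\<not> disc x homeomorphic disc z"
proof
  assume "disc x homeomorphic disc z"
  then obtain f g where h: "homeomorphism (disc x) (disc z) f g" unfolding homeomorphic_def by blast
  define b where "b = complex_of_real (hi 0)"
  have pos: "hi 0 > 0" by (rule stair_nonneg_imp_pos) simp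
  have "norm b = hi 0" using pos by (simp add: b_def)
  then have "b \<in> base" by (intro circle_in_base) (simp_all add: lo_hi_not_flat)
  then have "b \<in> disc x" by (simp add: disc_def)
  then obtain \<delta> where \<delta>: "\<delta> > 0" "\<And>w. w \<in> disc x \<Longrightarrow> dist w b < \<delta> \<Longrightarrow> dist (f w) (f b) < hi 0"
    using homeomorphism_cont1[OF h] pos unfolding continuous_on_iff by metis
  obtain M where M: "\<And>n. n \<ge> M \<Longrightarrow> hi 0 < mid n \<and> mid n < hi 0 + \<delta>"
    using mid_tendsto[OF \<delta>(1)] by blast
  have image: "dist (pin n (z n)) (f b) < hi 0" if n: "n \<ge> M" "x n = 0" for n
  proof -
    have "pin n (x n) \<in> disc x" using pin_in_base[of "real (x n)" n] by (simp add: disc_def)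
    moreover have "dist (pin n (x n)) b = \<bar>mid n - hi 0\<bar>"
      unfolding n(2) of_nat_0 pin_0 b_def dist_norm of_real_diff[symmetric] norm_of_real ..
    then have "dist (pin n (x n)) b < \<delta>" using M[OF n(1)] by simp
    ultimately have "dist (f (pin n (x n))) (f b) < hi 0" by (rule \<delta>(2))
    then show ?thesis by (simp only: homeomorphism_pin[OF h])
  qed
  obtain n where n: "n \<ge> M" "x n = 0" "z n = 0" using near by blast
  obtain m where m: "m \<ge> Suc M" "x m = 0" "z m = 2 ^ m div 2" using far by blast
  have "pin n (z n) = of_real (mid n)" using n(3) by (simp add: pin_0)
  then have 1: "dist (of_real (mid n)) (f b) < hi 0" using image[OF n(1,2)] by simp
  have "pin m (z m) = - of_real (mid m)" unfolding m(3) by (rule pin_half) (use m(1) in simp)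
  then have 2: "dist (- of_real (mid m)) (f b) < hi 0" using image[of m] m by simp
  have "dist (of_real (mid n)) (- of_real (mid m) :: complex) = mid n + mid m"
  proof -
    have "dist (of_real (mid n)) (- of_real (mid m) :: complex) = norm (of_real (mid n + mid m) :: complex)"
      by (simp add: dist_norm)
    then show ?thesis using mid_pos[of n] mid_pos[of m] by (simp only: norm_of_real)
  qed
  then have "mid n + mid m < hi 0 + hi 0"
    using 1 2 dist_triangle2[of "of_real (mid n)" "- of_real (mid m)" "f b"] by linarith
  then show False using M[of n] M[of m] n(1) m(1) by simp
qed

lemma flat_radius_meets_open:
  assumes U: "open U" "z \<in> U" "(z :: complex) \<noteq> 0"
  shows "\<exists>w\<in>U. norm w \<in> flat"
proof -
  obtain e where e: "e > 0" "ball z e \<subseteq> U" using U openE by blast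
  obtain r where r: "r \<in> flat" "norm z < r" "r < norm z + e" using flat_dense[of "norm z" "norm z + e"] e(1) by auto
  define w where "w = of_real r * sgn z"
  have ns: "norm (sgn z) = 1" using U(3) by (simp add: norm_sgn)
  have r0: "r > 0" using r(2) by (meson le_less_trans norm_ge_zero)
  have "norm (z - w) = norm (of_real (norm z - r) * sgn z)"
    unfolding w_def by (subst norm_sgn_mult[of z, symmetric]) (simp add: algebra_simps)
  also have "\<dots> = \<bar>norm z - r\<bar>" using ns by (simp only: norm_mult norm_of_real mult_1_right)
  finally have "w \<in> ball z e" using r by (simp add: dist_norm)
  moreover have "norm w = r" using r0 ns by (simp add: w_def norm_mult)
  ultimately show ?thesis using e(2) r(1) by blast
qed

lemma spoke_segment:
  assumes z: "z \<in> base" "norm z \<in> flat"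
  shows "\<exists>q\<in>\<rat>. \<exists>u\<in>{u. u ^ N q = 1}. z \<in> closed_segment (of_real (lo q) * u) (of_real (hi q) * u)"
proof -
  define q where "q = stair (norm z)"
  have q: "q \<in> \<rat>" "lo q < norm z" "norm z < hi q" using z(2) flat_level_rational flat_iff by (auto simp: q_def)
  have "sgn z ^ N q = 1" using z by (simp add: base_def q_def)
  define s where "s = (norm z - lo q) / (hi q - lo q)"
  have "s * (hi q - lo q) = norm z - lo q" using q by (simp add: s_def)
  then have s3: "(1 - s) * lo q + s * hi q = norm z" by (simp add: algebra_simps)
  have s: "0 \<le> s" "s \<le> 1" using q by (simp_all add: s_def)
  have "z = of_real ((1 - s) * lo q + s * hi q) * sgn z" unfolding s3 by (rule norm_sgn_mult[symmetric])
  then have "z = (1 - s) *\<^sub>R (of_real (lo q) * sgn z) + s *\<^sub>R (of_real (hi q) * sgn z)"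
    by (simp add: scaleR_conv_of_real algebra_simps)
  then have "z \<in> closed_segment (of_real (lo q) * sgn z) (of_real (hi q) * sgn z)"
    using s unfolding in_segment by blast
  then show ?thesis using q(1) \<open>sgn z ^ N q = 1\<close> by blast
qed

text \<open>A nonempty open set away from the centre contains points whose radius lies in a gap.
  Over the open set of such radii the continuum consists of countably many segments, the spokes and
  the whiskers, so Baire category applies.\<close>

lemma interior_disc: "interior (disc x) = {}"
proof (rule ccontr)
  assume "interior (disc x) \<noteq> {}"
  then obtain z0 where z0: "z0 \<in> interior (disc x)" by blast
  then have "z0 \<noteq> 0" using disc_level[of z0] interior_subset stair_nonneg_imp_pos[of "norm z0"] by auto
  define U where "U = interior (disc x) \<inter> {w. norm w \<in> flat}"
  have "open {w :: complex. norm w \<in> flat}"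
    using open_vimage[OF open_flat, of norm] by (simp add: vimage_def continuous_on_norm)
  then have oU: "open U" by (simp add: U_def open_Int)
  have neU: "U \<noteq> {}" using flat_radius_meets_open[OF open_interior z0 \<open>z0 \<noteq> 0\<close>] by (auto simp: U_def)
  define \<F> where "\<F> = (\<Union>q\<in>\<rat>. (\<lambda>u. closed_segment (of_real (lo q) * u) (of_real (hi q) * u)) ` {u :: complex. u ^ N q = 1})
      \<union> (\<lambda>(n, j). closed_segment (pin n (x n)) (tip n j (x n))) ` UNIV"
  have "countable {u :: complex. u ^ N q = 1}" if "q \<in> \<rat>" for q
  proof (rule countable_finite)
    have "card {u :: complex. u ^ N q = 1} = N q" using N_ge_2[OF that] by (intro card_roots_unity_eq) simp
    then show "finite {u :: complex. u ^ N q = 1}" using N_ge_2[OF that] card.infinite by fastforce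
  qed
  then have "countable \<F>" unfolding \<F>_def using countable_rat by (intro countable_Un countable_UN countable_image) auto
  moreover have "closed T \<and> interior T = {}" if T: "T \<in> \<F>" for T
  proof -
    obtain a b :: complex where "T = closed_segment a b" using T by (auto simp: \<F>_def)
    then show ?thesis by (simp add: interior_closed_segment_ge2)
  qed
  ultimately have int: "interior (\<Union>\<F>) = {}" by (rule interior_countable_Union_closed_empty)
  have "U \<subseteq> \<Union>\<F>"
  proof
    fix w assume "w \<in> U"
    then have w: "w \<in> disc x" "norm w \<in> flat" using interior_subset by (auto simp: U_def)
    show "w \<in> \<Union>\<F>"
    proof (cases "w \<in> base")
      case True
      then show ?thesis using spoke_segment[OF True w(2)] unfolding \<F>_def by blast
    next
      case False
      then obtain n j where "w \<in> closed_segment (pin n (x n)) (tip n j (x n))" using w(1) by (auto simp: disc_def)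
      then show ?thesis unfolding \<F>_def by (intro UnionI[of "closed_segment (pin n (x n)) (tip n j (x n))"] UnI2) (auto intro!: image_eqI[of _ _ "(n, j)"])
    qed
  qed
  then have "U \<subseteq> interior (\<Union>\<F>)" using oU by (rule interior_maximal)
  then show False using int neU by blast
qed

lemma arm_in_disc:
  "(n, j) \<in> arms \<Longrightarrow> w \<in> closed_segment (pin n (x n)) (tip n j (x n)) \<Longrightarrow> w \<in> disc x" for x :: "nat \<Rightarrow> nat"
  unfolding disc_def by blast

text \<open>Late whiskers are short and rooted in \<open>base\<close>, so they lie in V wherever
  their feet are. Only finitely many coordinates of x matter.\<close>

lemma disc_subset_open: assumes V: "open V" shows "open {x. disc x \<subseteq> V}"
proof (cases "base \<subseteq> V")
  case False
  then have "{x. disc x \<subseteq> V} = {}" by (auto simp: disc_def)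
  then show ?thesis by simp
next
  case True
  obtain \<epsilon> where \<epsilon>: "\<epsilon> > 0" "(\<Union>z\<in>base. ball z \<epsilon>) \<subseteq> V"
    by (rule compact_subset_open_imp_ball_epsilon_subset[OF compact_base V True])
  obtain M where M: "(1/2 :: real) ^ M < \<epsilon>" using real_arch_pow_inv[of \<epsilon> "1/2"] \<epsilon>(1) by auto
  have small: "closed_segment (pin n k) (tip n j k) \<subseteq> V" if n: "n \<ge> M" "j \<le> Suc n" "k \<in> \<int>" for n j k
  proof -
    have "(1/2 :: real) ^ n \<le> (1/2) ^ M" using n(1) by (intro power_decreasing) auto
    then have "dist (pin n k) (tip n j k) < \<epsilon>" using dist_pin_tip[OF n(2), of k] M by linarith
    then have "closed_segment (pin n k) (tip n j k) \<subseteq> ball (pin n k) \<epsilon>"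
      using \<epsilon>(1) by (intro closed_segment_subset convex_ball) auto
    then show ?thesis using \<epsilon>(2) pin_in_base[OF n(3), of n] by blast
  qed
  show ?thesis
  proof (subst open_subopen, rule ballI)
    fix x assume x: "x \<in> {x. disc x \<subseteq> V}"
    have "cyl (pre x M) \<subseteq> {x. disc x \<subseteq> V}"
    proof (intro subsetI CollectI)
      fix y w assume y: "y \<in> cyl (pre x M)" and w: "w \<in> disc y"
      show "w \<in> V"
      proof (cases "w \<in> base")
        case False
        then obtain n j where nj: "(n, j) \<in> arms" "w \<in> closed_segment (pin n (y n)) (tip n j (y n))"
          using w by (auto simp: disc_def)
        show ?thesis
        proof (cases "n < M")
          case True
          then have "y n = x n" using y by (simp only: mem_cyl_pre)
          then have "w \<in> disc x" using nj by (intro arm_in_disc[of n j]) simp_all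
          then show ?thesis using x by blast
        next
          case False
          then show ?thesis using small[of n j "real (y n)"] nj by (auto simp: arms_def)
        qed
      qed (use True in blast)
    qed
    then show "\<exists>T. open T \<and> x \<in> T \<and> T \<subseteq> {x. disc x \<subseteq> V}"
      by (intro exI[of _ "cyl (pre x M)"]) (simp add: open_cyl mem_cyl_pre)
  qed
qed

text \<open>A given point of the continuum lies in \<open>base\<close> or on one whisker, whose
  position depends on a single coordinate; all sequences with the same prefix keep that
  point.\<close>

lemma disc_meets_open: "open {x. disc x \<inter> V \<noteq> {}}"
proof (subst open_subopen, rule ballI)
  fix x assume "x \<in> {x. disc x \<inter> V \<noteq> {}}"
  then obtain w where w: "w \<in> disc x" "w \<in> V" by blast
  have "\<exists>M. \<forall>y\<in>cyl (pre x M). w \<in> disc y"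
  proof (cases "w \<in> base")
    case True then show ?thesis by (simp add: disc_def)
  next
    case False
    then obtain n j where nj: "(n, j) \<in> arms" "w \<in> closed_segment (pin n (x n)) (tip n j (x n))"
      using w by (auto simp: disc_def)
    have "w \<in> disc y" if "y \<in> cyl (pre x (Suc n))" for y
    proof -
      have "y n = x n" using that unfolding mem_cyl_pre by simp
      then show ?thesis using nj by (intro arm_in_disc[of n j]) simp_all
    qed
    then show ?thesis by blast
  qed
  then obtain M where "\<forall>y\<in>cyl (pre x M). w \<in> disc y" by blast
  then have "cyl (pre x M) \<subseteq> {x. disc x \<inter> V \<noteq> {}}" using w(2) by blast
  then show "\<exists>T. open T \<and> x \<in> T \<and> T \<subseteq> {x. disc x \<inter> V \<noteq> {}}"
    by (intro exI[of _ "cyl (pre x M)"]) (simp add: open_cyl mem_cyl_pre)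
qed

end

section \<open>Transfer to the real plane and measurability of the parametrisation\<close>

definition emb :: "complex \<Rightarrow> real^2" where
  "emb z = (\<chi> i. if i = 1 then Re z else Im z)"

definition unemb :: "real^2 \<Rightarrow> complex" where
  "unemb v = Complex (v $ 1) (v $ 2)"

lemma unemb_emb [simp]: "unemb (emb z) = z"
  by (simp add: emb_def unemb_def)

lemma emb_unemb [simp]: "emb (unemb v) = v"
  by (simp add: emb_def unemb_def vec_eq_iff forall_2)

lemma continuous_emb: "continuous_on S emb"
proof -
  have "continuous_on S (\<lambda>z. if i = (1::2) then Re z else Im z)" for i
    by (cases "i = 1") (auto intro!: continuous_intros)
  then have "continuous_on S (\<lambda>z. \<chi> i. if i = (1::2) then Re z else Im z)"
    by (rule continuous_on_vec_lambda)
  then show ?thesis by (simp add: emb_def[abs_def])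
qed

lemma continuous_unemb: "continuous_on S unemb"
proof -
  have "continuous_on S (\<lambda>v :: real^2. of_real (v $ 1) + \<i> * of_real (v $ 2))" by (intro continuous_intros)
  then show ?thesis by (simp add: unemb_def[abs_def] Complex_eq)
qed

lemma homeomorphic_emb: "S homeomorphic emb ` S"
proof -
  have "homeomorphism S (emb ` S) emb unemb"
    by (rule homeomorphismI) (auto intro: continuous_emb continuous_unemb)
  then show ?thesis unfolding homeomorphic_def by blast
qed

lemma homeomorphic_emb_iff: "emb ` S homeomorphic emb ` T \<longleftrightarrow> S homeomorphic T"
  using homeomorphic_emb homeomorphic_trans homeomorphic_sym by metis

lemma open_emb_vimage: "open U \<Longrightarrow> open (emb -` U)"
  by (rule open_vimage[OF _ continuous_emb])

lemma interior_emb: assumes "interior S = {}" shows "interior (emb ` S) = {}"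
proof -
  have "open (emb -` interior (emb ` S))" by (rule open_emb_vimage) simp
  moreover have "emb -` interior (emb ` S) \<subseteq> S"
  proof
    fix z assume "z \<in> emb -` interior (emb ` S)"
    then have "emb z \<in> emb ` S" using interior_subset by auto
    then show "z \<in> S" by (metis imageE unemb_emb)
  qed
  ultimately have "emb -` interior (emb ` S) \<subseteq> interior S" by (rule interior_maximal[rotated])
  then have *: "emb -` interior (emb ` S) = {}" using assms by blast
  have "v \<notin> interior (emb ` S)" for v using * emb_unemb[of v] by (metis empty_iff vimageI)
  then show ?thesis by blast
qed

text \<open>The two hypotheses on open sets treat the subbasis, so preimages of Vietoris open sets
  are open, and Borel sets follow by induction. Complements in \<open>K_borel\<close> are taken
  within the compact sets, so that case uses the compactness of every value of \<Phi>.\<close>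

lemma borel_vietoris_preimage:
  fixes \<Phi> :: "'b::topological_space \<Rightarrow> 'a::topological_space set"
  assumes compact: "\<And>x. compact (\<Phi> x)"
    and sub: "\<And>U. open U \<Longrightarrow> open {x. \<Phi> x \<subseteq> U}"
    and meets: "\<And>U. open U \<Longrightarrow> open {x. \<Phi> x \<inter> U \<noteq> {}}"
    and B: "B \<in> K_borel"
  shows "{x. \<Phi> x \<in> B} \<in> sets borel"
proof -
  have op: "open {x. \<Phi> x \<in> W}" if "openin vietoris W" for W
  proof -
    have "generate_topology_on ({{K. compact K \<and> K \<subseteq> U} | U. open U} \<union> {{K. compact K \<and> K \<inter> U \<noteq> {}} | U. open U}) W"
      using that unfolding vietoris_def by (rule openin_topology_generated_by)
    then show ?thesis
    proof (induction rule: generate_topology_on.induct)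
      case Empty then show ?case by simp
    next
      case (Int a b)
      have "{x. \<Phi> x \<in> a \<inter> b} = {x. \<Phi> x \<in> a} \<inter> {x. \<Phi> x \<in> b}" by auto
      then show ?case using Int by (simp add: open_Int)
    next
      case (UN K)
      have "{x. \<Phi> x \<in> \<Union>K} = (\<Union>k\<in>K. {x. \<Phi> x \<in> k})" by auto
      then show ?case using UN by (simp add: open_UN)
    next
      case (Basis s)
      then consider U where "open U" "s = {K. compact K \<and> K \<subseteq> U}" | U where "open U" "s = {K. compact K \<and> K \<inter> U \<noteq> {}}"
        by blast
      then show ?case by cases (simp_all add: compact sub meets)
    qed
  qed
  have "B \<in> sigma_sets {K. compact K} {B. openin vietoris B}" using B by (simp add: K_borel_def)
  then show ?thesis
  proof (induction rule: sigma_sets.induct)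
    case (Basic a) then show ?case using op by (simp add: borel_open)
  next
    case Empty then show ?case by simp
  next
    case (Compl a)
    have "{x. \<Phi> x \<in> {K. compact K} - a} = UNIV - {x. \<Phi> x \<in> a}" using compact by auto
    then show ?case using Compl by (simp only:) (metis sets.compl_sets space_borel)
  next
    case (Union a)
    have "{x. \<Phi> x \<in> \<Union>(range a)} = (\<Union>i. {x. \<Phi> x \<in> a i})" by auto
    then show ?case using Union.IH by (simp only:) (rule sets.countable_UN, blast)
  qed
qed

context spinning_wheel begin

lemma disc_LC1: "emb ` disc x \<in> LC1"
proof -
  have hom: "disc x homeomorphic emb ` disc x" by (rule homeomorphic_emb)
  obtain p where p: "p \<in> base" using three_points by blast
  obtain p' where p': "p' \<in> base" "p' \<noteq> p" using three_points by blast
  have pd: "emb p \<in> emb ` disc x" "emb p' \<in> emb ` disc x" using p p' by (auto simp: disc_def)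
  have ne: "emb p \<noteq> emb p'" using p'(2) by (metis unemb_emb)
  have c: "compact (emb ` disc x)" by (rule compact_continuous_image[OF continuous_emb compact_disc])
  have con: "connected (emb ` disc x)" by (rule connected_continuous_image[OF continuous_emb connected_disc])
  have "locally connected (emb ` disc x)"
    using homeomorphic_locally[OF hom, of connected connected] locally_connected_disc homeomorphic_connectedness by blast
  moreover have "covering_dimension (emb ` disc x) 1"
    by (rule covering_dimension_planar[OF c interior_emb[OF interior_disc] con pd ne])
  ultimately show ?thesis using c con pd(1) by (auto simp: LC1_def)
qed

lemma borel_disc_preimage: "B \<in> K_borel \<Longrightarrow> {x. emb ` disc x \<in> B} \<in> sets borel"
proof (rule borel_vietoris_preimage)
  show "compact (emb ` disc x)" for x by (rule compact_continuous_image[OF continuous_emb compact_disc])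
  fix U :: "(real^2) set" assume "open U"
  then have "open (emb -` U)" by (rule open_emb_vimage)
  then show "open {x. emb ` disc x \<subseteq> U}" using disc_subset_open by (simp add: image_subset_iff_subset_vimage)
  have "emb ` disc x \<inter> U \<noteq> {} \<longleftrightarrow> disc x \<inter> emb -` U \<noteq> {}" for x by auto
  then show "open {x. emb ` disc x \<inter> U \<noteq> {}}" using disc_meets_open[of "emb -` U"] by simp
qed

lemma LC1_not_classifiable:
  "\<not> classifiable_by_countable_structures (LC1 :: (real^2) set set) (\<lambda>K L. K homeomorphic L)"
proof
  assume "classifiable_by_countable_structures (LC1 :: (real^2) set set) (\<lambda>K L. K homeomorphic L)"
  then obtain I ar f where "\<forall>K\<in>(LC1 :: (real^2) set set). f K \<in> Mod I ar"
    "\<forall>B\<in>Mod_sets I ar. {K\<in>LC1. f K \<in> B} \<in> K_borel"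
    "\<forall>K\<in>LC1. \<forall>L\<in>LC1. K homeomorphic L \<longleftrightarrow> iso_struct I ar (f K) (f L)"
    unfolding classifiable_by_countable_structures_def by (elim exE conjE)
  note f = this[rule_format]
  define g where "g x = f (emb ` disc x)" for x
  have iso: "iso_struct I ar (g x) (g y) \<longleftrightarrow> disc x homeomorphic disc y" for x y
    using f(3)[OF disc_LC1 disc_LC1] by (simp add: g_def homeomorphic_emb_iff)
  have borel: "{x. g x i xs} \<in> sets borel" if i: "i \<in> I" "length xs = ar i" for i xs
  proof -
    have "{R \<in> Mod I ar. R i xs} \<in> Mod_sets I ar"
      unfolding Mod_sets_def using i by (intro sigma_sets.Basic) blast
    from borel_disc_preimage[OF f(2)[OF this]] show ?thesis
      using disc_LC1 f(1)[OF disc_LC1] by (simp add: g_def)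
  qed
  have hom: "iso_struct I ar (g x) (g y)" if "\<forall>n. x n \<le> Suc (y n) \<and> y n \<le> Suc (x n)" for x y
    unfolding iso using that by (intro disc_homeomorphic) auto
  \<comment> \<open>The displacement \<open>2 ^ n div 2\<close> places the marked point at a half
    turn from the position 0, the farthest possible.\<close>
  obtain x z where xz: "iso_struct I ar (g x) (g z)" "\<forall>N. \<exists>n\<ge>N. x n = 0 \<and> z n = 0" "\<forall>N. \<exists>n\<ge>N. x n = 0 \<and> z n = 2 ^ n div 2"
    by (rule borel_homomorphism_far_isomorphic[of I ar g "\<lambda>n. 2 ^ n div 2", OF borel hom])
  then show False using disc_not_homeomorphic[OF xz(2,3)] by (simp add: iso)
qed

end

theorem theorem4p14:
  shows "\<not> classifiable_by_countable_structures (LC1 :: (real^2) set set) (\<lambda>K L. K homeomorphic L)"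
proof -
  obtain N :: "real \<Rightarrow> nat" where "\<forall>q\<in>\<rat>. 2 \<le> N q" "\<forall>m. finite {q\<in>\<rat> \<inter> {0..1}. N q \<le> m}"
    "\<forall>q\<in>\<rat>. 0 \<le> q \<longrightarrow> (\<forall>n. real (N q) * bump n q \<in> \<int>)"
    using spoke_numbers_exist by blast
  then have "spinning_wheel N" by unfold_locales blast+
  then show ?thesis by (rule spinning_wheel.LC1_not_classifiable)
qed

end
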